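(* Let $F=K_{a_1,\dots,a_k}$ be a complete multipartite graph ($k\ge 2$, $a_1,\dots,a_k$ positive integers). Then $\overline{\mathrm{ex}}(n,F)=O(n)$; that is, there is a constant $c=c(F)$ such that $\overline{\mathrm{ex}}(n,F)\le cn$ for all $n\ge |V(F)|$.
   Context: All graphs are simple and undirected. For graphs $F$ and $G$, an induced $F$-decomposition of $G$ is a collection $\{F_1,\dots,F_\ell\}$ of induced subgraphs of $G$, each isomorphic to $F$, which are pairwise edge-disjoint and whose edge sets together cover $E(G)$. For $n\ge |V(F)|$, $\mathrm{ex}(n,F)$ denotes the maximum number of edges in a graph of order $n$ admitting an induced $F$-decomposition, and $\overline{\mathrm{ex}}(n,F)=\binom{n}{2}-\mathrm{ex}(n,F)$. $K_{a_1,\dots,a_k}$ denotes the complete $k$-partite graph with partite classes of sizes $a_1,\dots,a_k$. *)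

theory Defs
  imports Complex_Main
begin

record 'a ugraph =
  verts :: "'a set"
  edges :: "'a set set"

definition simple_graph :: "'a ugraph \<Rightarrow> bool" where
  "simple_graph G \<longleftrightarrow> finite (verts G) \<and> edges G \<subseteq> {e. e \<subseteq> verts G \<and> card e = 2}"

definition induced_subgraph :: "'a ugraph \<Rightarrow> 'a ugraph \<Rightarrow> bool" where
  "induced_subgraph H G \<longleftrightarrow>
     verts H \<subseteq> verts G \<and> edges H = {e \<in> edges G. e \<subseteq> verts H}"

definition graph_iso :: "'a ugraph \<Rightarrow> 'b ugraph \<Rightarrow> bool" where
  "graph_iso G H \<longleftrightarrow>
     (\<exists>f. bij_betw f (verts G) (verts H) \<and>
       (\<forall>x\<in>verts G. \<forall>y\<in>verts G. {x, y} \<in> edges G \<longleftrightarrow> {f x, f y} \<in> edges H))"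

text \<open>The collection may be empty, so every edgeless graph has a decomposition.\<close>

definition induced_decomposition :: "'b ugraph \<Rightarrow> 'a ugraph \<Rightarrow> 'a ugraph set \<Rightarrow> bool" where
  "induced_decomposition F G D \<longleftrightarrow>
     finite D \<and>
     (\<forall>H\<in>D. induced_subgraph H G \<and> graph_iso H F) \<and>
     (\<forall>H\<in>D. \<forall>H'\<in>D. H \<noteq> H' \<longrightarrow> edges H \<inter> edges H' = {}) \<and>
     (\<Union>H\<in>D. edges H) = edges G"

text \<open>
  Every finite graph is isomorphic to one with vertices in \<^typ>\<open>nat\<close>, so it is enough to let
  the host graphs range over graphs on natural numbers. The set below is finite and nonempty
  (see \<open>ex_set_finite\<close>, \<open>ex_set_nonempty\<close>), so the maximum is the intended one.
\<close>

definition ex_set :: "nat \<Rightarrow> 'b ugraph \<Rightarrow> nat set" where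
  "ex_set n F = {card (edges G) | G :: nat ugraph.
     simple_graph G \<and> card (verts G) = n \<and> (\<exists>D. induced_decomposition F G D)}"

definition ex_num :: "nat \<Rightarrow> 'b ugraph \<Rightarrow> nat" where
  "ex_num n F = Max (ex_set n F)"

definition ex_bar :: "nat \<Rightarrow> 'b ugraph \<Rightarrow> int" where
  "ex_bar n F = int (n choose 2) - int (ex_num n F)"

text \<open>The vertex \<open>(i, j)\<close> is the \<open>j\<close>-th vertex of the \<open>i\<close>-th class, both counted from 0.\<close>

definition complete_multipartite :: "nat list \<Rightarrow> (nat \<times> nat) ugraph" where
  "complete_multipartite as =
     (let V = {(i, j). i < length as \<and> j < as ! i}
      in \<lparr>verts = V, edges = {{u, v} | u v. u \<in> V \<and> v \<in> V \<and> fst u \<noteq> fst v}\<rparr>)"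

lemma ex_set_le_choose:
  assumes "m \<in> ex_set n F"
  shows "m \<le> n choose 2"
proof -
  obtain G :: "nat ugraph" where G: "simple_graph G" "card (verts G) = n" "m = card (edges G)"
    using assms by (auto simp: ex_set_def)
  have fin: "finite (verts G)" and sub: "edges G \<subseteq> {e. e \<subseteq> verts G \<and> card e = 2}"
    using G(1) by (auto simp: simple_graph_def)
  have "card (edges G) \<le> card {e. e \<subseteq> verts G \<and> card e = 2}"
    using sub fin by (intro card_mono) auto
  then show ?thesis
    using n_subsets[OF fin, of 2] G by simp
qed

lemma ex_set_finite: "finite (ex_set n F)"
  using ex_set_le_choose by (metis finite_nat_set_iff_bounded_le)

lemma ex_set_nonempty: "ex_set n F \<noteq> {}"
proof -
  let ?G = "\<lparr>verts = {..<n}, edges = {}\<rparr> :: nat ugraph"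
  have "induced_decomposition F ?G {}"
    by (simp add: induced_decomposition_def)
  moreover have "simple_graph ?G" "card (verts ?G) = n"
    by (simp_all add: simple_graph_def)
  ultimately show ?thesis
    unfolding ex_set_def by blast
qed

lemma ex_bar_nonneg: "0 \<le> ex_bar n F"
  using ex_set_le_choose[OF Max_in[OF ex_set_finite ex_set_nonempty]]
  by (simp add: ex_bar_def ex_num_def)

lemma simple_graph_complete_multipartite: "simple_graph (complete_multipartite as)"
proof -
  have "{(i, j). i < length as \<and> j < as ! i} = (SIGMA i:{..<length as}. {..<as ! i})"
    by auto
  then have "finite {(i, j). i < length as \<and> j < as ! i}"
    by simp
  then show ?thesis
    by (auto simp: simple_graph_def complete_multipartite_def Let_def card_2_iff)
qed

end

theory Submission
  imports Defs "HOL-Number_Theory.Number_Theory" "HOL-Computational_Algebra.Polynomial_Factorial"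
    "HOL-Library.FuncSet"
begin

text \<open>
  Write \<open>K\<^sub>u[t]\<close> for the complete \<open>u\<close>-partite graph with classes of size \<open>t\<close>. If for some \<open>u\<close> and \<open>t\<close>
  both \<open>K\<^sub>u[t]\<close> and \<open>K\<^bsub>u+1\<^esub>[t]\<close> have induced \<open>F\<close>-decompositions, then any family of blocks of sizes
  \<open>u\<close> and \<open>u + 1\<close> with pairwise at most one common point, blown up by \<open>t\<close>, yields a graph with an
  induced \<open>F\<close>-decomposition. Block families that miss only \<open>O(n)\<close> pairs of \<open>n\<close> points come from
  writing \<open>n = u m + x\<close> with \<open>x \<le> m\<close> and \<open>m \<equiv> 1 (mod u!)\<close>: a truncated transversal design covers
  the pairs in different groups, and recursion inside the groups is lossless, since the number
  \<open>T(n)\<close> of missed pairs satisfies \<open>T(n) = u T(m) + T(x)\<close>.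

  The two blow-ups are decomposed in two steps, for a suitable prime \<open>Q\<close> and \<open>u = Q\<close>. First,
  \<open>K\<^sub>Q[t]\<close> decomposes into \<open>F\<close>: translate and scale base copies in the integers modulo \<open>Q\<close>
  whose differences lie in prescribed cosets of a subgroup of odd order and bounded index; such
  copies exist for large \<open>Q\<close> by a second moment argument. Second, \<open>K\<^sub>Q[w]\<close> and \<open>K\<^bsub>Q+1\<^esub>[w]\<close> decompose into \<open>K\<^sub>Q\<close> for a power \<open>w\<close> of
  \<open>Q - 1\<close>: the former by a transversal design, the latter by blowing up the affine plane of order \<open>Q\<close>
  with one point removed.
\<close>

section \<open>Decompositions into induced multipartite subgraphs\<close>

text \<open>Inducedness is the obstacle: every nonadjacent pair of a copy of \<open>F\<close> must
  be a non-edge of the host, which may have only linearly many non-edges. In a blow-up the fibres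
  are independent, so a copy whose classes each sit inside one fibre, with different classes in
  adjacent fibres, is induced automatically, and fibres of bounded size cost only O(n) pairs. Two
  consecutive block sizes are needed because truncating one group of a transversal design shortens a
  line by at most one point. The coset construction lives over a prime field and says nothing about
  \<open>Q + 1\<close> classes; the detour through cliques of order \<open>Q\<close> supplies that
  second size with the same fibres. Finally, the scaling subgroup must not contain -1, so its index
  absorbs the whole power of 2 in \<open>Q - 1\<close>, while the second moment argument wants
  \<open>Q\<close> large in terms of that index. A bound on this power of 2, uniform over infinitely
  many suitable primes, breaks the circle.\<close>

abbreviation mp_verts :: "nat list \<Rightarrow> (nat \<times> nat) set" where
  "mp_verts as \<equiv> {(i, j). i < length as \<and> j < as ! i}"

definition multipartite_on :: "nat list \<Rightarrow> ('a \<Rightarrow> 'a \<Rightarrow> bool) \<Rightarrow> 'a set \<Rightarrow> bool" where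
  "multipartite_on as E B \<longleftrightarrow>
     (\<exists>f. bij_betw f (mp_verts as) B \<and>
       (\<forall>u\<in>mp_verts as. \<forall>v\<in>mp_verts as. E (f u) (f v) \<longleftrightarrow> fst u \<noteq> fst v))"

text \<open>An edge lies in an induced subgraph exactly when both ends do, so vertex sets alone
  record the pieces, and covering plus edge-disjointness becomes unique existence. \<open>L\<close>
  is a set so that blocks of two sizes can be mixed.\<close>

definition decomposable :: "nat list set \<Rightarrow> 'a set \<Rightarrow> ('a \<Rightarrow> 'a \<Rightarrow> bool) \<Rightarrow> bool" where
  "decomposable L V E \<longleftrightarrow>
     (\<exists>\<B>. (\<forall>B\<in>\<B>. B \<subseteq> V \<and> (\<exists>as\<in>L. multipartite_on as E B)) \<and>
       (\<forall>x\<in>V. \<forall>y\<in>V. E x y \<longrightarrow> (\<exists>!B. B \<in> \<B> \<and> x \<in> B \<and> y \<in> B)))"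

abbreviation clique :: "nat \<Rightarrow> nat list" where
  "clique q \<equiv> replicate q 1"

abbreviation cross :: "'a \<times> 'b \<Rightarrow> 'a \<times> 'b \<Rightarrow> bool" where
  "cross p q \<equiv> fst p \<noteq> fst q"

lemma mp_verts_clique: "mp_verts (clique q) = (\<lambda>i. (i, 0)) ` {..<q}"
  by (auto simp: image_iff)

lemma multipartite_on_clique_iff:
  "multipartite_on (clique q) E B \<longleftrightarrow>
     finite B \<and> card B = q \<and> (\<forall>x\<in>B. \<forall>y\<in>B. E x y \<longleftrightarrow> x \<noteq> y)" (is "?L \<longleftrightarrow> ?R")
proof
  assume ?L
  then obtain f where f: "bij_betw f (mp_verts (clique q)) B"
    and E: "\<And>u v. u \<in> mp_verts (clique q) \<Longrightarrow> v \<in> mp_verts (clique q) \<Longrightarrow>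
              E (f u) (f v) \<longleftrightarrow> fst u \<noteq> fst v"
    unfolding multipartite_on_def by blast
  have "finite (mp_verts (clique q))" "card (mp_verts (clique q)) = q"
    unfolding mp_verts_clique by (auto simp: card_image inj_on_def)
  then have "finite B" "card B = q"
    using bij_betw_finite[OF f] bij_betw_same_card[OF f] by simp_all
  moreover have "E x y \<longleftrightarrow> x \<noteq> y" if xy: "x \<in> B" "y \<in> B" for x y
  proof -
    obtain u v where uv: "u \<in> mp_verts (clique q)" "v \<in> mp_verts (clique q)" "x = f u" "y = f v"
      using xy bij_betw_imp_surj_on[OF f] by blast
    have "f u = f v \<longleftrightarrow> u = v"
      using inj_on_eq_iff[OF bij_betw_imp_inj_on[OF f] uv(1,2)] .
    moreover have "u = v \<longleftrightarrow> fst u = fst v"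
      using uv(1,2) unfolding mp_verts_clique by auto
    ultimately show ?thesis
      using E[OF uv(1,2)] uv(3,4) by simp
  qed
  ultimately show ?R by blast
next
  assume R: ?R
  then obtain g where g: "bij_betw g {..<q} B"
    using ex_bij_betw_nat_finite[of B] by (auto simp: atLeast0LessThan)
  have "bij_betw fst (mp_verts (clique q)) {..<q}"
    unfolding mp_verts_clique by (auto simp: bij_betw_def inj_on_def image_image)
  then have b: "bij_betw (g \<circ> fst) (mp_verts (clique q)) B"
    using g by (rule bij_betw_trans)
  moreover have "E ((g \<circ> fst) u) ((g \<circ> fst) v) \<longleftrightarrow> fst u \<noteq> fst v"
    if "u \<in> mp_verts (clique q)" "v \<in> mp_verts (clique q)" for u v
  proof -
    have m: "fst u < q" "fst v < q" using that by auto
    then have "g (fst u) \<in> B" "g (fst v) \<in> B" "g (fst u) = g (fst v) \<longleftrightarrow> fst u = fst v"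
      using g by (auto simp: bij_betw_def inj_on_def)
    then show ?thesis using R by simp
  qed
  ultimately show ?L unfolding multipartite_on_def by blast
qed

lemma multipartite_on_transfer:
  assumes "multipartite_on as E B" "inj_on g B"
    and "\<And>x y. x \<in> B \<Longrightarrow> y \<in> B \<Longrightarrow> E' (g x) (g y) \<longleftrightarrow> E x y"
  shows "multipartite_on as E' (g ` B)"
proof -
  obtain f where f: "bij_betw f (mp_verts as) B"
    and E: "\<And>u v. u \<in> mp_verts as \<Longrightarrow> v \<in> mp_verts as \<Longrightarrow> E (f u) (f v) \<longleftrightarrow> fst u \<noteq> fst v"
    using assms(1) unfolding multipartite_on_def by blast
  have "bij_betw (g \<circ> f) (mp_verts as) (g ` B)"
    using f assms(2) by (meson bij_betw_trans inj_on_imp_bij_betw)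
  moreover have "E' ((g \<circ> f) u) ((g \<circ> f) v) \<longleftrightarrow> fst u \<noteq> fst v"
    if "u \<in> mp_verts as" "v \<in> mp_verts as" for u v
    using that E assms(3) f by (simp add: bij_betw_apply)
  ultimately show ?thesis unfolding multipartite_on_def by blast
qed

lemma decomposableE:
  assumes "decomposable L V E"
  obtains \<B> where "\<And>B. B \<in> \<B> \<Longrightarrow> B \<subseteq> V \<and> (\<exists>as\<in>L. multipartite_on as E B)"
    and "\<And>x y. x \<in> V \<Longrightarrow> y \<in> V \<Longrightarrow> E x y \<Longrightarrow> \<exists>!B. B \<in> \<B> \<and> x \<in> B \<and> y \<in> B"
proof -
  from assms obtain \<B> where a: "\<forall>B\<in>\<B>. B \<subseteq> V \<and> (\<exists>as\<in>L. multipartite_on as E B)"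
    and b: "\<forall>x\<in>V. \<forall>y\<in>V. E x y \<longrightarrow> (\<exists>!B. B \<in> \<B> \<and> x \<in> B \<and> y \<in> B)"
    unfolding decomposable_def by (elim exE conjE) (rule that)
  show thesis
    by (rule that[of \<B>]) (simp_all only: a[rule_format] b[rule_format] simp_thms)
qed

text \<open>Blocks arise as \<open>\<beta> p\<close> from parameters \<open>p\<close>. Uniqueness is
  asked of the parameter, which is what solving equations delivers, and it implies uniqueness of the
  block.\<close>

lemma decomposableI:
  assumes "\<And>p. p \<in> P \<Longrightarrow> \<beta> p \<subseteq> V"
    and "\<And>p. p \<in> P \<Longrightarrow> \<exists>as\<in>L. multipartite_on as E (\<beta> p)"
    and "\<And>x y. x \<in> V \<Longrightarrow> y \<in> V \<Longrightarrow> E x y \<Longrightarrow> \<exists>p\<in>P. x \<in> \<beta> p \<and> y \<in> \<beta> p"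
    and "\<And>x y p q. x \<in> V \<Longrightarrow> y \<in> V \<Longrightarrow> E x y \<Longrightarrow> p \<in> P \<Longrightarrow> q \<in> P \<Longrightarrow>
           x \<in> \<beta> p \<Longrightarrow> y \<in> \<beta> p \<Longrightarrow> x \<in> \<beta> q \<Longrightarrow> y \<in> \<beta> q \<Longrightarrow> p = q"
  shows "decomposable L V E"
  unfolding decomposable_def
proof (intro exI[of _ "\<beta> ` P"] conjI ballI impI)
  fix x y assume "x \<in> V" "y \<in> V" "E x y"
  then obtain p where "p \<in> P" "x \<in> \<beta> p" "y \<in> \<beta> p" "\<And>q. q \<in> P \<Longrightarrow> x \<in> \<beta> q \<Longrightarrow> y \<in> \<beta> q \<Longrightarrow> p = q"
    using assms(3,4) by metis
  then show "\<exists>!B. B \<in> \<beta> ` P \<and> x \<in> B \<and> y \<in> B" by blast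
next
  fix B assume "B \<in> \<beta> ` P"
  then obtain p where "p \<in> P" "B = \<beta> p" by blast
  then show "B \<subseteq> V" "\<exists>as\<in>L. multipartite_on as E B"
    using assms(1,2)[of p] by simp_all
qed

lemma decomposable_transfer:
  assumes dec: "decomposable L V E" and g: "bij_betw g V V'"
    and E: "\<And>x y. x \<in> V \<Longrightarrow> y \<in> V \<Longrightarrow> E' (g x) (g y) \<longleftrightarrow> E x y"
  shows "decomposable L V' E'"
proof -
  from dec obtain \<B> where B: "\<And>B. B \<in> \<B> \<Longrightarrow> B \<subseteq> V \<and> (\<exists>as\<in>L. multipartite_on as E B)"
    and ex: "\<And>x y. x \<in> V \<Longrightarrow> y \<in> V \<Longrightarrow> E x y \<Longrightarrow> \<exists>!B. B \<in> \<B> \<and> x \<in> B \<and> y \<in> B"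
    by (rule decomposableE) (rule that)
  have inj: "inj_on g V" and im: "g ` V = V'" using g by (auto simp: bij_betw_def)
  have mem: "g x \<in> g ` B \<longleftrightarrow> x \<in> B" if "x \<in> V" "B \<in> \<B>" for x B
    using inj that B by (meson inj_on_image_mem_iff)
  show ?thesis
  proof (rule decomposableI[of \<B> "\<lambda>B. g ` B"])
    fix B assume BB: "B \<in> \<B>"
    show "g ` B \<subseteq> V'" using B[OF BB] im by blast
    obtain as where "as \<in> L" "multipartite_on as E B" using B[OF BB] by blast
    then have "multipartite_on as E' (g ` B)"
      by (intro multipartite_on_transfer[of as E B]) (use B[OF BB] E inj in \<open>auto intro: inj_on_subset\<close>)
    then show "\<exists>as\<in>L. multipartite_on as E' (g ` B)" using \<open>as \<in> L\<close> by blast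
  next
    fix x' y' assume "x' \<in> V'" "y' \<in> V'" and E': "E' x' y'"
    then obtain x y where xy: "x \<in> V" "y \<in> V" "x' = g x" "y' = g y" using im by blast
    then have Exy: "E x y" using E' E by simp
    show "\<exists>B\<in>\<B>. x' \<in> g ` B \<and> y' \<in> g ` B"
      using ex[OF xy(1,2) Exy] xy by blast
    fix B C assume "B \<in> \<B>" "C \<in> \<B>" "x' \<in> g ` B" "y' \<in> g ` B" "x' \<in> g ` C" "y' \<in> g ` C"
    then show "B = C"
      using ex[OF xy(1,2) Exy] mem xy by metis
  qed
qed

text \<open>Wilson's fundamental construction: an edge upstairs projects to an edge of
  \<open>E\<close>, which selects one block, and the ingredient placed over that block selects one
  piece.\<close>

lemma decomposable_blowup:
  fixes V :: "'a set" and T :: "'b set"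
  assumes dec: "decomposable (clique ` K) V E"
    and ingr: "\<And>s. s \<in> K \<Longrightarrow> decomposable L ({..<s} \<times> T) cross"
  shows "decomposable L (V \<times> T) (\<lambda>p q. E (fst p) (fst q))"
proof -
  from dec obtain \<B> where B: "\<And>B. B \<in> \<B> \<Longrightarrow> B \<subseteq> V \<and> (\<exists>as\<in>clique ` K. multipartite_on as E B)"
    and ex: "\<And>x y. x \<in> V \<Longrightarrow> y \<in> V \<Longrightarrow> E x y \<Longrightarrow> \<exists>!B. B \<in> \<B> \<and> x \<in> B \<and> y \<in> B"
    by (rule decomposableE) (rule that)
  have BK: "card B \<in> K" "finite B" "\<And>x y. x \<in> B \<Longrightarrow> y \<in> B \<Longrightarrow> E x y \<longleftrightarrow> x \<noteq> y"
    if BB: "B \<in> \<B>" for B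
  proof -
    obtain q where "q \<in> K" "multipartite_on (clique q) E B" using B[OF BB] by blast
    then show "card B \<in> K" "finite B" "\<And>x y. x \<in> B \<Longrightarrow> y \<in> B \<Longrightarrow> E x y \<longleftrightarrow> x \<noteq> y"
      unfolding multipartite_on_clique_iff by blast+
  qed
  have "decomposable L (B \<times> T) (\<lambda>p q. E (fst p) (fst q))" if BB: "B \<in> \<B>" for B
  proof -
    obtain g where g: "bij_betw g {..<card B} B"
      using ex_bij_betw_nat_finite[OF BK(2)[OF BB]] by (auto simp: atLeast0LessThan)
    show ?thesis
    proof (rule decomposable_transfer[OF ingr[OF BK(1)[OF BB]]])
      show "bij_betw (map_prod g id) ({..<card B} \<times> T) (B \<times> T)"
        using g by (intro bij_betw_map_prod) auto
      fix p q assume "p \<in> {..<card B} \<times> T" "q \<in> {..<card B} \<times> T"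
      then have "g (fst p) \<in> B" "g (fst q) \<in> B" "g (fst p) = g (fst q) \<longleftrightarrow> fst p = fst q"
        using g by (auto simp: bij_betw_def inj_on_def)
      then show "E (fst (map_prod g id p)) (fst (map_prod g id q)) = cross p q"
        using BK(3)[OF BB] by simp
    qed
  qed
  then have "\<forall>B\<in>\<B>. decomposable L (B \<times> T) (\<lambda>p q. E (fst p) (fst q))" by blast
  from bchoice[OF this[unfolded decomposable_def]] obtain \<C> where
    C: "\<forall>B\<in>\<B>. (\<forall>C\<in>\<C> B. C \<subseteq> B \<times> T \<and> (\<exists>as\<in>L. multipartite_on as (\<lambda>p q. E (fst p) (fst q)) C)) \<and>
       (\<forall>x\<in>B \<times> T. \<forall>y\<in>B \<times> T. E (fst x) (fst y) \<longrightarrow> (\<exists>!C. C \<in> \<C> B \<and> x \<in> C \<and> y \<in> C))" ..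
  then have C1: "C \<subseteq> B \<times> T \<and> (\<exists>as\<in>L. multipartite_on as (\<lambda>p q. E (fst p) (fst q)) C)"
    if "B \<in> \<B>" "C \<in> \<C> B" for B C
    using that by simp
  have C2: "\<exists>!C. C \<in> \<C> B \<and> x \<in> C \<and> y \<in> C"
    if "B \<in> \<B>" "x \<in> B \<times> T" "y \<in> B \<times> T" "E (fst x) (fst y)" for B x y
    using C[rule_format, OF that(1), THEN conjunct2, rule_format, OF that(2-4)] .
  show ?thesis
    unfolding decomposable_def
  proof (intro exI[of _ "\<Union>B\<in>\<B>. \<C> B"] conjI ballI impI)
    fix C assume "C \<in> (\<Union>B\<in>\<B>. \<C> B)"
    then show "C \<subseteq> V \<times> T" "\<exists>as\<in>L. multipartite_on as (\<lambda>p q. E (fst p) (fst q)) C"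
      using C1 B by blast+
  next
    fix x y assume "x \<in> V \<times> T" "y \<in> V \<times> T" and Exy: "E (fst x) (fst y)"
    then have xy: "fst x \<in> V" "fst y \<in> V" "snd x \<in> T" "snd y \<in> T" by auto
    obtain B where BB: "B \<in> \<B>" "fst x \<in> B" "fst y \<in> B"
      and uB: "\<And>B'. B' \<in> \<B> \<Longrightarrow> fst x \<in> B' \<Longrightarrow> fst y \<in> B' \<Longrightarrow> B' = B"
      using ex[OF xy(1,2) Exy] by blast
    have xyB: "x \<in> B \<times> T" "y \<in> B \<times> T" using BB xy by (auto simp: mem_Times_iff)
    obtain C where C: "C \<in> \<C> B" "x \<in> C" "y \<in> C"
      and uC: "\<And>C'. C' \<in> \<C> B \<Longrightarrow> x \<in> C' \<Longrightarrow> y \<in> C' \<Longrightarrow> C' = C"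
      using C2[OF BB(1) xyB Exy] by blast
    show "\<exists>!C. C \<in> (\<Union>B\<in>\<B>. \<C> B) \<and> x \<in> C \<and> y \<in> C"
    proof (rule ex1I[of _ C])
      show "C \<in> (\<Union>B\<in>\<B>. \<C> B) \<and> x \<in> C \<and> y \<in> C" using C BB by blast
      fix C' assume C': "C' \<in> (\<Union>B\<in>\<B>. \<C> B) \<and> x \<in> C' \<and> y \<in> C'"
      then obtain B' where B': "B' \<in> \<B>" "C' \<in> \<C> B'" by blast
      then have "fst x \<in> B'" "fst y \<in> B'" using C1[OF B'] C' by (auto simp: mem_Times_iff)
      then have "B' = B" using uB B' by blast
      then show "C' = C" using uC B' C' by blast
    qed
  qed
qed

section \<open>Block designs missing linearly many pairs\<close>

text \<open>Cramer's rule modulo \<open>m\<close>: only the determinant has to be a unit, so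
  \<open>m\<close> may be composite.\<close>

lemma ex_solution_2x2:
  fixes x y x' y' v v' m :: int
  assumes m: "m > 0" and cop: "coprime (x * y' - x' * y) m" and v: "v \<in> {0..<m}" "v' \<in> {0..<m}"
  obtains a b where "a \<in> {0..<m}" "b \<in> {0..<m}" "(a * x + b * y) mod m = v" "(a * x' + b * y') mod m = v'"
proof -
  let ?D = "x * y' - x' * y"
  obtain c where c: "[?D * c = 1] (mod m)" using cop cong_solve_coprime_int by blast
  define a where "a = (c * (v * y' - v' * y)) mod m"
  define b where "b = (c * (x * v' - x' * v)) mod m"
  have ab: "[a = c * (v * y' - v' * y)] (mod m)" "[b = c * (x * v' - x' * v)] (mod m)"
    unfolding a_def b_def by simp_all
  have "[a * x + b * y = c * (v * y' - v' * y) * x + c * (x * v' - x' * v) * y] (mod m)"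
    by (intro cong_add cong_scalar_right ab)
  also have "c * (v * y' - v' * y) * x + c * (x * v' - x' * v) * y = (?D * c) * v" by (simp add: algebra_simps)
  also have "[\<dots> = 1 * v] (mod m)" by (rule cong_scalar_right[OF c])
  finally have 1: "(a * x + b * y) mod m = v" using v by (simp add: cong_def)
  have "[a * x' + b * y' = c * (v * y' - v' * y) * x' + c * (x * v' - x' * v) * y'] (mod m)"
    by (intro cong_add cong_scalar_right ab)
  also have "c * (v * y' - v' * y) * x' + c * (x * v' - x' * v) * y' = (?D * c) * v'" by (simp add: algebra_simps)
  also have "[\<dots> = 1 * v'] (mod m)" by (rule cong_scalar_right[OF c])
  finally have 2: "(a * x' + b * y') mod m = v'" using v by (simp add: cong_def)
  show thesis by (rule that[OF _ _ 1 2]) (use m in \<open>simp_all add: a_def b_def\<close>)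
qed

lemma solution_2x2_unique:
  fixes x y x' y' m :: int
  assumes cop: "coprime (x * y' - x' * y) m"
    and ab: "a \<in> {0..<m}" "b \<in> {0..<m}" "a' \<in> {0..<m}" "b' \<in> {0..<m}"
    and 1: "(a * x + b * y) mod m = (a' * x + b' * y) mod m"
    and 2: "(a * x' + b * y') mod m = (a' * x' + b' * y') mod m"
  shows "a = a' \<and> b = b'"
proof -
  let ?D = "x * y' - x' * y"
  have 1: "[a * x + b * y = a' * x + b' * y] (mod m)" and 2: "[a * x' + b * y' = a' * x' + b' * y'] (mod m)"
    using 1 2 by (simp_all add: cong_def)
  have "[(a * x + b * y) * y' - (a * x' + b * y') * y = (a' * x + b' * y) * y' - (a' * x' + b' * y') * y] (mod m)"
    by (intro cong_diff cong_scalar_right 1 2)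
  then have "[a * ?D = a' * ?D] (mod m)" by (simp add: algebra_simps)
  then have "[a = a'] (mod m)" using cop by (metis cong_mult_rcancel)
  moreover have "[(a * x' + b * y') * x - (a * x + b * y) * x' = (a' * x' + b' * y') * x - (a' * x + b' * y) * x'] (mod m)"
    by (intro cong_diff cong_scalar_right 1 2)
  then have "[b * ?D = b' * ?D] (mod m)" by (simp add: algebra_simps)
  then have "[b = b'] (mod m)" using cop by (metis cong_mult_rcancel)
  ultimately show ?thesis using ab by (simp add: cong_def)
qed

lemma ex_line_through:
  fixes i j m y z :: int
  assumes "m > 0" "coprime (i - j) m" "y \<in> {0..<m}" "z \<in> {0..<m}"
  obtains a b where "a \<in> {0..<m}" "b \<in> {0..<m}" "(a + b * i) mod m = y" "(a + b * j) mod m = z"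
  proof -
  have "coprime (1 * i - 1 * j) m" using assms(2) by simp
  from ex_solution_2x2[OF assms(1) this assms(4,3)] show thesis using that by auto
qed

lemma line_through_unique:
  fixes i j m :: int
  assumes "coprime (i - j) m" "a \<in> {0..<m}" "b \<in> {0..<m}" "a' \<in> {0..<m}" "b' \<in> {0..<m}"
    and "(a + b * i) mod m = (a' + b' * i) mod m" "(a + b * j) mod m = (a' + b' * j) mod m"
  shows "a = a' \<and> b = b'"
  using solution_2x2_unique[of 1 i 1 j m a b a' b'] assms by simp

text \<open>Missed pairs are ordered and include the diagonal. The bound has no additive term, so
  bounds with the same \<open>c\<close> add up over a partition into groups, as the recursion
  requires.\<close>

definition near_complete :: "nat list set \<Rightarrow> nat \<Rightarrow> nat \<Rightarrow> bool" where
  "near_complete L c n \<longleftrightarrow>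
     (\<exists>E. symp E \<and> irreflp E \<and> decomposable L {..<n} E \<and>
       card {(x, y). x < n \<and> y < n \<and> \<not> E x y} \<le> c * n)"

lemma near_completeI:
  fixes V :: "'a set"
  assumes V: "finite V" "card V = n" and E: "symp E" "irreflp E"
    and dec: "decomposable L V E"
    and miss: "card {(x, y). x \<in> V \<and> y \<in> V \<and> \<not> E x y} \<le> c * n"
  shows "near_complete L c n"
proof -
  obtain g where g: "bij_betw g {..<n} V"
    using ex_bij_betw_nat_finite[OF V(1)] V(2) by (auto simp: atLeast0LessThan)
  define h where "h = inv_into {..<n} g"
  have h: "bij_betw h V {..<n}" unfolding h_def using g by (rule bij_betw_inv_into)
  have gh: "g (h x) = x" if "x \<in> V" for x
    unfolding h_def using g that by (simp add: bij_betw_inv_into_right)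
  let ?E = "\<lambda>x y. E (g x) (g y)"
  have "decomposable L {..<n} ?E"
    by (rule decomposable_transfer[OF dec h]) (simp add: gh)
  moreover have "bij_betw (map_prod g g) {(x, y). x < n \<and> y < n \<and> \<not> ?E x y}
      {(x, y). x \<in> V \<and> y \<in> V \<and> \<not> E x y}"
  proof (rule bij_betw_subset)
    show "bij_betw (map_prod g g) ({..<n} \<times> {..<n}) (V \<times> V)" using g by (intro bij_betw_map_prod)
    show "map_prod g g ` {(x, y). x < n \<and> y < n \<and> \<not> ?E x y} = {(x, y). x \<in> V \<and> y \<in> V \<and> \<not> E x y}"
    proof (intro equalityI subsetI)
      fix p assume "p \<in> {(x, y). x \<in> V \<and> y \<in> V \<and> \<not> E x y}"
      then obtain x y where p: "p = (x, y)" "x \<in> V" "y \<in> V" "\<not> E x y" by auto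
      then have "p = map_prod g g (h x, h y)" "h x < n" "h y < n"
        using gh h by (auto dest: bij_betwE)
      then show "p \<in> map_prod g g ` {(x, y). x < n \<and> y < n \<and> \<not> ?E x y}"
        using p gh by (intro image_eqI[of _ _ "(h x, h y)"]) auto
    qed (use g in \<open>auto dest: bij_betwE\<close>)
  qed auto
  then have "card {(x, y). x < n \<and> y < n \<and> \<not> ?E x y} = card {(x, y). x \<in> V \<and> y \<in> V \<and> \<not> E x y}"
    by (rule bij_betw_same_card)
  moreover have "symp ?E" "irreflp ?E" using E by (auto simp: symp_def irreflp_def)
  ultimately show ?thesis unfolding near_complete_def using miss by (intro exI[of _ ?E]) simp
qed

text \<open>The points form \<open>u\<close> full groups of size \<open>m\<close> and one group cut
  down to \<open>x\<close> points. Group numbers differ by at most \<open>u\<close>, hence by units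
  modulo \<open>m\<close>, so two points of different groups lie on exactly one line
  \<open>a + b * i\<close>. All missed pairs lie inside groups, and the group sizes add up to
  \<open>u * m + x\<close>.\<close>

lemma near_complete_step:
  assumes u: "\<And>d. 0 < d \<Longrightarrow> d \<le> u \<Longrightarrow> coprime d m" and m: "m > 0" and x: "x \<le> m"
    and nc: "near_complete (clique ` {u, u + 1}) c m" "near_complete (clique ` {u, u + 1}) c x"
  shows "near_complete (clique ` {u, u + 1}) c (u * m + x)"
proof -
  let ?L = "clique ` {u, u + 1}"
  define w where "w i = (if i < u then m else x)" for i
  have "\<forall>i. \<exists>E. symp E \<and> irreflp E \<and> decomposable ?L {..<w i} E \<and>
       card {(x, y). x < w i \<and> y < w i \<and> \<not> E x y} \<le> c * w i"
    using nc unfolding near_complete_def w_def by simp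
  from choice[OF this] obtain \<E> where symE: "\<And>i. symp (\<E> i)" and irrE: "\<And>i. irreflp (\<E> i)"
    and decE: "\<And>i. decomposable ?L {..<w i} (\<E> i)"
    and missE: "\<And>i. card {(x, y). x < w i \<and> y < w i \<and> \<not> \<E> i x y} \<le> c * w i"
    by blast
  have decE': "\<forall>i. decomposable ?L {..<w i} (\<E> i)" using decE ..
  have "\<forall>i. \<exists>\<B>. (\<forall>B\<in>\<B>. B \<subseteq> {..<w i} \<and> (\<exists>as\<in>?L. multipartite_on as (\<E> i) B)) \<and>
       (\<forall>x\<in>{..<w i}. \<forall>y\<in>{..<w i}. \<E> i x y \<longrightarrow> (\<exists>!B. B \<in> \<B> \<and> x \<in> B \<and> y \<in> B))"
    using decE' unfolding decomposable_def .
  from choice[OF this] obtain \<B> where \<B>: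
    "\<forall>i. (\<forall>B\<in>\<B> i. B \<subseteq> {..<w i} \<and> (\<exists>as\<in>?L. multipartite_on as (\<E> i) B)) \<and>
       (\<forall>x\<in>{..<w i}. \<forall>y\<in>{..<w i}. \<E> i x y \<longrightarrow> (\<exists>!B. B \<in> \<B> i \<and> x \<in> B \<and> y \<in> B))" ..
  have B1: "B \<subseteq> {..<w i}" "\<exists>as\<in>?L. multipartite_on as (\<E> i) B" if "B \<in> \<B> i" for B i
    using \<B>[rule_format, of i, THEN conjunct1, rule_format, OF that] by simp_all
  have B2: "\<exists>!B. B \<in> \<B> i \<and> a \<in> B \<and> b \<in> B" if "a < w i" "b < w i" "\<E> i a b" for i a b
    using \<B>[rule_format, of i, THEN conjunct2, rule_format, of a b] that by simp
  define V where "V = (SIGMA i:{..u}. {..<w i})"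
  define E where "E p q \<longleftrightarrow> fst p \<noteq> fst q \<or> \<E> (fst p) (snd p) (snd q)" for p q :: "nat \<times> nat"
  define line where
    "line ab = {p \<in> V. int (snd p) = (fst ab + snd ab * int (fst p)) mod int m}" for ab :: "int \<times> int"
  define R where "R = {0..<int m} \<times> {0..<int m}"
  define P where "P = Inl ` R \<union> Inr ` (SIGMA i:{..u}. \<B> i)"
  define \<beta> where "\<beta> p = (case p of Inl ab \<Rightarrow> line ab | Inr (i, B) \<Rightarrow> Pair i ` B)" for p
  have w_le: "w i \<le> m" for i unfolding w_def using x by simp
  have cop: "coprime (int i - int j) (int m)" if "i \<le> u" "j \<le> u" "i \<noteq> j" for i j
  proof -
    have "coprime (nat \<bar>int i - int j\<bar>) m" by (rule u) (use that in auto)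
    then have "coprime (\<bar>int i - int j\<bar>) (int m)" by (metis coprime_int_iff int_nat_eq abs_ge_zero)
    then show ?thesis by simp
  qed
  have "decomposable ?L V E"
  proof (rule decomposableI[of P \<beta>])
    fix p assume "p \<in> P"
    then consider (line) a b where "p = Inl (a, b)" "(a, b) \<in> R"
      | (group) i B where "p = Inr (i, B)" "i \<le> u" "B \<in> \<B> i" unfolding P_def by auto
    then have "\<beta> p \<subseteq> V \<and> (\<exists>as\<in>?L. multipartite_on as E (\<beta> p))"
    proof cases
      case group
      have "multipartite_on as E (Pair i ` B)" if "multipartite_on as (\<E> i) B" for as
        by (rule multipartite_on_transfer[OF that]) (auto simp: E_def inj_on_def)
      then show ?thesis using group B1[OF group(3)] by (auto simp: \<beta>_def V_def)
    next
      case line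
      define v where "v i = nat ((a + b * int i) mod int m)" for i
      have v: "v i < m" "int (v i) = (a + b * int i) mod int m" for i
        unfolding v_def using m by (simp_all add: nat_less_iff)
      define I where "I = {i. i \<le> u \<and> v i < w i}"
      \<comment> \<open>A line can lose a point only in group \<open>u\<close>, when its value there
        is cut off; this gives the sizes \<open>u\<close> and \<open>u + 1\<close>.\<close>
      have I: "I = (if v u < x then {..u} else {..<u})"
      proof -
        have *: "i \<in> I \<longleftrightarrow> i \<in> (if v u < x then {..u} else {..<u})" for i
          unfolding I_def w_def using v(1)[of i] by (cases "i = u") auto
        show ?thesis by (rule Set.set_eqI) (rule *)
      qed
      have eq: "\<beta> p = (\<lambda>i. (i, v i)) ` I"
      proof (intro equalityI subsetI)
        fix q assume "q \<in> \<beta> p"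
        then have q: "q \<in> V" "int (snd q) = int (v (fst q))" by (auto simp: \<beta>_def line line_def v(2))
        then have "q = (fst q, v (fst q))" by (simp add: prod_eq_iff)
        moreover have "fst q \<in> I" using q by (auto simp: I_def V_def)
        ultimately show "q \<in> (\<lambda>i. (i, v i)) ` I" by blast
      next
        fix q assume "q \<in> (\<lambda>i. (i, v i)) ` I"
        then show "q \<in> \<beta> p" by (auto simp: \<beta>_def line line_def v(2) I_def V_def)
      qed
      have fin: "finite I" "card I \<in> {u, u + 1}" unfolding I by auto
      have "card (\<beta> p) = card I" unfolding eq by (rule card_image) (auto simp: inj_on_def)
      moreover have "\<forall>q\<in>\<beta> p. \<forall>r\<in>\<beta> p. E q r \<longleftrightarrow> q \<noteq> r"
        unfolding eq E_def using irrE by (auto simp: irreflp_def)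
      ultimately have "multipartite_on (clique (card I)) E (\<beta> p)"
        unfolding multipartite_on_clique_iff using fin eq by simp
      then show ?thesis using fin(2) by (auto simp: \<beta>_def line line_def)
    qed
    then show "\<beta> p \<subseteq> V" "\<exists>as\<in>?L. multipartite_on as E (\<beta> p)" by simp_all
  next
    fix p q assume pq: "p \<in> V" "q \<in> V" "E p q"
    obtain i a j b where pq_eq: "p = (i, a)" "q = (j, b)" by fastforce
    have ia: "i \<le> u" "a < w i" "j \<le> u" "b < w j" using pq pq_eq by (auto simp: V_def)
    have lt: "a < m" "b < m" using ia w_le by (meson less_le_trans)+
    show "\<exists>r\<in>P. p \<in> \<beta> r \<and> q \<in> \<beta> r"
    proof (cases "i = j")
      case True
      then have "\<E> i a b" using pq(3) by (simp add: E_def pq_eq)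
      then obtain B where "B \<in> \<B> i" "a \<in> B" "b \<in> B" using B2[of a i b] ia True by blast
      then show ?thesis using ia True
        by (intro bexI[of _ "Inr (i, B)"]) (auto simp: P_def \<beta>_def pq_eq)
    next
      case False
      obtain s t where "s \<in> {0..<int m}" "t \<in> {0..<int m}"
        "(s + t * int i) mod int m = int a" "(s + t * int j) mod int m = int b"
        using ex_line_through[of "int m" "int i" "int j" "int a" "int b"] m cop[OF ia(1,3) False] lt by auto
      then show ?thesis using pq pq_eq
        by (intro bexI[of _ "Inl (s, t)"]) (auto simp: P_def R_def \<beta>_def line_def)
    qed
    fix r s assume rs: "r \<in> P" "s \<in> P" "p \<in> \<beta> r" "q \<in> \<beta> r" "p \<in> \<beta> s" "q \<in> \<beta> s"
    show "r = s"
    proof (cases "i = j")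
      case True
      \<comment> \<open>A line has at most one point in each group, so two distinct points of one
        group share only blocks of that group.\<close>
      have irr: "a \<noteq> b" using pq(3) irrE[of i] True by (auto simp: E_def pq_eq irreflp_def)
      have *: "\<exists>B. r = Inr (i, B) \<and> B \<in> \<B> i \<and> a \<in> B \<and> b \<in> B" if "r \<in> P" "p \<in> \<beta> r" "q \<in> \<beta> r" for r
        using that irr True by (auto simp: P_def \<beta>_def pq_eq line_def)
      have "\<E> i a b" using pq(3) True by (simp add: E_def pq_eq)
      then have "\<exists>!B. B \<in> \<B> i \<and> a \<in> B \<and> b \<in> B" using B2[of a i b] ia True by blast
      then show ?thesis using *[OF rs(1,3,4)] *[OF rs(2,5,6)] by blast
    next
      case False
      have *: "\<exists>c d. r = Inl (c, d) \<and> c \<in> {0..<int m} \<and> d \<in> {0..<int m} \<and>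
          int a = (c + d * int i) mod int m \<and> int b = (c + d * int j) mod int m"
        if "r \<in> P" "p \<in> \<beta> r" "q \<in> \<beta> r" for r
        using that False by (auto simp: P_def R_def \<beta>_def pq_eq line_def)
      obtain c d where 1: "r = Inl (c, d)" "c \<in> {0..<int m}" "d \<in> {0..<int m}"
          "int a = (c + d * int i) mod int m" "int b = (c + d * int j) mod int m"
        using *[OF rs(1,3,4)] by blast
      obtain c' d' where 2: "s = Inl (c', d')" "c' \<in> {0..<int m}" "d' \<in> {0..<int m}"
          "int a = (c' + d' * int i) mod int m" "int b = (c' + d' * int j) mod int m"
        using *[OF rs(2,5,6)] by blast
      have "c = c' \<and> d = d'"
        by (rule line_through_unique[OF cop[OF ia(1,3) False] 1(2,3) 2(2,3)]) (use 1 2 in simp_all)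
      then show ?thesis using 1 2 by simp
    qed
  qed
  moreover have "finite V" "card V = u * m + x"
  proof -
    show "finite V" unfolding V_def by auto
    have "card V = (\<Sum>i\<le>u. w i)" unfolding V_def by simp
    also have "{..u} = insert u {..<u}" by auto
    also have "sum w (insert u {..<u}) = x + (\<Sum>i<u. w i)" by (simp add: w_def)
    also have "(\<Sum>i<u. w i) = u * m" by (simp add: w_def)
    finally show "card V = u * m + x" by simp
  qed
  moreover have "symp E" "irreflp E"
    using symE irrE by (auto simp: E_def symp_def irreflp_def)
  moreover have "card {(p, q). p \<in> V \<and> q \<in> V \<and> \<not> E p q} \<le> c * (u * m + x)"
  proof -
    let ?M = "\<lambda>i. {(x, y). x < w i \<and> y < w i \<and> \<not> \<E> i x y}"
    have fin: "finite (?M i)" for i by (rule finite_subset[of _ "{..<w i} \<times> {..<w i}"]) auto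
    have "{(p, q). p \<in> V \<and> q \<in> V \<and> \<not> E p q} \<subseteq> (\<lambda>(i, x, y). ((i, x), (i, y))) ` (SIGMA i:{..u}. ?M i)"
      by (force simp: V_def E_def image_iff)
    then have "card {(p, q). p \<in> V \<and> q \<in> V \<and> \<not> E p q} \<le> card (SIGMA i:{..u}. ?M i)"
      using fin by (intro surj_card_le) auto
    also have "\<dots> = (\<Sum>i\<le>u. card (?M i))" using fin by (intro card_SigmaI) auto
    also have "\<dots> \<le> (\<Sum>i\<le>u. c * w i)" by (intro sum_mono missE)
    also have "\<dots> = c * (\<Sum>i\<le>u. w i)" by (simp add: sum_distrib_left)
    also have "(\<Sum>i\<le>u. w i) = card V" unfolding V_def by simp
    finally show ?thesis using \<open>card V = u * m + x\<close> by simp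
  qed
  ultimately show ?thesis by (intro near_completeI)
qed

lemma ex_near_complete:
  assumes u: "u \<ge> 2"
  obtains c where "\<And>n. near_complete (clique ` {u, u + 1}) c n"
proof -
  define l :: nat where "l = fact u"
  \<comment> \<open>For \<open>n < c\<close> the empty graph misses \<open>n * n \<le> c * n\<close>
    pairs. For \<open>n \<ge> c\<close> the quotient \<open>n div u\<close> is at least
    \<open>(u + 1) * l\<close>, which makes the group size below at least
    \<open>u * l\<close>.\<close>
  define c where "c = 2 * (u + 1) * (u + 1) * l"
  have l: "l > 0" unfolding l_def by simp
  have "near_complete (clique ` {u, u + 1}) c n" for n
  proof (induction n rule: less_induct)
    case (less n)
    show ?case
    proof (cases "n < c")
      case True
      have "decomposable (clique ` {u, u + 1}) {..<n} (\<lambda>_ _. False)"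
        unfolding decomposable_def by (rule exI[of _ "{}"]) simp
      moreover have "card {(x, y). x < n \<and> y < n \<and> \<not> False} \<le> c * n"
      proof -
        have "{(x, y). x < n \<and> y < n \<and> \<not> False} = {..<n} \<times> {..<n}" by auto
        then show ?thesis using True by (simp add: card_cartesian_product)
      qed
      ultimately show ?thesis
        unfolding near_complete_def
        by (intro exI[of _ "\<lambda>_ _. False"]) (auto simp: symp_def irreflp_def)
    next
      case False
      \<comment> \<open>This makes \<open>m\<close> the largest number up to \<open>n div u\<close>
        that is 1 modulo \<open>l\<close>. The remainder \<open>n - u * m\<close> is then below
        \<open>u * l\<close>, and \<open>u * l \<le> m\<close>.\<close>
      define k where "k = (n div u - 1) div l"
      define m where "m = 1 + l * k"
      have "(u + 1) * l * u \<le> n" using False unfolding c_def by (simp add: algebra_simps)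
      then have ul: "(u + 1) * l \<le> n div u" using u by (simp add: less_eq_div_iff_mult_less_eq)
      then have nu: "n div u \<ge> 1" using l by (cases "n div u = 0") auto
      have kl: "l * k \<le> n div u - 1" "n div u - 1 < l * k + l"
        unfolding k_def using times_div_less_eq_dividend[of l "n div u - 1"]
          dividend_less_times_div[OF l, of "n div u - 1"] by simp_all
      have "m \<le> n div u" using kl nu unfolding m_def by linarith
      then have um: "u * m \<le> n" using u by (metis le_trans mult_le_mono2 div_times_less_eq_dividend mult.commute)
      have "n div u < m + l" using kl nu unfolding m_def by linarith
      then have "n < u * (m + l)" using u by (simp add: div_less_iff_less_mult mult.commute)
      moreover have "u * l \<le> m"
        using ul \<open>n div u < m + l\<close> by (simp add: algebra_simps)
      ultimately have x: "n - u * m \<le> m" by (simp add: algebra_simps)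
      have m0: "m > 0" by (simp add: m_def)
      have mn: "m < n" "n - u * m < n"
      proof -
        have "2 * m \<le> u * m" using u by (rule mult_le_mono1)
        then show "m < n" "n - u * m < n" using um m0 by linarith+
      qed
      have "near_complete (clique ` {u, u + 1}) c (u * m + (n - u * m))"
      proof (rule near_complete_step[OF _ m0 x less.IH[OF mn(1)] less.IH[OF mn(2)]])
        fix d assume "0 < d" "d \<le> u"
        then have "d dvd l" unfolding l_def by (simp add: dvd_fact)
        then have "coprime l m \<Longrightarrow> coprime d m" by (meson coprime_divisors dvd_refl)
        moreover have "coprime l m" unfolding m_def
          by (metis coprime_1_right coprime_iff_gcd_eq_1 gcd_add_mult mult.commute add.commute)
        ultimately show "coprime d m" by simp
      qed
      then show ?thesis using um by simp
    qed
  qed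
  then show thesis by (rule that)
qed

section \<open>Decomposing blow-ups of cliques into cliques\<close>

lemma decomposable_regroup:
  assumes dec: "decomposable L ((I \<times> A) \<times> B) (\<lambda>p q. cross (fst p) (fst q))"
    and fin: "finite A" "finite B"
  shows "decomposable L (I \<times> {..<card A * card B}) cross"
proof -
  have "finite (A \<times> B)" "card (A \<times> B) = card A * card B" using fin by (simp_all add: card_cartesian_product)
  then obtain g where g: "bij_betw g (A \<times> B) {..<card A * card B}"
    using ex_bij_betw_finite_nat[of "A \<times> B"] by (auto simp: atLeast0LessThan)
  show ?thesis
  proof (rule decomposable_transfer[OF dec])
    have "bij_betw (\<lambda>((i, a), b). (i, (a, b))) ((I \<times> A) \<times> B) (I \<times> (A \<times> B))"
      by (rule bij_betw_byWitness[where f' = "\<lambda>(i, (a, b)). ((i, a), b)"]) auto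
    moreover have "bij_betw (map_prod id g) (I \<times> (A \<times> B)) (I \<times> {..<card A * card B})"
      using g by (intro bij_betw_map_prod) auto
    ultimately show "bij_betw (map_prod id g \<circ> (\<lambda>((i, a), b). (i, (a, b)))) ((I \<times> A) \<times> B) (I \<times> {..<card A * card B})"
      by (rule bij_betw_trans)
  qed auto
qed

text \<open>Point \<open>(i, v)\<close> stands for the nonzero vector \<open>(X i, Y i) / v\<close>
  of the plane. The groups are the lines through the origin without the origin, and block
  \<open>(a, b)\<close> is the line \<open>a x + b y = 1\<close>; it is parallel to exactly one line
  through the origin, so it meets \<open>Q\<close> of the \<open>Q + 1\<close> groups.\<close>

lemma decomposable_punctured_plane:
  assumes Q: "prime Q"
  shows "decomposable {clique Q} ({..<Q + 1} \<times> {..<Q - 1}) cross"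
proof -
  have Q1: "Q > 1" using Q by (rule prime_gt_1_nat)
  have pQ: "prime (int Q)" using Q by simp
  \<comment> \<open>\<open>(X i, Y i)\<close> runs through the \<open>Q + 1\<close> directions: the
    slopes \<open>0, ..., Q - 1\<close> and the vertical.\<close>
  define X where "X i = (if i < Q then 1 else 0 :: int)" for i
  define Y where "Y i = (if i < Q then int i else 1)" for i
  have cop: "coprime (X i * Y j - X j * Y i) (int Q)" if "i \<le> Q" "j \<le> Q" "i \<noteq> j" for i j
  proof -
    have "\<not> int Q dvd X i * Y j - X j * Y i"
    proof (cases "i < Q \<and> j < Q")
      case True
      then have "\<bar>int j - int i\<bar> < int Q" "int j - int i \<noteq> 0" using that by auto
      then show ?thesis using True zdvd_not_zless[of "\<bar>int j - int i\<bar>" "int Q"] by (auto simp: X_def Y_def)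
    next
      case False
      then show ?thesis using that Q1 by (auto simp: X_def Y_def)
    qed
    then show ?thesis using pQ by (simp add: coprime_commute prime_imp_coprime)
  qed
  define row where "row ab i = (fst ab * X i + snd ab * Y i) mod int Q" for ab i
  define P where "P = ({0..<int Q} \<times> {0..<int Q}) - {(0, 0)}"
  define \<beta> where "\<beta> ab = {(i, v). i \<le> Q \<and> v = row ab i \<and> v \<noteq> 0}" for ab
  have "decomposable {clique Q} ({..Q} \<times> {1..<int Q}) cross"
  proof (rule decomposableI[of P \<beta>])
    fix ab assume ab: "ab \<in> P"
    obtain a b where ab_eq: "ab = (a, b)" by fastforce
    have ab': "a \<in> {0..<int Q}" "b \<in> {0..<int Q}" "a \<noteq> 0 \<or> b \<noteq> 0" using ab unfolding P_def ab_eq by auto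
    have row_range: "0 \<le> row ab i" "row ab i < int Q" for i unfolding row_def using Q1 by simp_all
    have row_pos: "1 \<le> row ab i" if "row ab i \<noteq> 0" for i using row_range(1)[of i] that by linarith
    show "\<beta> ab \<subseteq> {..Q} \<times> {1..<int Q}" unfolding \<beta>_def using row_range row_pos by auto
    \<comment> \<open>The missed group is the direction on which the linear form vanishes:
      \<open>Q\<close> if \<open>b = 0\<close>, otherwise the solution of
      \<open>a + b * z = 0\<close>.\<close>
    have "\<exists>z\<le>Q. \<forall>i\<le>Q. row ab i = 0 \<longleftrightarrow> i = z"
    proof (cases "b = 0")
      case True
      then have "row ab i = 0 \<longleftrightarrow> i = Q" if "i \<le> Q" for i
        using that ab' by (auto simp: row_def ab_eq X_def)
      then show ?thesis by blast
    next
      case False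
      have "\<not> int Q dvd b" using False ab' by (auto dest: zdvd_imp_le)
      then have cb: "coprime b (int Q)" using prime_imp_coprime[OF pQ] by (simp only: coprime_commute)
      then obtain c where c: "[b * c = 1] (mod int Q)" using cong_solve_coprime_int by blast
      define z where "z = nat ((- a * c) mod int Q)"
      have z: "z < Q" "int z = (- a * c) mod int Q" unfolding z_def using Q1 by (auto simp: nat_less_iff)
      have "[a + b * int z = a + b * (- a * c)] (mod int Q)"
        by (intro cong_add cong_mult) (simp_all add: z(2))
      also have "a + b * (- a * c) = a - (b * c) * a" by (simp add: algebra_simps)
      also have "[a - (b * c) * a = a - 1 * a] (mod int Q)" by (intro cong_diff cong_scalar_right c) simp
      finally have z0: "[a + b * int z = 0] (mod int Q)" by simp
      have "row ab i = 0 \<longleftrightarrow> i = z" if "i \<le> Q" for i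
      proof (cases "i < Q")
        case True
        show ?thesis
        proof
          assume "row ab i = 0"
          then have "[a + b * int i = 0] (mod int Q)" using True by (simp add: row_def ab_eq X_def Y_def cong_def)
          then have "[a + b * int i = a + b * int z] (mod int Q)" using z0 by (meson cong_sym cong_trans)
          then have "[b * int i = b * int z] (mod int Q)" by (simp only: cong_add_lcancel)
          then have "[int i = int z] (mod int Q)" using cb by (metis cong_mult_lcancel)
          then show "i = z" using True z(1) by (simp add: cong_def)
        next
          assume "i = z"
          then show "row ab i = 0" using z0 z(1) by (simp add: row_def ab_eq X_def Y_def cong_def)
        qed
      next
        case False
        then show ?thesis using that z(1) ab' \<open>b \<noteq> 0\<close> by (auto simp: row_def ab_eq X_def Y_def)
      qed
      then show ?thesis using z(1) by (meson less_imp_le)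
    qed
    then obtain z where z: "z \<le> Q" "\<And>i. i \<le> Q \<Longrightarrow> row ab i = 0 \<longleftrightarrow> i = z" by blast
    have eq: "\<beta> ab = (\<lambda>i. (i, row ab i)) ` ({..Q} - {z})" unfolding \<beta>_def using z by auto
    have "card (\<beta> ab) = Q" unfolding eq using z(1) by (subst card_image) (auto simp: inj_on_def)
    moreover have "finite (\<beta> ab)" unfolding eq by simp
    moreover have "\<forall>u\<in>\<beta> ab. \<forall>v\<in>\<beta> ab. cross u v \<longleftrightarrow> u \<noteq> v" unfolding eq by auto
    ultimately show "\<exists>as\<in>{clique Q}. multipartite_on as cross (\<beta> ab)"
      using multipartite_on_clique_iff[of Q cross "\<beta> ab"] by blast
  next
    fix u v assume uv: "u \<in> {..Q} \<times> {1..<int Q}" "v \<in> {..Q} \<times> {1..<int Q}" "cross u v"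
    obtain i x j y where u: "u = (i, x)" "v = (j, y)" by fastforce
    have ij: "i \<le> Q" "j \<le> Q" "i \<noteq> j" "x \<in> {1..<int Q}" "y \<in> {1..<int Q}" using uv u by auto
    have Qpos: "int Q > 0" using Q1 by simp
    have xy: "x \<in> {0..<int Q}" "y \<in> {0..<int Q}" using ij by auto
    obtain a b where ab: "a \<in> {0..<int Q}" "b \<in> {0..<int Q}" "(a * X i + b * Y i) mod int Q = x"
        "(a * X j + b * Y j) mod int Q = y"
      using ex_solution_2x2[OF Qpos cop[OF ij(1-3)] xy] by blast
    have "(a, b) \<noteq> (0, 0)" using ab(3) ij(4) by auto
    then have "(a, b) \<in> P" "u \<in> \<beta> (a, b)" "v \<in> \<beta> (a, b)"
      using ab ij unfolding P_def \<beta>_def row_def u by auto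
    then show "\<exists>p\<in>P. u \<in> \<beta> p \<and> v \<in> \<beta> p" by blast
    fix p q assume pq: "p \<in> P" "q \<in> P" "u \<in> \<beta> p" "v \<in> \<beta> p" "u \<in> \<beta> q" "v \<in> \<beta> q"
    have "fst p = fst q \<and> snd p = snd q"
    proof (rule solution_2x2_unique[OF cop[OF ij(1-3)]])
      show "(fst p * X i + snd p * Y i) mod int Q = (fst q * X i + snd q * Y i) mod int Q"
        "(fst p * X j + snd p * Y j) mod int Q = (fst q * X j + snd q * Y j) mod int Q"
        using pq(3-6) unfolding \<beta>_def row_def u by auto
    qed (use pq(1,2) in \<open>auto simp: P_def\<close>)
    then show "p = q" by (simp add: prod_eq_iff)
  qed
  moreover have "bij_betw (map_prod id (\<lambda>v. nat v - 1)) ({..Q} \<times> {1..<int Q}) ({..<Q + 1} \<times> {..<Q - 1})"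
  proof (rule bij_betw_map_prod)
    show "bij_betw (\<lambda>v. nat v - 1) {1..<int Q} {..<Q - 1}"
      by (rule bij_betw_byWitness[where f' = "\<lambda>v. int v + 1"]) auto
    show "bij_betw id {..Q} {..<Q + 1}" by (auto simp: bij_betw_def)
  qed
  ultimately show ?thesis by (rule decomposable_transfer) auto
qed

section \<open>Transversal designs from linear recurrences\<close>

text \<open>With \<open>S\<close> the shift of sequences, this is the product of the operators
  \<open>S^m - 1\<close>, \<open>m\<close> in \<open>ms\<close>, applied to
  \<open>s\<close>.\<close>

fun diffs :: "nat list \<Rightarrow> (nat \<Rightarrow> int) \<Rightarrow> nat \<Rightarrow> int" where
  "diffs [] s n = s n"
| "diffs (m # ms) s n = diffs ms (\<lambda>i. s (i + m) - s i) n"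

text \<open>The operator is a monic polynomial in the shift, of degree \<open>sum_list ms\<close>,
  so a recurrence built on it can be solved for the latest term. Positivity of the entries keeps the
  subtracted terms inside the window.\<close>

lemma diffs_leading:
  assumes "0 \<notin> set ms"
  shows "\<exists>g. \<forall>s n. diffs ms s n = s (n + sum_list ms) + g (map (\<lambda>j. s (n + j)) [0..<sum_list ms])"
  using assms
proof (induction ms)
  case Nil
  show ?case by (rule exI[of _ "\<lambda>_. 0"]) simp
next
  case (Cons m ms)
  then have m: "m > 0" by auto
  obtain g where g: "\<And>s n. diffs ms s n = s (n + sum_list ms) + g (map (\<lambda>j. s (n + j)) [0..<sum_list ms])"
    using Cons by auto
  let ?S = "sum_list ms"
  define G where "G xs = g (map (\<lambda>j. xs ! (j + m) - xs ! j) [0..<?S]) - xs ! ?S" for xs :: "int list"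
  have "diffs (m # ms) s n = s (n + (m + ?S)) + G (map (\<lambda>j. s (n + j)) [0..<m + ?S])" for s n
  proof -
    let ?xs = "map (\<lambda>j. s (n + j)) [0..<m + ?S]"
    have 1: "map (\<lambda>j. ?xs ! (j + m) - ?xs ! j) [0..<?S] = map (\<lambda>j. s (n + j + m) - s (n + j)) [0..<?S]"
      by (rule map_cong[OF refl]) (simp add: ac_simps)
    have 2: "?xs ! ?S = s (n + ?S)" using m by simp
    have 3: "n + ?S + m = n + (m + ?S)" by simp
    show ?thesis unfolding G_def 1 2 diffs.simps g 3 by simp
  qed
  then show ?case by (intro exI[of _ G]) simp
qed

lemma diffs_add: "diffs ms (\<lambda>i. s i + s' i) n = diffs ms s n + diffs ms s' n"
proof (induction ms arbitrary: s s')
  case (Cons m ms)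
  have "diffs (m # ms) (\<lambda>i. s i + s' i) n = diffs ms (\<lambda>i. (s (i + m) - s i) + (s' (i + m) - s' i)) n"
    by (simp add: algebra_simps)
  then show ?case by (simp only: Cons.IH diffs.simps)
qed simp

lemma diffs_minus: "diffs ms (\<lambda>i. s i - s' i) n = diffs ms s n - diffs ms s' n"
  using diffs_add[of ms "\<lambda>i. s i - s' i" s' n] by simp

lemma diffs_shift: "diffs ms (\<lambda>i. s (i + k)) n = diffs ms s (n + k)"
proof (induction ms arbitrary: s)
  case (Cons m ms)
  show ?case using Cons.IH[of "\<lambda>i. s (i + m) - s i"] by (simp add: ac_simps)
qed simp

lemma diffs_cong: "(\<And>i. [s i = s' i] (mod N)) \<Longrightarrow> [diffs ms s n = diffs ms s' n] (mod N)"
  by (induction ms arbitrary: s s') (simp_all add: cong_diff)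

lemma diffs_zero: "diffs ms (\<lambda>_. 0) n = 0"
  by (induction ms) simp_all

text \<open>The factor \<open>S^m - 1\<close> kills an \<open>m\<close>-periodic sequence, and the
  factors applied before it preserve the period.\<close>

lemma diffs_periodic:
  assumes "\<And>i. [s (i + m) = s i] (mod N)" "m \<in> set ms"
  shows "[diffs ms s n = 0] (mod N)"
  using assms
proof (induction ms arbitrary: s)
  case (Cons k ms)
  show ?case
  proof (cases "m = k")
    case True
    have "[s (i + k) - s i = 0] (mod N)" for i
      using cong_diff[OF Cons.prems(1)[of i] cong_refl[of "s i"]] True by simp
    then have "[diffs ms (\<lambda>i. s (i + k) - s i) n = diffs ms (\<lambda>_. 0) n] (mod N)" by (rule diffs_cong)
    then show ?thesis by (simp add: diffs_zero)
  next
    case False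
    have "[diffs ms (\<lambda>i. s (i + k) - s i) n = 0] (mod N)"
    proof (rule Cons.IH)
      fix i
      show "[s (i + m + k) - s (i + m) = s (i + k) - s i] (mod N)"
        using cong_diff[OF Cons.prems(1)[of "i + k"] Cons.prems(1)[of i]] by (simp add: ac_simps)
    qed (use False Cons.prems in auto)
    then show ?thesis by simp
  qed
qed simp

text \<open>The first \<open>D\<close> terms are free and determine all others. \<open>step\<close>
  is the shift register on windows of length \<open>D\<close>, and \<open>seq\<close> reads off its
  output.\<close>

lemma card_recurrent_sequences:
  fixes N :: int and G :: "int list \<Rightarrow> int"
  assumes N: "N > 0" and D: "D > 0"
  defines "A \<equiv> {s. \<forall>n. s n \<in> {0..<N} \<and> s (n + D) = G (map (\<lambda>j. s (n + j)) [0..<D]) mod N}"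
  shows "finite A" "card A = nat N ^ D"
proof -
  define W where "W = {xs. set xs \<subseteq> {0..<N} \<and> length xs = D}"
  define step where "step xs = tl xs @ [G xs mod N]" for xs
  define seq where "seq xs n = hd ((step ^^ n) xs)" for xs n
  have step_nth: "step ys ! j = ys ! Suc j" if "Suc j < length ys" for ys j
    using that unfolding step_def by (cases ys) (simp_all add: nth_append)
  have step_last: "step ys ! (D - 1) = G ys mod N" if "length ys = D" for ys
    using that D unfolding step_def by (simp add: nth_append)
  have step_W: "(step ^^ n) xs \<in> W" if "xs \<in> W" for xs n
  proof (induction n)
    case (Suc n)
    have "step ys \<in> W" if "ys \<in> W" for ys
      using that N D unfolding W_def step_def by (cases ys) auto
    then show ?case using Suc by simp
  qed (use that in simp)
  have nth: "(step ^^ n) xs ! j = seq xs (n + j)" if "xs \<in> W" "j < D" for xs n j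
    using that(2)
  proof (induction j arbitrary: n)
    case 0
    then show ?case using step_W[OF that(1), of n] D unfolding seq_def W_def
      by (simp add: hd_conv_nth) (metis hd_conv_nth length_0_conv less_irrefl mem_Collect_eq)
  next
    case (Suc j)
    let ?ys = "(step ^^ n) xs"
    have "length ?ys = D" using step_W[OF that(1)] unfolding W_def by blast
    then have "?ys ! Suc j = step ?ys ! j" using Suc.prems by (intro step_nth[symmetric]) simp
    also have "\<dots> = (step ^^ Suc n) xs ! j" by simp
    also have "\<dots> = seq xs (Suc n + j)" by (rule Suc.IH) (use Suc.prems in simp)
    finally show ?case by simp
  qed
  have state: "(step ^^ n) xs = map (\<lambda>j. seq xs (n + j)) [0..<D]" if "xs \<in> W" for xs n
    by (rule nth_equalityI) (use step_W[OF that, of n] nth[OF that] in \<open>auto simp: W_def\<close>)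
  have "bij_betw (\<lambda>s. map s [0..<D]) A W"
  proof (rule bij_betw_byWitness[where f' = seq])
    show "(\<lambda>s. map s [0..<D]) ` A \<subseteq> W" unfolding A_def W_def by auto
    show "seq ` W \<subseteq> A"
    proof (intro image_subsetI)
      fix xs assume xs: "xs \<in> W"
      have "seq xs n \<in> {0..<N}" for n
        using step_W[OF xs, of n] D unfolding seq_def W_def
        by (metis (mono_tags, lifting) hd_in_set length_greater_0_conv mem_Collect_eq subsetD)
      moreover have "seq xs (n + D) = G (map (\<lambda>j. seq xs (n + j)) [0..<D]) mod N" for n
      proof -
        let ?ys = "(step ^^ n) xs"
        have len: "length ?ys = D" using step_W[OF xs] unfolding W_def by blast
        have "seq xs (n + D) = seq xs (Suc n + (D - 1))" using D by simp
        also have "\<dots> = (step ^^ Suc n) xs ! (D - 1)" by (rule nth[OF xs, symmetric]) (use D in simp)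
        also have "\<dots> = step ?ys ! (D - 1)" by simp
        also have "\<dots> = G ?ys mod N" by (rule step_last[OF len])
        also have "?ys = map (\<lambda>j. seq xs (n + j)) [0..<D]" by (rule state[OF xs])
        finally show ?thesis .
      qed
      ultimately show "seq xs \<in> A" unfolding A_def by blast
    qed
    show "\<forall>xs\<in>W. map (seq xs) [0..<D] = xs" using state[of _ 0] by simp
    show "\<forall>s\<in>A. seq (map s [0..<D]) = s"
    proof
      fix s assume s: "s \<in> A"
      let ?xs = "map s [0..<D]"
      have xs: "?xs \<in> W" using s unfolding A_def W_def by auto
      have "(step ^^ n) ?xs = map (\<lambda>j. s (n + j)) [0..<D]" for n
      proof (induction n)
        case (Suc n)
        let ?ys = "map (\<lambda>j. s (n + j)) [0..<D]"
        have "(step ^^ Suc n) ?xs = step ?ys" using Suc by simp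
        also have "\<dots> = map (\<lambda>j. s (Suc n + j)) [0..<D]"
        proof (rule nth_equalityI)
          fix i assume "i < length (step ?ys)"
          then have i: "i < D" using D unfolding step_def by simp
          show "step ?ys ! i = map (\<lambda>j. s (Suc n + j)) [0..<D] ! i"
          proof (cases "i = D - 1")
            case True
            have "s (n + D) = G ?ys mod N" using s unfolding A_def by blast
            then show ?thesis using True D step_last[of ?ys] by simp
          next
            case False
            then show ?thesis using i step_nth[of i ?ys] by simp
          qed
        qed (use D in \<open>simp add: step_def\<close>)
        finally show ?case .
      qed simp
      then have "seq ?xs n = s n" for n unfolding seq_def using D by (simp add: hd_map)
      then show "seq ?xs = s" by blast
    qed
  qed
  moreover have "finite W" "card W = nat N ^ D"
    unfolding W_def using finite_lists_length_eq[of "{0..<N}" D] card_lists_length_eq[of "{0..<N}" D] by simp_all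
  ultimately show "finite A" "card A = nat N ^ D"
    using bij_betw_finite bij_betw_same_card by metis+
qed

text \<open>The recurrence below makes every shift, and every difference of two of the first \<open>q\<close> shifts,
  act injectively on its solutions: a solution with period \<open>m < q\<close> is killed by the product of
  differences, hence zero. So the shifts play the role of the \<open>q\<close> slopes of an affine plane, over a
  solution space whose size may be any large power of an arbitrary \<open>N\<close>.\<close>

lemma decomposable_transversal:
  fixes N q D :: nat
  assumes N: "N > 0" and q: "q > 0" and D: "D \<ge> q + sum_list [1..<q]"
  shows "decomposable {clique q} ({..<q} \<times> {..<N ^ D}) cross"
proof -
  define ms where "ms = [1..<q]"
  \<comment> \<open>The offset raises the order of the recurrence to \<open>D\<close>. Being at
    least \<open>q\<close>, it leaves room to shift back by \<open>i < q\<close> in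
    \<open>K_periodic\<close>.\<close>
  define e where "e = D - sum_list ms"
  have De: "D = e + sum_list ms" and e: "e \<ge> q" unfolding e_def using D by (simp_all add: ms_def)
  \<comment> \<open>The extra term \<open>s n\<close> forces a solution that \<open>diffs ms\<close>
    kills to vanish.\<close>
  define K where "K s \<longleftrightarrow> (\<forall>n. [s n + diffs ms s (n + e) = 0] (mod int N))" for s
  define A where "A = {s. (\<forall>n. s n \<in> {0..<int N}) \<and> K s}"
  obtain g where g: "\<And>s n. diffs ms s n = s (n + sum_list ms) + g (map (\<lambda>j. s (n + j)) [0..<sum_list ms])"
    using diffs_leading[of ms] unfolding ms_def by auto
  define G where "G xs = - (xs ! 0) - g (drop e xs)" for xs :: "int list"
  have G: "G (map (\<lambda>j. s (n + j)) [0..<D]) = - s n - g (map (\<lambda>j. s (n + e + j)) [0..<sum_list ms])" for s n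
  proof -
    have "drop e (map (\<lambda>j. s (n + j)) [0..<D]) = map (\<lambda>j. s (n + e + j)) [0..<sum_list ms]"
      by (rule nth_equalityI) (auto simp: De ac_simps)
    then show ?thesis unfolding G_def using e q De by simp
  qed
  have "A = {s. \<forall>n. s n \<in> {0..<int N} \<and> s (n + D) = G (map (\<lambda>j. s (n + j)) [0..<D]) mod int N}"
  proof -
    have "[s n + diffs ms s (n + e) = 0] (mod int N) \<longleftrightarrow> s (n + D) = G (map (\<lambda>j. s (n + j)) [0..<D]) mod int N"
      if "\<And>n. s n \<in> {0..<int N}" for s n
    proof -
      have "s (n + D) = s (n + D) mod int N" using that[of "n + D"] by simp
      moreover have nD: "n + e + sum_list ms = n + D" using De by simp
      have "s n + diffs ms s (n + e) = s (n + D) - G (map (\<lambda>j. s (n + j)) [0..<D])"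
        unfolding G g nD by simp
      moreover have "[x - y = 0] (mod int N) \<longleftrightarrow> x mod int N = y mod int N" for x y
        by (metis cong_def cong_diff_iff_cong_0)
      ultimately show ?thesis by metis
    qed
    then show ?thesis unfolding A_def K_def by blast
  qed
  moreover have "D > 0" using De e q by simp
  ultimately have finA: "finite A" and cardA: "card A = N ^ D"
    using card_recurrent_sequences[of "int N" D G] N by simp_all
  have K_add: "K (\<lambda>n. s n + s' n)" if "K s" "K s'" for s s'
    unfolding K_def
  proof
    fix n
    have "[(s n + diffs ms s (n + e)) + (s' n + diffs ms s' (n + e)) = 0 + 0] (mod int N)"
      by (rule cong_add) (use that in \<open>simp_all add: K_def\<close>)
    then show "[s n + s' n + diffs ms (\<lambda>n. s n + s' n) (n + e) = 0] (mod int N)"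
      by (simp add: diffs_add algebra_simps)
  qed
  have K_diff: "K (\<lambda>n. s n - s' n)" if "K s" "K s'" for s s'
    unfolding K_def
  proof
    fix n
    have "[(s n + diffs ms s (n + e)) - (s' n + diffs ms s' (n + e)) = 0 - 0] (mod int N)"
      by (rule cong_diff) (use that in \<open>simp_all add: K_def\<close>)
    then show "[s n - s' n + diffs ms (\<lambda>n. s n - s' n) (n + e) = 0] (mod int N)"
      by (simp add: diffs_minus algebra_simps)
  qed
  have K_shift: "K (\<lambda>n. s (n + k))" if "K s" for s k
    using that unfolding K_def diffs_shift by (metis add.assoc add.commute)
  have K_mod: "K (\<lambda>n. s n mod int N)" if "K s" for s
    unfolding K_def
  proof
    fix n
    have "[s n mod int N + diffs ms (\<lambda>n. s n mod int N) (n + e) = s n + diffs ms s (n + e)] (mod int N)"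
      by (intro cong_add diffs_cong) simp_all
    also have "[s n + diffs ms s (n + e) = 0] (mod int N)" using that unfolding K_def by blast
    finally show "[s n mod int N + diffs ms (\<lambda>n. s n mod int N) (n + e) = 0] (mod int N)" .
  qed
  have K_periodic: "[d n = 0] (mod int N)"
    if "K d" and per: "\<And>n. [d (n + j) = d (n + i)] (mod int N)" and ij: "i < j" "j < q" for d i j n
  proof -
    have "[diffs ms (\<lambda>n. d (n + i)) (n + e - i) = 0] (mod int N)"
    proof (rule diffs_periodic)
      fix k
      show "[d (k + (j - i) + i) = d (k + i)] (mod int N)" using per[of k] ij by (simp add: ac_simps)
      have "1 \<le> j - i" "j - i < q" using ij by linarith+
      then show "j - i \<in> set ms" by (simp add: ms_def)
    qed
    then have "[diffs ms d (n + e) = 0] (mod int N)" unfolding diffs_shift using e ij by simp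
    then have "[d n + diffs ms d (n + e) - diffs ms d (n + e) = 0 - 0] (mod int N)"
      using \<open>K d\<close> unfolding K_def by (intro cong_diff) blast+
    then show ?thesis by simp
  qed
  \<comment> \<open>The analogue of \<open>a + b * i\<close>, with multiplication by
    \<open>i\<close> replaced by the \<open>i\<close>-fold shift.\<close>
  define row where "row ab i = (\<lambda>n. (fst ab n + snd ab (n + i)) mod int N)"
    for ab :: "(nat \<Rightarrow> int) \<times> (nat \<Rightarrow> int)" and i
  have row_A: "row ab i \<in> A" if "ab \<in> A \<times> A" for ab i
    using that K_mod[OF K_add[OF _ K_shift], of "fst ab" "snd ab" i] N
    unfolding A_def row_def by auto
  have inj: "ab = cd"
    if ij: "i < j" "j < q" and AA: "ab \<in> A \<times> A" "cd \<in> A \<times> A"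
      and eq: "row ab i = row cd i" "row ab j = row cd j" for i j ab cd
  proof -
    obtain a b c d where abcd: "ab = (a, b)" "cd = (c, d)" by fastforce
    have ri: "[a n + b (n + i) = c n + d (n + i)] (mod int N)"
      and rj: "[a n + b (n + j) = c n + d (n + j)] (mod int N)" for n
      using fun_cong[OF eq(1), of n] fun_cong[OF eq(2), of n] unfolding row_def abcd by (simp_all add: cong_def)
    have A': "K b" "K d" "\<And>n. a n \<in> {0..<int N}" "\<And>n. b n \<in> {0..<int N}"
      "\<And>n. c n \<in> {0..<int N}" "\<And>n. d n \<in> {0..<int N}" using AA unfolding abcd A_def by auto
    have "[(b (n + j) - d (n + j)) = (b (n + i) - d (n + i))] (mod int N)" for n
    proof -
      have "[(a n + b (n + j)) - (a n + b (n + i)) = (c n + d (n + j)) - (c n + d (n + i))] (mod int N)"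
        by (rule cong_diff[OF rj ri])
      then show ?thesis by (simp add: cong_iff_dvd_diff algebra_simps)
    qed
    then have bd: "[b n - d n = 0] (mod int N)" for n
      using K_periodic[OF K_diff[OF A'(1,2)] _ ij] by blast
    have bd: "b n = d n" for n
    proof -
      have "[b n = d n] (mod int N)" using bd[of n] cong_diff_iff_cong_0 by blast
      then show ?thesis using A'(4)[of n] A'(6)[of n] by (simp add: cong_def)
    qed
    have "a n = c n" for n
    proof -
      have "[a n + b (n + i) = c n + b (n + i)] (mod int N)" using ri[of n] bd by simp
      then have "[a n = c n] (mod int N)" by (simp add: cong_add_rcancel)
      then show ?thesis using A'(3)[of n] A'(5)[of n] by (simp add: cong_def)
    qed
    then show ?thesis using bd abcd by (simp add: fun_eq_iff)
  qed
  have inj': "ab = cd"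
    if ij: "i \<noteq> j" "i < q" "j < q" and AA: "ab \<in> A \<times> A" "cd \<in> A \<times> A"
      and eq: "row ab i = row cd i" "row ab j = row cd j" for i j ab cd
    using inj[of i j ab cd] inj[of j i ab cd] that by (metis linorder_neqE_nat)
  have surj: "\<exists>ab\<in>A \<times> A. row ab i = x \<and> row ab j = y"
    if ij: "i \<noteq> j" "i < q" "j < q" and xy: "x \<in> A" "y \<in> A" for i j x y
  proof -
    \<comment> \<open>A line through two given points exists by counting: an injective self-map of
      the finite set \<open>A \<times> A\<close> is onto.\<close>
    have "inj_on (\<lambda>ab. (row ab i, row ab j)) (A \<times> A)"
      by (rule inj_onI) (use inj'[OF ij] in blast)
    moreover have "(\<lambda>ab. (row ab i, row ab j)) ` (A \<times> A) \<subseteq> A \<times> A" using row_A by blast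
    ultimately have "(\<lambda>ab. (row ab i, row ab j)) ` (A \<times> A) = A \<times> A"
      using finA by (simp add: endo_inj_surj)
    then have "(x, y) \<in> (\<lambda>ab. (row ab i, row ab j)) ` (A \<times> A)" using xy by simp
    then show ?thesis by auto
  qed
  define \<beta> where "\<beta> ab = (\<lambda>i. (i, row ab i)) ` {..<q}" for ab
  have "decomposable {clique q} ({..<q} \<times> A) cross"
  proof (rule decomposableI[of "A \<times> A" \<beta>])
    fix ab assume "ab \<in> A \<times> A"
    then show "\<beta> ab \<subseteq> {..<q} \<times> A" unfolding \<beta>_def using row_A by blast
    have "card (\<beta> ab) = q" unfolding \<beta>_def by (subst card_image) (auto simp: inj_on_def)
    moreover have "finite (\<beta> ab)" "\<forall>u\<in>\<beta> ab. \<forall>v\<in>\<beta> ab. cross u v \<longleftrightarrow> u \<noteq> v" unfolding \<beta>_def by auto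
    ultimately show "\<exists>as\<in>{clique q}. multipartite_on as cross (\<beta> ab)"
      using multipartite_on_clique_iff[of q cross "\<beta> ab"] by blast
  next
    fix u v assume uv: "u \<in> {..<q} \<times> A" "v \<in> {..<q} \<times> A" "cross u v"
    obtain i x j y where u: "u = (i, x)" "v = (j, y)" by fastforce
    have ij: "i \<noteq> j" "i < q" "j < q" "x \<in> A" "y \<in> A" using uv u by auto
    have mem: "(i, x) \<in> \<beta> ab \<longleftrightarrow> i < q \<and> x = row ab i" for i x ab unfolding \<beta>_def by auto
    show "\<exists>p\<in>A \<times> A. u \<in> \<beta> p \<and> v \<in> \<beta> p" using surj[OF ij] ij unfolding u mem by blast
    fix p p' assume "p \<in> A \<times> A" "p' \<in> A \<times> A" "u \<in> \<beta> p" "v \<in> \<beta> p" "u \<in> \<beta> p'" "v \<in> \<beta> p'"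
    then show "p = p'" using inj'[OF ij(1-3), of p p'] unfolding u mem by simp
  qed
  moreover obtain h where "bij_betw h A {..<N ^ D}"
    using ex_bij_betw_finite_nat[OF finA] cardA by (auto simp: atLeast0LessThan)
  then have "bij_betw (map_prod id h) ({..<q} \<times> A) ({..<q} \<times> {..<N ^ D})" by (intro bij_betw_map_prod) auto
  ultimately show ?thesis by (rule decomposable_transfer) auto
qed

lemma ex_consecutive_clique_blowups:
  assumes Q: "prime Q"
  obtains w :: nat where "w > 0" "decomposable {clique Q} ({..<Q} \<times> {..<w}) cross"
    "decomposable {clique Q} ({..<Q + 1} \<times> {..<w}) cross"
proof -
  define D where "D = Q + sum_list [1..<Q]"
  have Q1: "Q > 1" using Q by (rule prime_gt_1_nat)
  have td: "decomposable {clique Q} ({..<Q} \<times> {..<(Q - 1) ^ D'}) cross" if "D' \<ge> D" for D'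
    by (rule decomposable_transversal) (use that Q1 in \<open>auto simp: D_def\<close>)
  have "decomposable {clique Q} (({..<Q + 1} \<times> {..<Q - 1}) \<times> {..<(Q - 1) ^ D}) (\<lambda>p q. cross (fst p) (fst q))"
    by (rule decomposable_blowup[of "{Q}"]) (use decomposable_punctured_plane[OF Q] td in auto)
  from decomposable_regroup[OF this]
  have "decomposable {clique Q} ({..<Q + 1} \<times> {..<(Q - 1) ^ (D + 1)}) cross" by simp
  \<comment> \<open>Both decompositions must share one \<open>w\<close>: the punctured plane adds a
    factor \<open>Q - 1\<close> to the exponent \<open>D\<close>, and the transversal design is
    available for exponent \<open>D + 1\<close> too.\<close>
  then show thesis using that[of "(Q - 1) ^ (D + 1)"] td[of "D + 1"] Q1 by simp
qed

section \<open>Primes in residue classes\<close>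

lemma poly_cong_int:
  fixes P :: "int poly"
  assumes "[x = y] (mod m)"
  shows "[poly P x = poly P y] (mod m)"
proof (induction P)
  case (pCons a P)
  then show ?case by (simp add: cong_add cong_mult assms)
qed simp

lemma map_poly_of_int_mult:
  "map_poly of_int (p * q) = map_poly (of_int :: int \<Rightarrow> complex) p * map_poly of_int q"
  by (rule poly_eqI) (simp only: coeff_map_poly[where f = of_int, OF of_int_0] coeff_mult of_int_sum of_int_mult)

text \<open>The quotient \<open>P\<close> is the cyclotomic polynomial up to sign. Dividing by a least common multiple
  in the factorial ring of integer polynomials avoids proving separately that it has integer
  coefficients.\<close>

lemma ex_cyclotomic_factor:
  fixes l :: nat
  assumes l: "l > 0"
  obtains P L :: "int poly" where "P * L = monom 1 l - 1" "degree P > 0"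
    "\<And>d. d dvd l \<Longrightarrow> d < l \<Longrightarrow> monom 1 d - 1 dvd L"
proof -
  define D where "D = {d. d dvd l \<and> d < l}"
  define L :: "int poly" where "L = Lcm ((\<lambda>d. monom 1 d - 1) ` D)"
  have finD: "finite D" unfolding D_def by simp
  have "(monom 1 d - 1 :: int poly) dvd monom 1 l - 1" if d: "d \<in> D" for d
  proof -
    obtain k where "l = d * k" using d by (auto simp: D_def dvd_def)
    then have "(monom 1 l :: int poly) = monom 1 d ^ k" by (simp add: monom_power)
    moreover have "(monom 1 d - 1 :: int poly) dvd monom 1 d ^ k - 1 ^ k"
      by (simp only: power_diff_sumr2) simp
    ultimately show ?thesis by simp
  qed
  then have "L dvd monom 1 l - 1" unfolding L_def by (intro Lcm_least) auto
  then obtain P where P: "monom 1 l - 1 = L * P" by (auto simp: dvd_def)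
  have "L dvd (\<Prod>d\<in>D. monom 1 d - 1)"
    unfolding L_def by (intro Lcm_least) (auto intro!: dvd_prodI finD)
  then obtain R where R: "(\<Prod>d\<in>D. monom 1 d - 1) = L * R" by (auto simp: dvd_def)
  \<comment> \<open>Evaluation at a primitive \<open>l\<close>-th root of unity. It kills
    \<open>x^l - 1\<close> but no \<open>x^d - 1\<close> with \<open>d\<close> in \<open>D\<close>,
    hence not \<open>L\<close>, which divides their product. So \<open>P\<close> has this root and,
    being nonzero, is not constant.\<close>
  define ev where "ev p = poly (map_poly (of_int :: int \<Rightarrow> complex) p) (cis (2 * pi * real 1 / real l))" for p
  have ev_mult: "ev (p * q) = ev p * ev q" for p q
    unfolding ev_def map_poly_of_int_mult by simp
  have ev_1: "ev 1 = 1" unfolding ev_def by simp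
  have ev_prod: "ev (\<Prod>d\<in>A. f d) = (\<Prod>d\<in>A. ev (f d))" for A and f :: "nat \<Rightarrow> int poly"
    by (induction A rule: infinite_finite_induct) (simp_all add: ev_mult ev_1)
  have ev_mon: "ev (monom 1 d - 1) = cis (2 * pi * real d / real l) - 1" for d
  proof -
    have "map_poly (of_int :: int \<Rightarrow> complex) (monom 1 d - 1) = monom 1 d - 1"
      by (rule poly_eqI) (simp add: coeff_map_poly)
    then show ?thesis unfolding ev_def by (simp add: poly_monom DeMoivre mult.commute)
  qed
  have "ev (monom 1 d - 1) \<noteq> 0" if "d \<in> D" for d
  proof -
    have "d < l" "d > 0" using that l by (auto simp: D_def intro: Nat.gr0I)
    moreover have "inj_on (\<lambda>k. cis (2 * pi * real k / real l)) {..<l}"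
      using bij_betw_roots_unity[OF l] by (simp add: bij_betw_def)
    ultimately have "cis (2 * pi * real d / real l) \<noteq> cis (2 * pi * real 0 / real l)"
      using l by (metis inj_on_contraD lessThan_iff not_less_zero)
    then show ?thesis by (simp add: ev_mon)
  qed
  then have "ev (\<Prod>d\<in>D. monom 1 d - 1) \<noteq> 0" unfolding ev_prod using finD by simp
  then have "ev L \<noteq> 0" unfolding R ev_mult by simp
  moreover have "ev (monom 1 l - 1) = 0" unfolding ev_mon using l by simp
  ultimately have evP: "ev P = 0" unfolding P ev_mult by simp
  have "degree P > 0"
  proof (rule ccontr)
    assume "\<not> degree P > 0"
    then have "degree P = 0" by simp
    then obtain c where c: "P = [:c:]" by (rule degree_eq_zeroE)
    have "ev P = of_int c" unfolding ev_def c by (simp add: map_poly_pCons)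
    then have "P = 0" using evP c by simp
    then have "monom 1 l = (1 :: int poly)" using P by simp
    then have "degree (monom (1::int) l) = 0" by simp
    then show False using l by (simp add: degree_monom_eq)
  qed
  moreover have "monom 1 d - 1 dvd L" if "d dvd l" "d < l" for d
    unfolding L_def by (rule dvd_Lcm) (use that in \<open>simp add: D_def\<close>)
  ultimately show thesis using that[of P L] P by (simp add: mult.commute)
qed

text \<open>The order of \<open>z\<close> modulo \<open>p\<close> divides \<open>l\<close>. Were it
  a proper divisor, \<open>p\<close> would divide \<open>L\<close> at \<open>z\<close> as well as
  \<open>P\<close>, making \<open>z\<close> a double root of \<open>x^l - 1\<close> modulo
  \<open>p\<close>; but the derivative \<open>l x^(l-1)\<close> does not vanish there. So the order
  is \<open>l\<close>, and it divides \<open>p - 1\<close>.\<close>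

lemma ord_prime_dvd_cyclotomic_factor:
  fixes P L :: "int poly" and z l p :: nat
  assumes PL: "P * L = monom 1 l - 1" and L: "\<And>d. d dvd l \<Longrightarrow> d < l \<Longrightarrow> monom 1 d - 1 dvd L"
    and p: "prime p" "\<not> p dvd l" "int p dvd poly P (int z)"
  shows "l dvd p - 1"
proof -
  have l: "l > 0" using p(2) by (auto intro: Nat.gr0I)
  have val: "poly P (int z) * poly L (int z) = int z ^ l - 1"
    using arg_cong[OF PL, of "\<lambda>q. poly q (int z)"] by (simp add: poly_monom)
  then have zl: "int p dvd int z ^ l - 1" using p(3) by (metis dvd_mult2)
  have nz: "\<not> int p dvd int z"
  proof
    assume "int p dvd int z"
    then have "int p dvd int z ^ l" using l by (meson dvd_power dvd_trans)
    then have "int p dvd 1" using zl by (metis dvd_diff_right_iff)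
    then show False using p(1) by (simp add: not_prime_unit)
  qed
  have nd: "\<not> int p dvd int z ^ d - 1" if d: "d dvd l" "d < l" for d
  proof
    assume a: "int p dvd int z ^ d - 1"
    obtain K where K: "L = (monom 1 d - 1) * K" using L[OF d] by (auto simp: dvd_def)
    have "poly L (int z) = (int z ^ d - 1) * poly K (int z)" unfolding K by (simp add: poly_monom)
    then have pL: "int p dvd poly L (int z)" using a by simp
    have "pderiv (P * L) = monom (int l) (l - 1)" unfolding PL by (simp add: pderiv_diff pderiv_monom)
    then have "poly (P * pderiv L + L * pderiv P) (int z) = poly (monom (int l) (l - 1)) (int z)"
      by (simp add: pderiv_mult)
    then have "poly P (int z) * poly (pderiv L) (int z) + poly L (int z) * poly (pderiv P) (int z)
        = int l * int z ^ (l - 1)" by (simp add: poly_monom)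
    moreover have "int p dvd poly P (int z) * poly (pderiv L) (int z) + poly L (int z) * poly (pderiv P) (int z)"
      using p(3) pL by simp
    ultimately have "int p dvd int l * int z ^ (l - 1)" by simp
    moreover have "prime (int p)" using p(1) by simp
    ultimately show False using p(2) nz by (metis prime_dvd_mult_iff prime_dvd_power int_dvd_int_iff)
  qed
  have cong: "[z ^ d = 1] (mod p) \<longleftrightarrow> int p dvd int z ^ d - 1" for d
  proof -
    have "[z ^ d = 1] (mod p) \<longleftrightarrow> [int (z ^ d) = int 1] (mod int p)" by (rule cong_int_iff[symmetric])
    then show ?thesis by (simp add: cong_iff_dvd_diff)
  qed
  have ord: "ord p z dvd l" using zl cong ord_divides by blast
  moreover have "ord p z = l"
  proof (rule ccontr)
    assume "ord p z \<noteq> l"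
    then have "ord p z < l" using ord l by (simp add: dvd_imp_le le_neq_implies_less)
    then have "\<not> int p dvd int z ^ ord p z - 1" using nd[OF ord] by simp
    then show False using cong[of "ord p z"] ord_divides[of z "ord p z" p] by simp
  qed
  moreover have "coprime p z" using nz p(1) by (simp add: prime_imp_coprime_nat)
  then have "ord p z dvd totient p" by (rule order_divides_totient)
  ultimately show ?thesis using p(1) by (simp add: totient_prime)
qed

lemma cong_1_if_all_primes_cong_1:
  fixes n m :: nat
  assumes "n > 0" and "\<And>p. prime p \<Longrightarrow> p dvd n \<Longrightarrow> [p = 1] (mod m)"
  shows "[n = 1] (mod m)"
  using assms
proof (induction n rule: less_induct)
  case (less n)
  show ?case
  proof (cases "n = 1")
    case False
    then obtain p where p: "prime p" "p dvd n" using prime_factor_nat by blast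
    then obtain k where k: "n = p * k" by (auto simp: dvd_def)
    have k0: "k > 0" "k < n" using less.prems(1) k prime_gt_1_nat[OF p(1)] by auto
    have "[k = 1] (mod m)" by (rule less.IH[OF k0(2,1)]) (use less.prems(2) k in auto)
    then show ?thesis using cong_mult[OF less.prems(2)[OF p]] k by fastforce
  qed simp
qed

text \<open>The bound on the power of 2 in \<open>p - 1\<close> yields a subgroup of odd order of the units modulo \<open>p\<close>
  whose index does not grow with \<open>p\<close>; odd order keeps \<open>d\<close> and \<open>- d\<close> in different cosets.\<close>

lemma infinitely_many_primes_cong_1:
  fixes l :: nat
  assumes l: "l > 0"
  obtains A where "\<And>B. \<exists>p > B. prime p \<and> l dvd p - 1 \<and> \<not> 2 ^ A dvd p - 1"
proof -
  obtain P L :: "int poly" where PL: "P * L = monom 1 l - 1" and degP: "degree P > 0"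
    and L: "\<And>d. d dvd l \<Longrightarrow> d < l \<Longrightarrow> monom 1 d - 1 dvd L"
    using ex_cyclotomic_factor[OF l] by blast
  have P0: "\<bar>poly P 0\<bar> = 1"
  proof -
    have "poly P 0 * poly L 0 = - 1"
      using arg_cong[OF PL, of "\<lambda>q. poly q 0"] l by (simp add: poly_monom)
    then have "\<bar>poly P 0\<bar> * \<bar>poly L 0\<bar> = 1" by (simp flip: abs_mult)
    then show ?thesis by (metis abs_ge_zero dvd_triv_left zdvd1_eq abs_abs)
  qed
  \<comment> \<open>\<open>P\<close> takes the values 1 and -1 only finitely often, so some even
    argument avoids both. The square appears because prime factors determine a value only up to
    sign.\<close>
  obtain z0 where z0: "even z0" "(poly P (int z0))\<^sup>2 \<noteq> 1"
  proof -
    define Q where "Q = (P - 1) * (P + 1)"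
    have "Q \<noteq> 0"
    proof
      assume "Q = 0"
      then have "P = 1 \<or> P = - 1" unfolding Q_def by (auto simp: eq_neg_iff_add_eq_0)
      then show False using degP by auto
    qed
    then have "finite {x. poly Q x = 0}" by (rule poly_roots_finite)
    moreover have "infinite (range (\<lambda>k::nat. 2 * int k))"
      by (rule range_inj_infinite) (auto simp: inj_on_def)
    ultimately obtain k :: nat where "poly Q (2 * int k) \<noteq> 0"
      by (metis (mono_tags, lifting) finite_subset image_subsetI mem_Collect_eq)
    then have "(poly P (int (2 * k)))\<^sup>2 \<noteq> 1" unfolding Q_def by (simp add: algebra_simps power2_eq_square)
    then show thesis using that[of "2 * k"] by simp
  qed
  \<comment> \<open>A crude exponent: a nonzero number is not divisible by anything larger than its
    absolute value, and \<open>A < 2 ^ A\<close>.\<close>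
  define A where "A = nat \<bar>(poly P (int z0))\<^sup>2 - 1\<bar>"
  have "A > 0" using z0(2) by (simp add: A_def)
  have A: "\<not> 2 ^ A dvd (poly P (int z0))\<^sup>2 - 1"
  proof
    assume "2 ^ A dvd (poly P (int z0))\<^sup>2 - 1"
    then have "\<bar>2 ^ A\<bar> \<le> \<bar>(poly P (int z0))\<^sup>2 - 1\<bar>" using z0(2) by (intro dvd_imp_le_int) auto
    then have "int (2 ^ A) \<le> int A" by (simp add: A_def)
    then have "2 ^ A \<le> A" by (simp only: of_nat_le_iff)
    then show False using less_exp[of A] by simp
  qed
  have "\<exists>p > B. prime p \<and> l dvd p - 1 \<and> \<not> 2 ^ A dvd p - 1" for B
  proof -
    \<comment> \<open>A multiple \<open>z\<close> of every prime up to \<open>max B l\<close> (2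
      included, as \<open>z0\<close> is even) gives a value of \<open>P\<close> with larger prime
      factors only, because \<open>poly P 0\<close> is a unit. Prescribing \<open>z\<close> modulo
      \<open>2 ^ A\<close> at the same time keeps the value congruent to that at
      \<open>z0\<close>.\<close>
    define W where "W = (\<Prod>p | prime p \<and> odd p \<and> p \<le> max B l. p)"
    have fin: "finite {p. prime p \<and> odd p \<and> p \<le> max B l}"
      by (rule finite_subset[of _ "{..max B l}"]) auto
    have "coprime ((2::nat) ^ A) W" unfolding W_def by (intro coprime_power_left_iff[THEN iffD2] disjI1 prod_coprime_right) auto
    then obtain z where z: "[z = z0] (mod 2 ^ A)" "[z = 0] (mod W)"
      using binary_chinese_remainder_nat by blast
    define v where "v = poly P (int z)"
    have v: "[v = poly P (int z0)] (mod 2 ^ A)"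
    proof -
      have "[int z = int z0] (mod int (2 ^ A))" using z(1) by (simp only: cong_int_iff)
      then show ?thesis unfolding v_def by (intro poly_cong_int) simp
    qed
    have v0: "\<not> int p dvd v" if "prime p" "p dvd z" for p
    proof
      assume "int p dvd v"
      moreover have "[v = poly P 0] (mod int p)" unfolding v_def
        by (rule poly_cong_int) (use that(2) in \<open>simp add: cong_0_iff\<close>)
      ultimately have "int p dvd poly P 0" by (metis cong_dvd_iff)
      then have "int p dvd 1" using P0 by (metis dvd_abs_iff)
      then show False using that(1) by (simp add: not_prime_unit)
    qed
    have "2 dvd z"
    proof -
      have "[z = z0] (mod 2)" by (rule cong_dvd_modulus_nat[OF z(1)]) (use \<open>A > 0\<close> in simp)
      then show ?thesis using z0(1) by (simp add: cong_dvd_iff)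
    qed
    then have "v \<noteq> 0" using v0[of 2] by auto
    have big: "p > max B l" if p: "prime p" "int p dvd v" for p
    proof (rule ccontr)
      assume "\<not> p > max B l"
      moreover have "odd p" using v0[of 2] \<open>2 dvd z\<close> p
        by (metis even_of_nat dvd_trans primes_dvd_imp_eq two_is_prime_nat of_nat_numeral)
      ultimately have "p dvd W" unfolding W_def using fin p(1) by (intro dvd_prodI) auto
      then have "p dvd z" using z(2) by (metis cong_0_iff dvd_trans)
      then show False using v0 p by blast
    qed
    \<comment> \<open>If every prime factor were 1 modulo \<open>2 ^ A\<close>, so would be the
      absolute value of \<open>v\<close> and hence its square, against the choice of
      \<open>A\<close>. This also excludes that \<open>v\<close> is a unit.\<close>
    have "\<exists>p. prime p \<and> int p dvd v \<and> \<not> 2 ^ A dvd p - 1"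
    proof (rule ccontr)
      assume neg: "\<not> ?thesis"
      have "[nat \<bar>v\<bar> = 1] (mod 2 ^ A)"
      proof (rule cong_1_if_all_primes_cong_1)
        fix p assume p: "prime p" "p dvd nat \<bar>v\<bar>"
        then have "int p dvd v" by (metis int_dvd_int_iff int_nat_eq abs_ge_zero dvd_abs_iff)
        then have "2 ^ A dvd p - 1" using neg p(1) by blast
        then show "[p = 1] (mod 2 ^ A)" using prime_ge_1_nat[OF p(1)]
          by (simp add: cong_altdef_nat)
      qed (use \<open>v \<noteq> 0\<close> in simp)
      then have "[int (nat \<bar>v\<bar>) = int 1] (mod int (2 ^ A))" by (simp only: cong_int_iff)
      then have "[\<bar>v\<bar> = 1] (mod 2 ^ A)" by simp
      then have "[\<bar>v\<bar>\<^sup>2 = 1\<^sup>2] (mod 2 ^ A)" by (rule cong_pow)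
      then have "[v\<^sup>2 = 1] (mod 2 ^ A)" by simp
      moreover have "[v\<^sup>2 = (poly P (int z0))\<^sup>2] (mod 2 ^ A)" by (rule cong_pow[OF v])
      ultimately have "[(poly P (int z0))\<^sup>2 = 1] (mod 2 ^ A)" by (metis cong_sym cong_trans)
      then show False using A by (simp add: cong_iff_dvd_diff)
    qed
    then obtain p where p: "prime p" "int p dvd v" "\<not> 2 ^ A dvd p - 1" by blast
    have "\<not> p dvd l" using big[OF p(1,2)] l by (auto dest: dvd_imp_le)
    then have "l dvd p - 1"
      using ord_prime_dvd_cyclotomic_factor[OF PL L p(1)] p(2) unfolding v_def by blast
    then show ?thesis using p big[OF p(1,2)] by auto
  qed
  then show thesis by (rule that)
qed

section \<open>Prescribed power residue classes of differences\<close>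

lemma card_filter_eq_sum: "finite A \<Longrightarrow> card {x \<in> A. P x} = (\<Sum>x\<in>A. if P x then 1 else 0)"
  by (subst card_eq_sum) (rule sum.inter_filter)

text \<open>\<open>\<chi>\<close> is the discrete logarithm reduced modulo \<open>m\<close>; its
  fibres on the units are the cosets of the subgroup of \<open>m\<close>-th powers.\<close>

locale power_residue_classes =
  fixes Q m :: nat and \<chi> :: "int \<Rightarrow> nat"
  assumes prime_Q: "prime Q" and m_dvd: "m dvd Q - 1"
    and chi_less: "\<not> int Q dvd x \<Longrightarrow> \<chi> x < m"
    and chi_mult: "\<not> int Q dvd x \<Longrightarrow> \<not> int Q dvd y \<Longrightarrow> \<chi> (x * y) = (\<chi> x + \<chi> y) mod m"
    and chi_cong: "[x = y] (mod int Q) \<Longrightarrow> \<chi> x = \<chi> y"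
    and card_chi: "r < m \<Longrightarrow> card {x \<in> {0..<int Q}. \<not> int Q dvd x \<and> \<chi> x = r} = (Q - 1) div m"

text \<open>For the last clause: -1 has discrete logarithm \<open>(Q - 1) div 2\<close>, which is
  \<open>e\<close> times an odd number and therefore \<open>e\<close> modulo
  \<open>2 * e\<close>.\<close>

lemma ex_power_residue_classes:
  assumes Q: "prime Q" and m: "m dvd Q - 1"
  obtains \<chi> where "power_residue_classes Q m \<chi>"
    "\<And>e. m = 2 * e \<Longrightarrow> odd ((Q - 1) div m) \<Longrightarrow> \<chi> (- 1) = e"
proof -
  have Q1: "Q > 1" using Q by (rule prime_gt_1_nat)
  obtain g where g: "residue_primroot Q g" using prime_primitive_root_exists[OF Q1 Q] by blast
  have cop: "coprime Q g" and ord: "ord Q g = Q - 1"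
    using g Q by (simp_all add: residue_primroot_def totient_prime)
  have bij: "bij_betw (\<lambda>i. g ^ i mod Q) {..<Q - 1} {0<..<Q}"
    using residue_primroot_is_generator[OF Q1 g] Q
    by (simp add: totient_prime totatives_prime greaterThanLessThan_def)
  define ind where "ind x = inv_into {..<Q - 1} (\<lambda>i. g ^ i mod Q) (nat (x mod int Q))" for x
  have range_x: "nat (x mod int Q) \<in> {0<..<Q}" if "\<not> int Q dvd x" for x
  proof -
    have "x mod int Q \<noteq> 0" "0 \<le> x mod int Q" "x mod int Q < int Q"
      using that Q1 by (auto simp: dvd_eq_mod_eq_0)
    then show ?thesis by (auto simp: nat_less_iff)
  qed
  have ind: "ind x < Q - 1" "[int g ^ ind x = x] (mod int Q)" if "\<not> int Q dvd x" for x
  proof -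
    have "ind x \<in> {..<Q - 1}" unfolding ind_def
      by (rule inv_into_into) (use bij range_x[OF that] in \<open>simp add: bij_betw_def\<close>)
    then show "ind x < Q - 1" by simp
    have "g ^ ind x mod Q = nat (x mod int Q)"
      unfolding ind_def by (rule bij_betw_inv_into_right[OF bij range_x[OF that]])
    then have "int (g ^ ind x mod Q) = x mod int Q" using Q1 by simp
    then show "[int g ^ ind x = x] (mod int Q)" by (simp add: cong_def zmod_int)
  qed
  have ind_eq: "[ind x = i] (mod Q - 1)" if "\<not> int Q dvd x" "[int g ^ i = x] (mod int Q)" for x i
  proof -
    have "[int (g ^ ind x) = int (g ^ i)] (mod int Q)"
      using ind(2)[OF that(1)] that(2) by (metis cong_sym cong_trans of_nat_power)
    then have "[g ^ ind x = g ^ i] (mod Q)" by (simp only: cong_int_iff)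
    then show ?thesis using order_divides_expdiff[OF cop] ord by simp
  qed
  have pQ: "prime (int Q)" using Q by simp
  define \<chi> where "\<chi> x = ind x mod m" for x
  have m0: "m > 0" using m Q1 by (auto intro: Nat.gr0I)
  have chi: "\<chi> x = i mod m" if "\<not> int Q dvd x" "[int g ^ i = x] (mod int Q)" for x i
    using cong_dvd_modulus_nat[OF ind_eq[OF that] m] by (simp add: \<chi>_def cong_def)
  have "power_residue_classes Q m \<chi>"
  proof
    fix x y :: int
    show "\<chi> x < m" using m0 by (simp add: \<chi>_def)
    show "\<chi> (x * y) = (\<chi> x + \<chi> y) mod m" if "\<not> int Q dvd x" "\<not> int Q dvd y"
    proof -
      have "\<not> int Q dvd x * y" using that pQ by (simp add: prime_dvd_mult_iff)
      moreover have "[int g ^ (ind x + ind y) = x * y] (mod int Q)"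
        unfolding power_add by (intro cong_mult ind that)
      ultimately show ?thesis using chi by (simp add: \<chi>_def mod_add_eq)
    qed
    show "\<chi> x = \<chi> y" if "[x = y] (mod int Q)"
      using that by (simp add: \<chi>_def ind_def cong_def)
  next
    fix r assume r: "r < m"
    obtain h where h: "Q - 1 = m * h" using m by (auto simp: dvd_def)
    have "bij_betw (\<lambda>i. int (g ^ (r + m * i) mod Q)) {..<h} {x \<in> {0..<int Q}. \<not> int Q dvd x \<and> \<chi> x = r}"
    proof (rule bij_betwI')
      fix i j assume ij: "i \<in> {..<h}" "j \<in> {..<h}"
      have lt: "r + m * i < Q - 1" if "i < h" for i
      proof -
        have "r + m * i < m * Suc i" using r by simp
        also have "\<dots> \<le> m * h" using that by (intro mult_le_mono2) simp
        finally show ?thesis using h by simp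
      qed
      have "g ^ (r + m * i) mod Q = g ^ (r + m * j) mod Q \<longleftrightarrow> r + m * i = r + m * j"
        using bij lt ij unfolding bij_betw_def by (intro inj_on_eq_iff) auto
      then show "int (g ^ (r + m * i) mod Q) = int (g ^ (r + m * j) mod Q) \<longleftrightarrow> i = j"
        using m0 by simp
    next
      fix i assume "i \<in> {..<h}"
      let ?x = "int (g ^ (r + m * i) mod Q)"
      have "\<not> Q dvd g" using cop Q1 by (metis coprime_absorb_left nat_dvd_1_iff_1 less_irrefl is_unit_gcd)
      then have "\<not> Q dvd g ^ (r + m * i)" using Q by (metis prime_dvd_power)
      then have nd: "\<not> int Q dvd ?x" by (simp add: dvd_mod_iff)
      have "\<chi> ?x = (r + m * i) mod m"
        by (rule chi[OF nd]) (simp add: cong_def zmod_int)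
      then show "?x \<in> {x \<in> {0..<int Q}. \<not> int Q dvd x \<and> \<chi> x = r}" using nd r Q1 by simp
    next
      fix y assume y: "y \<in> {x \<in> {0..<int Q}. \<not> int Q dvd x \<and> \<chi> x = r}"
      then have nd: "\<not> int Q dvd y" by simp
      have "ind y mod m = r" using y by (simp add: \<chi>_def)
      then have eq: "ind y = r + m * (ind y div m)" by (metis mod_mult_div_eq add.commute)
      have "ind y div m < h" using ind(1)[OF nd] h m0 by (simp add: div_less_iff_less_mult mult.commute)
      moreover have "y = int (g ^ ind y mod Q)"
        using ind(2)[OF nd] y by (simp add: cong_def zmod_int)
      ultimately show "\<exists>x\<in>{..<h}. y = int (g ^ (r + m * x) mod Q)" using eq by (metis lessThan_iff)
    qed
    then have "card {x \<in> {0..<int Q}. \<not> int Q dvd x \<and> \<chi> x = r} = h"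
      using bij_betw_same_card by fastforce
    then show "card {x \<in> {0..<int Q}. \<not> int Q dvd x \<and> \<chi> x = r} = (Q - 1) div m" using h m0 by simp
  qed (use Q m in auto)
  moreover have "\<chi> (- 1) = e" if e: "m = 2 * e" "odd ((Q - 1) div m)" for e
  proof -
    obtain h where h: "Q - 1 = m * h" using m by (auto simp: dvd_def)
    have "odd h" using e h m0 by simp
    have nd: "\<not> int Q dvd - 1" using Q1 by simp
    define i where "i = ind (- 1)"
    have i: "i < Q - 1" "[int g ^ i = - 1] (mod int Q)" using ind[OF nd] unfolding i_def by auto
    have "[int g ^ i * int g ^ i = - 1 * - 1] (mod int Q)" by (intro cong_mult i)
    then have "[int (g ^ (2 * i)) = int (g ^ 0)] (mod int Q)" by (simp add: power_add mult_2)
    then have "[g ^ (2 * i) = g ^ 0] (mod Q)" by (simp only: cong_int_iff)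
    then have "[2 * i = 0] (mod Q - 1)" using order_divides_expdiff[OF cop, of "2 * i" 0] ord by simp
    then obtain k where k: "2 * i = (Q - 1) * k" by (auto simp: cong_0_iff dvd_def)
    have "i > 0"
    proof (rule Nat.gr0I)
      assume "i = 0"
      then have "int Q dvd 2" using i(2) by (simp add: cong_iff_dvd_diff)
      then have "int Q \<le> 2" by (rule zdvd_imp_le) simp
      moreover have "Q - 1 = 2 * (e * h)" using e h by simp
      moreover have "e * h > 0" using e(1) m0 \<open>odd h\<close> by (auto intro: odd_pos)
      ultimately show False by linarith
    qed
    then have "0 < k" using k by (cases k) auto
    moreover have "(Q - 1) * k < (Q - 1) * 2" using i(1) k by linarith
    then have "k < 2" by simp
    ultimately have "2 * i = Q - 1" using k by (cases "k = 1") auto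
    then have "i = e * h" using h e by simp
    moreover obtain s where "h = 2 * s + 1" using \<open>odd h\<close> by (rule oddE)
    ultimately have "i = e + m * s" using e by (simp add: algebra_simps)
    then show ?thesis using e m0 unfolding \<chi>_def i_def[symmetric] by simp
  qed
  ultimately show thesis by (rule that)
qed

context power_residue_classes
begin

lemma Q_gt_1: "Q > 1" using prime_Q by (rule prime_gt_1_nat)

lemma m_pos: "m > 0" using m_dvd Q_gt_1 by (auto intro: Nat.gr0I)

definition class_size :: nat where "class_size = (Q - 1) div m"

lemma m_mult_class_size: "m * class_size = Q - 1" unfolding class_size_def using m_dvd by simp

lemma prime_int_Q: "prime (int Q)" using prime_Q by simp

definition nbrs :: "int set \<Rightarrow> nat \<Rightarrow> int \<Rightarrow> int set" where
  "nbrs U r x = {v \<in> U. \<not> int Q dvd x - v \<and> \<chi> (x - v) = r}"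

lemma card_shifted_class:
  assumes "r < m"
  shows "card {x \<in> {0..<int Q}. \<not> int Q dvd x - v \<and> \<chi> (x - v) = r} = class_size"
proof -
  have "bij_betw (\<lambda>x. (x - v) mod int Q) {x \<in> {0..<int Q}. \<not> int Q dvd x - v \<and> \<chi> (x - v) = r}
          {x \<in> {0..<int Q}. \<not> int Q dvd x \<and> \<chi> x = r}"
  proof (rule bij_betw_byWitness[where f' = "\<lambda>y. (y + v) mod int Q"])
    have 1: "((x - v) mod int Q + v) mod int Q = x mod int Q" for x by (simp add: mod_simps)
    have 2: "((y + v) mod int Q - v) mod int Q = y mod int Q" for y by (simp add: mod_simps)
    show "\<forall>a\<in>{x \<in> {0..<int Q}. \<not> int Q dvd x - v \<and> \<chi> (x - v) = r}.
            ((a - v) mod int Q + v) mod int Q = a" using 1 by simp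
    show "\<forall>a'\<in>{x \<in> {0..<int Q}. \<not> int Q dvd x \<and> \<chi> x = r}.
            ((a' + v) mod int Q - v) mod int Q = a'" using 2 by simp
    show "(\<lambda>x. (x - v) mod int Q) ` {x \<in> {0..<int Q}. \<not> int Q dvd x - v \<and> \<chi> (x - v) = r}
            \<subseteq> {x \<in> {0..<int Q}. \<not> int Q dvd x \<and> \<chi> x = r}"
    proof (intro image_subsetI)
      fix x assume "x \<in> {x \<in> {0..<int Q}. \<not> int Q dvd x - v \<and> \<chi> (x - v) = r}"
      moreover have "\<chi> ((x - v) mod int Q) = \<chi> (x - v)" by (rule chi_cong) simp
      ultimately show "(x - v) mod int Q \<in> {x \<in> {0..<int Q}. \<not> int Q dvd x \<and> \<chi> x = r}"
        using Q_gt_1 by (simp add: dvd_mod_iff)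
    qed
    show "(\<lambda>y. (y + v) mod int Q) ` {x \<in> {0..<int Q}. \<not> int Q dvd x \<and> \<chi> x = r}
            \<subseteq> {x \<in> {0..<int Q}. \<not> int Q dvd x - v \<and> \<chi> (x - v) = r}"
    proof (intro image_subsetI)
      fix y assume y: "y \<in> {x \<in> {0..<int Q}. \<not> int Q dvd x \<and> \<chi> x = r}"
      have c: "[(y + v) mod int Q - v = y] (mod int Q)" using 2[of y] by (simp add: cong_def)
      then have "\<chi> ((y + v) mod int Q - v) = \<chi> y" by (rule chi_cong)
      moreover have "int Q dvd (y + v) mod int Q - v \<longleftrightarrow> int Q dvd y" using c by (rule cong_dvd_iff)
      ultimately show "(y + v) mod int Q \<in> {x \<in> {0..<int Q}. \<not> int Q dvd x - v \<and> \<chi> (x - v) = r}"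
        using Q_gt_1 y by simp
    qed
  qed
  then show ?thesis using card_chi[OF assms] unfolding class_size_def by (simp add: bij_betw_same_card)
qed

text \<open>The quotient \<open>(x - v) / (x - v')\<close> lies in the subgroup of class 0, and it
  determines \<open>x\<close>, being a Moebius map of determinant \<open>v - v'\<close> up to
  sign.\<close>

lemma card_common_class_le:
  assumes vv: "v \<in> {0..<int Q}" "v' \<in> {0..<int Q}" "v \<noteq> v'"
  shows "card {x \<in> {0..<int Q}. \<not> int Q dvd x - v \<and> \<not> int Q dvd x - v' \<and> \<chi> (x - v) = \<chi> (x - v')} \<le> class_size"
    (is "card ?S \<le> class_size")
proof -
  let ?T = "{y \<in> {0..<int Q}. \<not> int Q dvd y \<and> \<chi> y = 0}"
  have vv': "\<not> int Q dvd v - v'"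
  proof
    assume "int Q dvd v - v'"
    then have "[v = v'] (mod int Q)" by (simp add: cong_iff_dvd_diff)
    then show False using vv by (simp add: cong_def)
  qed
  have "\<forall>x\<in>?S. \<exists>y. y \<in> ?T \<and> [y * (x - v') = x - v] (mod int Q)"
  proof
    fix x assume x: "x \<in> ?S"
    then have "coprime (x - v') (int Q)"
      using prime_int_Q by (simp add: coprime_commute prime_imp_coprime)
    then obtain c where c: "[(x - v') * c = 1] (mod int Q)" using cong_solve_coprime_int by blast
    define y where "y = (c * (x - v)) mod int Q"
    have "[y * (x - v') = c * (x - v) * (x - v')] (mod int Q)"
      unfolding y_def by (rule cong_scalar_right) simp
    also have "c * (x - v) * (x - v') = ((x - v') * c) * (x - v)" by (simp add: mult_ac)
    also have "[\<dots> = 1 * (x - v)] (mod int Q)" by (rule cong_scalar_right[OF c])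
    finally have y: "[y * (x - v') = x - v] (mod int Q)" by simp
    have nd: "\<not> int Q dvd y"
      using cong_dvd_iff[OF y] x by auto
    have "\<chi> (x - v) = (\<chi> y + \<chi> (x - v')) mod m"
      using chi_cong[OF y] chi_mult[OF nd] x by auto
    moreover have "\<chi> (x - v') < m" using chi_less x by auto
    ultimately have "[\<chi> y + \<chi> (x - v) = 0 + \<chi> (x - v)] (mod m)" using x by (auto simp: cong_def)
    then have "[\<chi> y = 0] (mod m)" by (simp only: cong_add_rcancel_nat)
    then have "\<chi> y = 0" using chi_less[OF nd] by (simp add: cong_def)
    moreover have "y \<in> {0..<int Q}" unfolding y_def using Q_gt_1 by simp
    ultimately show "\<exists>y. y \<in> ?T \<and> [y * (x - v') = x - v] (mod int Q)" using nd y by blast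
  qed
  from bchoice[OF this] obtain f where f: "\<forall>x\<in>?S. f x \<in> ?T \<and> [f x * (x - v') = x - v] (mod int Q)" ..
  have "inj_on f ?S"
  proof (rule inj_onI)
    fix x z assume xz: "x \<in> ?S" "z \<in> ?S" "f x = f z"
    have fx: "[f x * (x - v') = x - v] (mod int Q)" using f[rule_format, OF xz(1)] by (rule conjunct2)
    have "[f x * (z - v') = z - v] (mod int Q)"
      using f[rule_format, OF xz(2)] unfolding xz(3) by (rule conjunct2)
    then have "[f x * (x - v') - f x * (z - v') = (x - v) - (z - v)] (mod int Q)"
      by (rule cong_diff[OF fx])
    then have "int Q dvd (f x * (x - v') - f x * (z - v')) - ((x - v) - (z - v))"
      by (simp add: cong_iff_dvd_diff)
    moreover have "(f x * (x - v') - f x * (z - v')) - ((x - v) - (z - v)) = (f x - 1) * (x - z)"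
      by (simp add: algebra_simps)
    ultimately consider "int Q dvd f x - 1" | "int Q dvd x - z"
      using prime_int_Q by (metis prime_dvd_mult_iff)
    then show "x = z"
    proof cases
      case 1
      have "int Q dvd f x * (x - v') - (x - v)" using fx by (simp add: cong_iff_dvd_diff)
      moreover have "f x * (x - v') - (x - v) = (f x - 1) * (x - v') + (v - v')"
        by (simp add: algebra_simps)
      ultimately have "int Q dvd (f x - 1) * (x - v') + (v - v')" by simp
      then have "int Q dvd v - v'" using 1 by (simp add: dvd_add_right_iff)
      then show ?thesis using vv' by simp
    next
      case 2
      then have "[x = z] (mod int Q)" by (simp add: cong_iff_dvd_diff)
      then show ?thesis using xz by (simp add: cong_def)
    qed
  qed
  moreover have "f ` ?S \<subseteq> ?T" by (rule image_subsetI) (rule f[rule_format, THEN conjunct1])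
  moreover have "finite ?T" by (rule finite_subset[of _ "{0..<int Q}"]) auto
  ultimately have "card ?S \<le> card ?T" by (rule card_inj_on_le)
  also have "card ?T = class_size" using card_chi[of 0] m_pos unfolding class_size_def by simp
  finally show ?thesis .
qed

lemma sum_card_nbrs:
  assumes U: "U \<subseteq> {0..<int Q}" and r: "r < m"
  shows "(\<Sum>x\<in>{0..<int Q}. card (nbrs U r x)) = card U * class_size"
proof -
  have fU: "finite U" using U finite_subset by blast
  have "(\<Sum>x\<in>{0..<int Q}. card (nbrs U r x)) =
      (\<Sum>x\<in>{0..<int Q}. \<Sum>v\<in>U. if \<not> int Q dvd x - v \<and> \<chi> (x - v) = r then 1 else 0)"
    unfolding nbrs_def using fU by (intro sum.cong refl card_filter_eq_sum)
  also have "\<dots> = (\<Sum>v\<in>U. \<Sum>x\<in>{0..<int Q}. if \<not> int Q dvd x - v \<and> \<chi> (x - v) = r then 1 else 0)"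
    by (rule sum.swap)
  also have "\<dots> = (\<Sum>v\<in>U. card {x \<in> {0..<int Q}. \<not> int Q dvd x - v \<and> \<chi> (x - v) = r})"
    by (intro sum.cong refl card_filter_eq_sum[symmetric]) simp
  also have "\<dots> = (\<Sum>v\<in>U. class_size)" by (intro sum.cong refl card_shifted_class r)
  finally show ?thesis by simp
qed

text \<open>Summing over \<open>r\<close> turns the squares into pairs \<open>v\<close>,
  \<open>v'\<close> whose differences from \<open>x\<close> share a class. An equal pair contributes
  at most \<open>Q\<close> values of \<open>x\<close>, a distinct pair at most
  \<open>class_size\<close>.\<close>

lemma sum_card_nbrs_squared_le:
  assumes U: "U \<subseteq> {0..<int Q}"
  shows "(\<Sum>r<m. \<Sum>x\<in>{0..<int Q}. (card (nbrs U r x))\<^sup>2) \<le> card U * Q + (card U)\<^sup>2 * class_size"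
proof -
  have fU: "finite U" using U finite_subset by blast
  let ?F = "{0..<int Q}"
  let ?C = "\<lambda>x v v'. \<not> int Q dvd x - v \<and> \<not> int Q dvd x - v' \<and> \<chi> (x - v) = \<chi> (x - v')"
  have fin: "finite (nbrs U r x)" for r x unfolding nbrs_def using fU by simp
  have "(\<Sum>r<m. (card (nbrs U r x))\<^sup>2) \<le> (\<Sum>p\<in>U \<times> U. if ?C x (fst p) (snd p) then 1 else 0)" for x
  proof -
    have "(\<Sum>r<m. (card (nbrs U r x))\<^sup>2) = (\<Sum>r<m. card (nbrs U r x \<times> nbrs U r x))"
      by (simp add: card_cartesian_product power2_eq_square)
    also have "\<dots> = card (\<Union>r<m. nbrs U r x \<times> nbrs U r x)"
      by (rule card_UN_disjoint[symmetric]) (use fin in \<open>auto simp: nbrs_def\<close>)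
    also have "\<dots> \<le> card {p \<in> U \<times> U. ?C x (fst p) (snd p)}"
      by (rule card_mono) (use fU in \<open>auto simp: nbrs_def\<close>)
    also have "\<dots> = (\<Sum>p\<in>U \<times> U. if ?C x (fst p) (snd p) then 1 else 0)"
      using fU by (intro card_filter_eq_sum) simp
    finally show ?thesis .
  qed
  then have "(\<Sum>x\<in>?F. \<Sum>r<m. (card (nbrs U r x))\<^sup>2) \<le>
      (\<Sum>x\<in>?F. \<Sum>p\<in>U \<times> U. if ?C x (fst p) (snd p) then 1 else 0)" by (intro sum_mono)
  also have "\<dots> = (\<Sum>p\<in>U \<times> U. \<Sum>x\<in>?F. if ?C x (fst p) (snd p) then 1 else 0)" by (rule sum.swap)
  also have "\<dots> = (\<Sum>p\<in>U \<times> U. card {x \<in> ?F. ?C x (fst p) (snd p)})"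
    by (intro sum.cong refl card_filter_eq_sum[symmetric]) simp
  also have "\<dots> \<le> (\<Sum>p\<in>U \<times> U. (if fst p = snd p then Q else 0) + class_size)"
  proof (intro sum_mono)
    fix p assume p: "p \<in> U \<times> U"
    show "card {x \<in> ?F. ?C x (fst p) (snd p)} \<le> (if fst p = snd p then Q else 0) + class_size"
    proof (cases "fst p = snd p")
      case True
      have "card {x \<in> ?F. ?C x (fst p) (snd p)} \<le> card ?F" by (rule card_mono) auto
      then show ?thesis using True by simp
    next
      case False
      have "fst p \<in> {0..<int Q}" "snd p \<in> {0..<int Q}" using p U by auto
      then show ?thesis using card_common_class_le[OF _ _ False] False by simp
    qed
  qed
  also have "\<dots> = (\<Sum>p\<in>U \<times> U. if fst p = snd p then Q else 0) + card (U \<times> U) * class_size"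
    by (simp add: sum.distrib)
  also have "(\<Sum>p\<in>U \<times> U. if fst p = snd p then Q else 0) = (\<Sum>a\<in>U. \<Sum>b\<in>U. if a = b then Q else 0)"
    by (simp add: sum.cartesian_product case_prod_beta)
  also have "\<dots> = card U * Q" using fU by simp
  finally have "(\<Sum>x\<in>?F. \<Sum>r<m. (card (nbrs U r x))\<^sup>2) \<le> card U * Q + (card U)\<^sup>2 * class_size"
    by (simp add: card_cartesian_product power2_eq_square)
  then show ?thesis by (subst sum.swap)
qed

text \<open>Chebyshev's inequality, the variance being summed over all classes at once: only this
  total, not the variance of a single class, is easy to count.\<close>

lemma card_bad_le:
  assumes U: "U \<subseteq> {0..<int Q}" and r: "r < m"
  shows "card {x \<in> {0..<int Q}. 2 * Q * card (nbrs U r x) < card U * class_size} * (card U * class_size\<^sup>2) \<le> 8 * Q ^ 3"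
    (is "card ?B * _ \<le> _")
proof -
  let ?F = "{0..<int Q}"
  define u where "u = real (card U)"
  \<comment> \<open>The mean of \<open>g r x\<close> over \<open>x\<close>, by
    \<open>sum_card_nbrs\<close>; it is the same for every \<open>r\<close>.\<close>
  define \<mu> where "\<mu> = u * class_size / Q"
  define g where "g r x = real (card (nbrs U r x))" for r x
  have Q: "real Q > 0" using Q_gt_1 by simp
  have uQ: "u \<le> Q" unfolding u_def using card_mono[OF _ U] by simp
  have u0: "u \<ge> 0" unfolding u_def by simp
  have hQ: "real m * real class_size = real Q - 1" using m_mult_class_size Q_gt_1 by (metis of_nat_1 of_nat_diff of_nat_mult less_imp_le)
  have h_le: "real class_size \<le> Q" using hQ m_pos Q_gt_1 by (smt (verit) mult_le_cancel_right1 of_nat_0_le_iff of_nat_1 of_nat_le_iff Suc_leI One_nat_def)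
  have "real (card ?B) * (\<mu> / 2)\<^sup>2 = (\<Sum>x\<in>?B. (\<mu> / 2)\<^sup>2)" by simp
  also have "\<dots> \<le> (\<Sum>x\<in>?B. (g r x - \<mu>)\<^sup>2)"
  proof (rule sum_mono)
    fix x assume "x \<in> ?B"
    then have "real (2 * Q * card (nbrs U r x)) < real (card U * class_size)" by (simp only: mem_Collect_eq of_nat_less_iff)
    then have "g r x < \<mu> / 2" unfolding g_def \<mu>_def u_def using Q by (simp add: field_simps)
    moreover have "\<mu> \<ge> 0" unfolding \<mu>_def using u0 by simp
    ultimately show "(\<mu> / 2)\<^sup>2 \<le> (g r x - \<mu>)\<^sup>2" by (intro abs_le_square_iff[THEN iffD1]) auto
  qed
  also have "\<dots> \<le> (\<Sum>x\<in>?F. (g r x - \<mu>)\<^sup>2)" by (rule sum_mono2) auto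
  also have "\<dots> \<le> (\<Sum>r<m. \<Sum>x\<in>?F. (g r x - \<mu>)\<^sup>2)"
    by (rule member_le_sum[of r "{..<m}"]) (use r in \<open>auto intro: sum_nonneg\<close>)
  also have "\<dots> = (\<Sum>r<m. \<Sum>x\<in>?F. (g r x)\<^sup>2) - 2 * \<mu> * (\<Sum>r<m. \<Sum>x\<in>?F. g r x) + m * Q * \<mu>\<^sup>2"
    by (simp add: power2_diff sum.distrib sum_subtractf sum_distrib_left sum_distrib_right mult_ac)
  also have "(\<Sum>r<m. \<Sum>x\<in>?F. g r x) = (\<Sum>r<m. u * class_size)"
  proof (rule sum.cong[OF refl])
    fix r assume "r \<in> {..<m}"
    then show "(\<Sum>x\<in>?F. g r x) = u * class_size"
      unfolding g_def u_def using sum_card_nbrs[OF U, of r] by (metis lessThan_iff of_nat_mult of_nat_sum)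
  qed
  also have "(\<Sum>r<m. \<Sum>x\<in>?F. (g r x)\<^sup>2) \<le> u * Q + u\<^sup>2 * class_size"
  proof -
    have "real (\<Sum>r<m. \<Sum>x\<in>?F. (card (nbrs U r x))\<^sup>2) \<le> real (card U * Q + (card U)\<^sup>2 * class_size)"
      using sum_card_nbrs_squared_le[OF U] by (simp only: of_nat_le_iff)
    then show ?thesis unfolding g_def u_def by simp
  qed
  \<comment> \<open>Since \<open>\<mu> * Q = u * class_size\<close> and
    \<open>m * class_size = Q - 1\<close>, the quadratic terms cancel up to
    \<open>\<mu> * u\<close>.\<close>
  also have "u * Q + u\<^sup>2 * class_size - 2 * \<mu> * (\<Sum>r<m. u * class_size) + m * Q * \<mu>\<^sup>2 \<le> 2 * u * Q"
  proof -
    have "2 * \<mu> * (\<Sum>r<m. u * class_size) = 2 * \<mu> * u * (real m * real class_size)" by simp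
    moreover have "m * Q * \<mu>\<^sup>2 = \<mu> * u * (real m * real class_size)"
      unfolding \<mu>_def using Q by (simp add: power2_eq_square)
    ultimately have "u * Q + u\<^sup>2 * class_size - 2 * \<mu> * (\<Sum>r<m. u * class_size) + m * Q * \<mu>\<^sup>2 =
        u * Q + u\<^sup>2 * class_size - \<mu> * u * (real Q - 1)" using hQ by simp
    also have "\<dots> = u * Q + \<mu> * u" unfolding \<mu>_def using Q by (simp add: field_simps power2_eq_square)
    also have "\<mu> * u \<le> Q * u"
    proof -
      have "u * class_size \<le> real Q * real Q" using uQ h_le u0 by (intro mult_mono) auto
      then show ?thesis unfolding \<mu>_def using Q u0 by (intro mult_right_mono) (auto simp: field_simps)
    qed
    finally show ?thesis by (simp add: algebra_simps)
  qed
  finally have main: "real (card ?B) * (\<mu> / 2)\<^sup>2 \<le> 2 * u * Q" by simp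
  show ?thesis
  proof (cases "card U = 0")
    case False
    then have u: "u > 0" unfolding u_def by simp
    have "real (card ?B) * (u * class_size / Q / 2)\<^sup>2 = u * (real (card ?B) * u * class_size\<^sup>2 / (4 * Q\<^sup>2))"
      by (simp add: power2_eq_square)
    then have "u * (real (card ?B) * u * class_size\<^sup>2 / (4 * Q\<^sup>2)) \<le> u * (2 * Q)"
      using main unfolding \<mu>_def by (simp add: mult_ac)
    then have "real (card ?B) * u * class_size\<^sup>2 / (4 * Q\<^sup>2) \<le> 2 * Q"
      using u by (rule mult_left_le_imp_le)
    then have "real (card ?B) * u * class_size\<^sup>2 \<le> 2 * Q * (4 * Q\<^sup>2)" using Q by (simp add: pos_divide_le_eq)
    then have "real (card ?B * (card U * class_size\<^sup>2)) \<le> real (8 * Q ^ 3)"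
      unfolding u_def by (simp add: power2_eq_square power3_eq_cube mult_ac)
    then show ?thesis by (simp only: of_nat_le_iff)
  qed simp
qed

end

text \<open>The point with the last index is chosen first, so that every earlier candidate set keeps
  a positive proportion of points in the prescribed class relative to it; the induction then
  continues inside these smaller sets, which is why it is stated for sets of density
  \<open>\<delta>\<close>. Half the mean still gives density \<open>\<delta> / (4 * m)\<close>. The
  threshold is uniform in \<open>\<chi>\<close>, \<open>U\<close> and \<open>\<rho>\<close>.\<close>

lemma ex_prescribed_differences_in:
  fixes \<delta> :: real and m k :: nat
  assumes "m > 0" "\<delta> > 0"
  shows "\<exists>Q0. \<forall>Q \<chi> U (\<rho> :: nat \<Rightarrow> nat \<Rightarrow> nat). Q \<ge> Q0 \<longrightarrow> power_residue_classes Q m \<chi> \<longrightarrow>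
           (\<forall>i<k. U i \<subseteq> {0..<int Q} \<and> \<delta> * Q \<le> card (U i)) \<longrightarrow> (\<forall>i j. \<rho> i j < m) \<longrightarrow>
           (\<exists>\<alpha>. (\<forall>i<k. \<alpha> i \<in> U i) \<and>
              (\<forall>j<k. \<forall>i<j. \<not> int Q dvd \<alpha> j - \<alpha> i \<and> \<chi> (\<alpha> j - \<alpha> i) = \<rho> i j))"
  using assms(2)
proof (induction k arbitrary: \<delta>)
  case 0
  then show ?case by simp
next
  case (Suc k)
  have d': "\<delta> / (4 * m) > 0" using Suc.prems assms(1) by simp
  obtain Q1 where Q1: "\<And>Q \<chi> U (\<rho> :: nat \<Rightarrow> nat \<Rightarrow> nat). Q \<ge> Q1 \<Longrightarrow> power_residue_classes Q m \<chi> \<Longrightarrow>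
           (\<forall>i<k. U i \<subseteq> {0..<int Q} \<and> \<delta> / (4 * m) * Q \<le> card (U i)) \<Longrightarrow> (\<forall>i j. \<rho> i j < m) \<Longrightarrow>
           (\<exists>\<alpha>. (\<forall>i<k. \<alpha> i \<in> U i) \<and>
              (\<forall>j<k. \<forall>i<j. \<not> int Q dvd \<alpha> j - \<alpha> i \<and> \<chi> (\<alpha> j - \<alpha> i) = \<rho> i j))"
    using Suc.IH[OF d'] by blast
  \<comment> \<open>By \<open>card_bad_le\<close>, with \<open>class_size \<ge> Q / (2 * m)\<close>,
    each \<open>i\<close> excludes at most \<open>32 * m^2 / \<delta>\<close> choices; past this
    threshold the \<open>k\<close> excluded sets cannot exhaust the \<open>\<delta> * Q\<close>
    candidates.\<close>
  define Q0 where "Q0 = max Q1 (nat \<lceil>32 * k * m\<^sup>2 / \<delta>\<^sup>2\<rceil> + 1)"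
  show ?case
  proof (intro exI[of _ Q0] allI impI)
    fix Q \<chi> and U :: "nat \<Rightarrow> int set" and \<rho> :: "nat \<Rightarrow> nat \<Rightarrow> nat"
    assume Q: "Q \<ge> Q0" and "power_residue_classes Q m \<chi>"
      and U: "\<forall>i<Suc k. U i \<subseteq> {0..<int Q} \<and> \<delta> * Q \<le> card (U i)" and \<rho>: "\<forall>i j. \<rho> i j < m"
    interpret power_residue_classes Q m \<chi> by fact
    have Qpos: "real Q > 0" using Q_gt_1 by simp
    have size_ge: "real class_size \<ge> Q / (2 * m)"
    proof -
      have "real m * real class_size = real Q - 1"
        using m_mult_class_size Q_gt_1 by (metis of_nat_1 of_nat_diff of_nat_mult less_imp_le)
      moreover have "real Q - 1 \<ge> Q / 2" using Q_gt_1 by simp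
      ultimately show ?thesis using assms(1) by (simp add: field_simps)
    qed
    define bad where "bad i = {x \<in> {0..<int Q}. 2 * Q * card (nbrs (U i) (\<rho> i k) x) < card (U i) * class_size}" for i
    have card_bad: "real (card (bad i)) \<le> 32 * m\<^sup>2 / \<delta>" if "i < k" for i
    proof -
      have Ui: "U i \<subseteq> {0..<int Q}" "\<delta> * Q \<le> card (U i)" using U that by auto
      have "real (card (bad i)) * (\<delta> * Q * (Q / (2 * m))\<^sup>2) \<le> real (card (bad i)) * (card (U i) * (real class_size)\<^sup>2)"
        using Ui(2) size_ge Suc.prems by (intro mult_left_mono mult_mono power_mono) auto
      also have "\<dots> = real (card (bad i) * (card (U i) * class_size\<^sup>2))" by simp
      also have "\<dots> \<le> real (8 * Q ^ 3)"
        using card_bad_le[OF Ui(1), of "\<rho> i k"] \<rho> unfolding bad_def by (simp only: of_nat_le_iff)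
      finally have "real Q ^ 3 * (real (card (bad i)) * \<delta> / (4 * m\<^sup>2)) \<le> real Q ^ 3 * 8"
        by (simp add: power2_eq_square power3_eq_cube field_simps)
      then have "real (card (bad i)) * \<delta> / (4 * m\<^sup>2) \<le> 8"
        by (rule mult_left_le_imp_le) (use Qpos in simp)
      then show ?thesis using Suc.prems assms(1) by (simp add: field_simps)
    qed
    have "real (card (\<Union>i<k. bad i)) \<le> real (\<Sum>i<k. card (bad i))"
      by (simp only: of_nat_le_iff) (rule card_UN_le, simp)
    also have "\<dots> = (\<Sum>i<k. real (card (bad i)))" by simp
    also have "\<dots> \<le> (\<Sum>i<k. 32 * m\<^sup>2 / \<delta>)" by (intro sum_mono card_bad) simp
    also have "\<dots> = 32 * k * m\<^sup>2 / \<delta>\<^sup>2 * \<delta>" using Suc.prems by (simp add: power2_eq_square)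
    also have "\<dots> < Q * \<delta>"
    proof (rule mult_strict_right_mono)
      have "32 * k * m\<^sup>2 / \<delta>\<^sup>2 \<le> nat \<lceil>32 * k * m\<^sup>2 / \<delta>\<^sup>2\<rceil>" by (rule real_nat_ceiling_ge)
      also have "nat \<lceil>32 * k * m\<^sup>2 / \<delta>\<^sup>2\<rceil> < Q" using Q unfolding Q0_def by linarith
      finally show "32 * k * m\<^sup>2 / \<delta>\<^sup>2 < Q" by simp
    qed (rule Suc.prems)
    also have "\<dots> \<le> card (U k)" using U by (simp add: mult.commute)
    finally have "card (\<Union>i<k. bad i) < card (U k)" by simp
    moreover have "finite (\<Union>i<k. bad i)"
      by (rule finite_subset[of _ "{0..<int Q}"]) (auto simp: bad_def)
    ultimately have "\<not> U k \<subseteq> (\<Union>i<k. bad i)" using card_mono by (metis leD)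
    then obtain x where x: "x \<in> U k" "\<And>i. i < k \<Longrightarrow> x \<notin> bad i" by blast
    have xF: "x \<in> {0..<int Q}" using x(1) U by blast
    define U' where "U' i = nbrs (U i) (\<rho> i k) x" for i
    have "\<forall>i<k. U' i \<subseteq> {0..<int Q} \<and> \<delta> / (4 * m) * Q \<le> card (U' i)"
    proof (intro allI impI conjI)
      fix i assume i: "i < k"
      have Ui: "U i \<subseteq> {0..<int Q}" "\<delta> * Q \<le> card (U i)" using U i by auto
      show "U' i \<subseteq> {0..<int Q}" using Ui unfolding U'_def nbrs_def by blast
      have "card (U i) * class_size \<le> 2 * Q * card (U' i)" using x(2)[OF i] xF unfolding bad_def U'_def by simp
      then have "real (card (U i) * class_size) \<le> real (2 * Q * card (U' i))" by (simp only: of_nat_le_iff)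
      then have le: "real (card (U i)) * class_size \<le> 2 * real Q * card (U' i)" by simp
      have "\<delta> * Q * (Q / (2 * m)) \<le> real (card (U i)) * class_size"
        using Ui(2) size_ge Suc.prems by (intro mult_mono) auto
      then have "\<delta> * Q * (Q / (2 * m)) \<le> 2 * real Q * card (U' i)" using le by linarith
      moreover have "\<delta> * Q * (Q / (2 * m)) = 2 * (real Q * (\<delta> / (4 * m) * Q))" by simp
      ultimately have "real Q * (\<delta> / (4 * m) * Q) \<le> real Q * real (card (U' i))" by linarith
      then show "\<delta> / (4 * m) * Q \<le> card (U' i)" using Qpos by (rule mult_left_le_imp_le)
    qed
    moreover have "Q \<ge> Q1" using Q unfolding Q0_def by simp
    ultimately obtain \<alpha> where \<alpha>: "\<And>i. i < k \<Longrightarrow> \<alpha> i \<in> U' i"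
      "\<And>i j. j < k \<Longrightarrow> i < j \<Longrightarrow> \<not> int Q dvd \<alpha> j - \<alpha> i \<and> \<chi> (\<alpha> j - \<alpha> i) = \<rho> i j"
      using Q1[OF _ \<open>power_residue_classes Q m \<chi>\<close> _ \<rho>, of U'] by metis
    show "\<exists>\<alpha>. (\<forall>i<Suc k. \<alpha> i \<in> U i) \<and>
        (\<forall>j<Suc k. \<forall>i<j. \<not> int Q dvd \<alpha> j - \<alpha> i \<and> \<chi> (\<alpha> j - \<alpha> i) = \<rho> i j)"
    proof (intro exI[of _ "\<alpha>(k := x)"] conjI allI impI)
      fix i assume "i < Suc k"
      then show "(\<alpha>(k := x)) i \<in> U i"
        using \<alpha>(1)[of i] x(1) by (cases "i = k") (auto simp: U'_def nbrs_def)
    next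
      fix j i assume ij: "j < Suc k" "i < j"
      have "\<not> int Q dvd (\<alpha>(k := x)) j - (\<alpha>(k := x)) i \<and> \<chi> ((\<alpha>(k := x)) j - (\<alpha>(k := x)) i) = \<rho> i j"
      proof (cases "j = k")
        case True
        then show ?thesis using \<alpha>(1)[of i] ij by (simp add: U'_def nbrs_def)
      next
        case False
        then show ?thesis using \<alpha>(2)[of j i] ij by simp
      qed
      then show "\<not> int Q dvd (\<alpha>(k := x)) j - (\<alpha>(k := x)) i"
        "\<chi> ((\<alpha>(k := x)) j - (\<alpha>(k := x)) i) = \<rho> i j" by simp_all
    qed
  qed
qed

lemma ex_prescribed_differences:
  assumes "m > 0"
  obtains Q0 where "\<And>Q \<chi> (\<rho> :: nat \<Rightarrow> nat \<Rightarrow> nat). Q \<ge> Q0 \<Longrightarrow> power_residue_classes Q m \<chi> \<Longrightarrow> (\<And>i j. \<rho> i j < m) \<Longrightarrow>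
    \<exists>\<alpha>. \<forall>j<k. \<forall>i<j. \<not> int Q dvd \<alpha> j - \<alpha> i \<and> \<chi> (\<alpha> j - \<alpha> i) = \<rho> i j"
proof -
  obtain Q0 where Q0: "\<forall>Q \<chi> U (\<rho> :: nat \<Rightarrow> nat \<Rightarrow> nat). Q \<ge> Q0 \<longrightarrow> power_residue_classes Q m \<chi> \<longrightarrow>
           (\<forall>i<k. U i \<subseteq> {0..<int Q} \<and> 1 * real Q \<le> card (U i)) \<longrightarrow> (\<forall>i j. \<rho> i j < m) \<longrightarrow>
           (\<exists>\<alpha>. (\<forall>i<k. \<alpha> i \<in> U i) \<and>
              (\<forall>j<k. \<forall>i<j. \<not> int Q dvd \<alpha> j - \<alpha> i \<and> \<chi> (\<alpha> j - \<alpha> i) = \<rho> i j))"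
    using ex_prescribed_differences_in[OF assms, of 1 k] by auto
  show thesis
  proof (rule that)
    fix Q \<chi> and \<rho> :: "nat \<Rightarrow> nat \<Rightarrow> nat"
    assume "Q \<ge> Q0" "power_residue_classes Q m \<chi>" "\<And>i j. \<rho> i j < m"
    then show "\<exists>\<alpha>. \<forall>j<k. \<forall>i<j. \<not> int Q dvd \<alpha> j - \<alpha> i \<and> \<chi> (\<alpha> j - \<alpha> i) = \<rho> i j"
      using Q0[rule_format, of Q \<chi> "\<lambda>_. {0..<int Q}" \<rho>] by auto
  qed
qed

section \<open>Decomposing a blow-up of a clique of prime order\<close>

text \<open>Base copies are indexed by shift vectors \<open>y\<close>: class \<open>i\<close> occupies the second coordinates
  \<open>y i, \<dots>, y i + as ! i - 1\<close> modulo \<open>t\<close>. When \<open>as ! i\<close> divides \<open>t\<close>, a residue \<open>s\<close> is covered by class \<open>i\<close>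
  for exactly one shift in each residue class modulo \<open>as ! i\<close>. So, for given second coordinates of
  the ends of an edge, \<open>hit\<close> determines the base copy and the two classes that cover them. The
  difference of classes \<open>i\<close> and \<open>j\<close> in copy \<open>y\<close> is then put into the coset numbered by \<open>hit as y i j\<close>.\<close>

definition shifts :: "nat list \<Rightarrow> nat \<Rightarrow> (nat \<Rightarrow> nat) set" where
  "shifts as t = {..<length as} \<rightarrow>\<^sub>E {..<t}"

definition hit :: "nat list \<Rightarrow> (nat \<Rightarrow> nat) \<Rightarrow> nat \<Rightarrow> nat \<Rightarrow> nat \<times> nat \<times> nat \<times> nat \<times> (nat \<Rightarrow> nat)" where
  "hit as y i j = (i, j, y i mod as ! i, y j mod as ! j, restrict y ({..<length as} - {i, j}))"

definition hits :: "nat list \<Rightarrow> nat \<Rightarrow> (nat \<times> nat \<times> nat \<times> nat \<times> (nat \<Rightarrow> nat)) set" where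
  "hits as t = {hit as y i j | y i j. y \<in> shifts as t \<and> i < j \<and> j < length as}"

lemma finite_hits: "finite (hits as t)"
proof -
  have "hits as t \<subseteq> (\<lambda>(y, i, j). hit as y i j) ` (shifts as t \<times> {..<length as} \<times> {..<length as})"
  proof
    fix q assume "q \<in> hits as t"
    then obtain y i j where "q = hit as y i j" "y \<in> shifts as t" "i < j" "j < length as"
      unfolding hits_def by blast
    then show "q \<in> (\<lambda>(y, i, j). hit as y i j) ` (shifts as t \<times> {..<length as} \<times> {..<length as})"
      by (intro image_eqI[of _ _ "(y, i, j)"]) auto
  qed
  moreover have "finite (shifts as t \<times> {..<length as} \<times> {..<length as})"
    unfolding shifts_def by (intro finite_cartesian_product finite_PiE) auto
  ultimately show ?thesis by (meson finite_imageI finite_subset)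
qed

text \<open>The starting points of the cyclic windows of length \<open>a\<close> that cover
  \<open>s\<close> are \<open>a\<close> consecutive positions, so they meet every residue modulo
  \<open>a\<close>; \<open>a dvd t\<close> makes these residues well defined around the
  cycle.\<close>

lemma ex_shift:
  fixes a t p s :: nat
  assumes "a dvd t" "p < a" "s < t"
  obtains x l where "x < t" "x mod a = p" "l < a" "(x + l) mod t = s"
proof -
  define l where "l = nat ((int s - int p) mod int a)"
  define x where "x = nat ((int s - int l) mod int t)"
  have l: "int l = (int s - int p) mod int a" "l < a" unfolding l_def using assms(2) by (auto simp: nat_less_iff)
  have x: "int x = (int s - int l) mod int t" "x < t" unfolding x_def using assms(3) by (auto simp: nat_less_iff)
  have "int (x mod a) = (int s - int l) mod int a"
    unfolding zmod_int x(1) using assms(1) by (simp add: mod_mod_cancel)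
  also have "\<dots> = int p mod int a" unfolding l(1) by (simp add: mod_simps)
  also have "\<dots> = int p" using assms(2) by simp
  finally have "x mod a = p" by simp
  moreover have "int ((x + l) mod t) = int s"
    unfolding zmod_int of_nat_add x(1) using assms(3) by (simp add: mod_simps)
  then have "(x + l) mod t = s" by simp
  ultimately show thesis using that x(2) l(2) by blast
qed

lemma shift_unique:
  fixes a t x x' l l' :: nat
  assumes a: "a dvd t" and "x < t" "x' < t" "l < a" "l' < a" and m: "x mod a = x' mod a"
    and eq: "(x + l) mod t = (x' + l') mod t"
  shows "x = x'"
proof -
  have "[x + l = x' + l'] (mod t)" using eq by (simp add: cong_def)
  then have "[x + l = x' + l'] (mod a)" using a by (rule cong_dvd_modulus_nat)
  moreover have xx: "[x' + l = x + l] (mod a)" using m by (intro cong_add) (simp_all add: cong_def)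
  ultimately have "[x' + l = x' + l'] (mod a)" by (meson cong_trans)
  then have "[l = l'] (mod a)" by (simp only: cong_add_lcancel_nat)
  then have "l = l'" using assms(4,5) by (simp add: cong_def)
  then have "[x + l = x' + l] (mod t)" using eq by (simp add: cong_def)
  then have "[x = x'] (mod t)" by (simp add: cong_add_rcancel_nat)
  then show ?thesis using assms(2,3) by (simp add: cong_def)
qed

context power_residue_classes
begin

text \<open>Of \<open>d\<close> and \<open>- d\<close> exactly one lies in a coset numbered below
  \<open>e\<close>; orient each edge accordingly. The coset of its difference then reveals a hit and
  a number \<open>s\<close>, the second coordinates of its ends complete the shift vector, the
  difference fixes the scaling factor \<open>h\<close>, and the position fixes the translation
  \<open>b\<close>. Hence exactly one copy covers the edge.\<close>

lemma decomposable_blowup_of_prime_clique: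
  fixes as :: "nat list"
  assumes m: "m = 2 * e" and neg: "\<chi> (- 1) = e"
    and e: "e = card (hits as t) * c"
    and dvd: "\<And>i. i < length as \<Longrightarrow> as ! i dvd t" and pos: "\<And>i. i < length as \<Longrightarrow> as ! i > 0" and t: "t > 0"
    and pres: "\<And>\<rho>. (\<And>i j. \<rho> i j < m) \<Longrightarrow>
      \<exists>\<alpha>. \<forall>j<length as. \<forall>i<j. \<not> int Q dvd \<alpha> j - \<alpha> i \<and> \<chi> (\<alpha> j - \<alpha> i) = \<rho> i j"
  shows "decomposable {as} ({0..<int Q} \<times> {..<t}) cross"
proof -
  let ?k = "length as"
  let ?Y = "shifts as t"
  \<comment> \<open>There are \<open>c\<close> cosets per hit: every shift vector gets
    \<open>c\<close> base copies, numbered by \<open>s\<close>, so that all cosets below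
    \<open>e\<close> are used.\<close>
  obtain \<iota> where \<iota>: "bij_betw \<iota> (hits as t \<times> {..<c}) {..<e}"
    using ex_bij_betw_finite_nat[of "hits as t \<times> {..<c}"] finite_hits e
    by (auto simp: card_cartesian_product atLeast0LessThan)
  have e0: "e > 0" using m m_pos by simp
  \<comment> \<open>The default 0 keeps the values below \<open>m\<close> for all arguments, as
    \<open>pres\<close> demands.\<close>
  define \<rho> where "\<rho> y s i j = (if y \<in> ?Y \<and> i < j \<and> j < ?k \<and> s < c then \<iota> (hit as y i j, s) else 0)" for y s i j
  have \<rho>_less: "\<rho> y s i j < e" for y s i j
  proof (cases "y \<in> ?Y \<and> i < j \<and> j < ?k \<and> s < c")
    case True
    then have "(hit as y i j, s) \<in> hits as t \<times> {..<c}" unfolding hits_def by blast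
    then show ?thesis using True bij_betw_apply[OF \<iota>] unfolding \<rho>_def by auto
  next
    case False
    then show ?thesis unfolding \<rho>_def using e0 by auto
  qed
  have "\<forall>ys. \<exists>\<alpha>. \<forall>j<?k. \<forall>i<j. \<not> int Q dvd \<alpha> j - \<alpha> i \<and> \<chi> (\<alpha> j - \<alpha> i) = \<rho> (fst ys) (snd ys) i j"
  proof
    fix ys :: "(nat \<Rightarrow> nat) \<times> nat"
    have "\<rho> (fst ys) (snd ys) i j < m" for i j using \<rho>_less[of "fst ys" "snd ys" i j] m by linarith
    then show "\<exists>\<alpha>. \<forall>j<?k. \<forall>i<j. \<not> int Q dvd \<alpha> j - \<alpha> i \<and> \<chi> (\<alpha> j - \<alpha> i) = \<rho> (fst ys) (snd ys) i j"
      by (rule pres)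
  qed
  from choice[OF this] obtain \<alpha>0 where
    \<alpha>0: "\<forall>ys. \<forall>j<?k. \<forall>i<j. \<not> int Q dvd \<alpha>0 ys j - \<alpha>0 ys i \<and>
      \<chi> (\<alpha>0 ys j - \<alpha>0 ys i) = \<rho> (fst ys) (snd ys) i j" ..
  define \<alpha> where "\<alpha> y s = \<alpha>0 (y, s)" for y s
  have \<alpha>: "\<not> int Q dvd \<alpha> y s j - \<alpha> y s i" "\<chi> (\<alpha> y s j - \<alpha> y s i) = \<rho> y s i j"
    if "i < j" "j < ?k" for y s i j
    using \<alpha>0[rule_format, OF that(2,1), of "(y, s)"] unfolding \<alpha>_def by simp_all
  have \<alpha>_ne: "\<not> int Q dvd \<alpha> y s j - \<alpha> y s i" if "i \<noteq> j" "i < ?k" "j < ?k" for y s i j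
    using \<alpha>(1)[of i j y s] \<alpha>(1)[of j i y s] that by (metis dvd_diff_commute linorder_neqE_nat)
  define H where "H = {x \<in> {0..<int Q}. \<not> int Q dvd x \<and> \<chi> x = 0}"
  define f where "f = (\<lambda>(y, s, h, b) (i, l). ((b + h * \<alpha> y s i) mod int Q, (y i + l) mod t))"
  define P where "P = ?Y \<times> {..<c} \<times> H \<times> {0..<int Q}"
  define \<beta> where "\<beta> p = f p ` mp_verts as" for p
  have chi_neg: "\<chi> (- x) = (e + \<chi> x) mod m" if "\<not> int Q dvd x" for x
    using chi_mult[of "- 1" x] that neg Q_gt_1 by simp
  have forward: "i < j \<and> i < ?k \<and> j < ?k \<and> [h * (\<alpha> y s j - \<alpha> y s i) = x' - x] (mod int Q) \<and>
      \<chi> (x' - x) = \<iota> (hit as y i j, s)"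
    if p: "(y, s, h, b) \<in> P" and x: "x \<in> {0..<int Q}" "x' \<in> {0..<int Q}" "x \<noteq> x'" "\<chi> (x' - x) < e"
      and i: "i < ?k" "x = (b + h * \<alpha> y s i) mod int Q" and j: "j < ?k" "x' = (b + h * \<alpha> y s j) mod int Q"
    for y s h b x x' i j
  proof -
    have h: "\<not> int Q dvd h" "\<chi> h = 0" and ys: "y \<in> ?Y" "s < c" using p unfolding P_def H_def by auto
    have "i \<noteq> j" using i j x by auto
    have nd: "\<not> int Q dvd x' - x"
    proof
      assume "int Q dvd x' - x"
      then have "[x' = x] (mod int Q)" by (simp add: cong_iff_dvd_diff)
      then show False using x by (simp add: cong_def)
    qed
    have diff: "[h * (\<alpha> y s j - \<alpha> y s i) = x' - x] (mod int Q)"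
    proof -
      have "[x' - x = (b + h * \<alpha> y s j) - (b + h * \<alpha> y s i)] (mod int Q)"
        unfolding i(2) j(2) by (intro cong_diff) simp_all
      then show ?thesis by (simp add: algebra_simps cong_sym)
    qed
    have chi_h: "\<chi> (h * d) = \<chi> d" if "\<not> int Q dvd d" for d
      using chi_mult[OF h(1) that] chi_less[OF that] h(2) by simp
    \<comment> \<open>With \<open>j < i\<close> the reversed difference would also have a class
      below \<open>e\<close>, but negation adds \<open>e\<close> to the class.\<close>
    have "i < j"
    proof (rule ccontr)
      assume "\<not> i < j"
      then have ji: "j < i" using \<open>i \<noteq> j\<close> by simp
      have "[- (h * (\<alpha> y s j - \<alpha> y s i)) = - (x' - x)] (mod int Q)" using diff by (simp only: cong_minus_minus_iff)
      then have "[h * (\<alpha> y s i - \<alpha> y s j) = - (x' - x)] (mod int Q)" by (simp add: algebra_simps)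
      then have "\<chi> (- (x' - x)) = \<chi> (\<alpha> y s i - \<alpha> y s j)"
        using chi_cong chi_h[OF \<alpha>(1)[OF ji i(1)]] by metis
      then have "\<chi> (- (x' - x)) < e" using \<alpha>(2)[OF ji i(1)] \<rho>_less by simp
      moreover have "\<chi> (- (x' - x)) = e + \<chi> (x' - x)"
        unfolding chi_neg[OF nd] using x(4) m by simp
      ultimately show False by simp
    qed
    moreover have "\<chi> (x' - x) = \<rho> y s i j"
      using chi_cong[OF diff] chi_h[OF \<alpha>(1)[OF \<open>i < j\<close> j(1)]] \<alpha>(2)[OF \<open>i < j\<close> j(1)] by metis
    ultimately show ?thesis using diff i j ys by (simp add: \<rho>_def)
  qed
  have ex: "\<exists>p\<in>P. (x, \<sigma>) \<in> \<beta> p \<and> (x', \<sigma>') \<in> \<beta> p"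
    if x: "x \<in> {0..<int Q}" "x' \<in> {0..<int Q}" "x \<noteq> x'" "\<chi> (x' - x) < e" and \<sigma>: "\<sigma> < t" "\<sigma>' < t"
    for x x' \<sigma> \<sigma>'
  proof -
    have nd: "\<not> int Q dvd x' - x"
    proof
      assume "int Q dvd x' - x"
      then have "[x' = x] (mod int Q)" by (simp add: cong_iff_dvd_diff)
      then show False using x by (simp add: cong_def)
    qed
    have "\<chi> (x' - x) \<in> \<iota> ` (hits as t \<times> {..<c})" using bij_betw_imp_surj_on[OF \<iota>] x(4) by simp
    then obtain q where q: "q \<in> hits as t \<times> {..<c}" "\<iota> q = \<chi> (x' - x)" by (rule imageE) simp
    then obtain y0 i j s where y0: "y0 \<in> ?Y" "i < j" "j < ?k" "s < c" "q = (hit as y0 i j, s)"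
      unfolding hits_def by blast
    have ik: "i < ?k" using y0 by simp
    obtain xi li where xi: "xi < t" "xi mod as ! i = y0 i mod as ! i" "li < as ! i" "(xi + li) mod t = \<sigma>"
      using ex_shift[OF dvd[OF ik] _ \<sigma>(1), of "y0 i mod as ! i"] pos[OF ik] by auto
    obtain xj lj where xj: "xj < t" "xj mod as ! j = y0 j mod as ! j" "lj < as ! j" "(xj + lj) mod t = \<sigma>'"
      using ex_shift[OF dvd[OF y0(3)] _ \<sigma>(2), of "y0 j mod as ! j"] pos[OF y0(3)] by auto
    \<comment> \<open>Only the entries \<open>i\<close> and \<open>j\<close> move, each within its
      residue class modulo the size of its part, so the hit stays the same.\<close>
    define y where "y = y0(i := xi, j := xj)"
    have y: "y \<in> ?Y" using y0(1,3) ik xi(1) xj(1) unfolding shifts_def y_def by (auto simp: PiE_iff extensional_def)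
    have yi: "y i = xi" "y j = xj" unfolding y_def using y0(2) by auto
    have hit: "hit as y i j = hit as y0 i j"
      unfolding hit_def using xi(2) xj(2) yi by (auto simp: y_def restrict_def fun_eq_iff)
    let ?d = "\<alpha> y s j - \<alpha> y s i"
    have \<rho>: "\<chi> ?d = \<chi> (x' - x)"
      using \<alpha>(2)[OF y0(2,3)] q(2) y y0 hit by (simp add: \<rho>_def)
    have d: "\<not> int Q dvd ?d" by (rule \<alpha>(1)[OF y0(2,3)])
    then have "coprime ?d (int Q)" using prime_int_Q by (simp add: coprime_commute prime_imp_coprime)
    then obtain g where g: "[?d * g = 1] (mod int Q)" using cong_solve_coprime_int by blast
    define h where "h = (g * (x' - x)) mod int Q"
    have "[h * ?d = g * (x' - x) * ?d] (mod int Q)" unfolding h_def by (rule cong_scalar_right) simp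
    also have "g * (x' - x) * ?d = (?d * g) * (x' - x)" by (simp add: mult_ac)
    also have "[\<dots> = 1 * (x' - x)] (mod int Q)" by (rule cong_scalar_right[OF g])
    finally have hd: "[h * ?d = x' - x] (mod int Q)" by simp
    have ndh: "\<not> int Q dvd h" using cong_dvd_iff[OF hd] nd by auto
    have "\<chi> (x' - x) = (\<chi> h + \<chi> ?d) mod m" using chi_cong[OF hd] chi_mult[OF ndh d] by simp
    then have "[\<chi> h + \<chi> ?d = 0 + \<chi> ?d] (mod m)" using \<rho> chi_less[OF d] by (simp add: cong_def)
    then have "[\<chi> h = 0] (mod m)" by (simp only: cong_add_rcancel_nat)
    then have "\<chi> h = 0" using chi_less[OF ndh] by (simp add: cong_def)
    then have H: "h \<in> H" unfolding H_def using ndh Q_gt_1 by (simp add: h_def)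
    define b where "b = (x - h * \<alpha> y s i) mod int Q"
    have p: "(y, s, h, b) \<in> P" unfolding P_def using y y0(4) H Q_gt_1 by (simp add: b_def)
    have bx: "[b + h * \<alpha> y s i = x] (mod int Q)"
    proof -
      have "[b + h * \<alpha> y s i = (x - h * \<alpha> y s i) + h * \<alpha> y s i] (mod int Q)"
        unfolding b_def by (rule cong_add) simp_all
      then show ?thesis by simp
    qed
    have "[(b + h * \<alpha> y s i) + h * ?d = x + (x' - x)] (mod int Q)" by (rule cong_add[OF bx hd])
    then have bx': "[b + h * \<alpha> y s j = x'] (mod int Q)" by (simp add: algebra_simps)
    have "(x, \<sigma>) = f (y, s, h, b) (i, li)" unfolding f_def using bx x(1) xi(4) yi by (simp add: cong_def)
    moreover have "(x', \<sigma>') = f (y, s, h, b) (j, lj)" unfolding f_def using bx' x(2) xj(4) yi by (simp add: cong_def)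
    moreover have "(i, li) \<in> mp_verts as" "(j, lj) \<in> mp_verts as" using ik y0(3) xi(3) xj(3) by auto
    ultimately show ?thesis unfolding \<beta>_def using p by blast
  qed
  have uniq: "p = p'"
    if x: "x \<in> {0..<int Q}" "x' \<in> {0..<int Q}" "x \<noteq> x'" "\<chi> (x' - x) < e"
      and pp: "p \<in> P" "p' \<in> P" "(x, \<sigma>) \<in> \<beta> p" "(x', \<sigma>') \<in> \<beta> p" "(x, \<sigma>) \<in> \<beta> p'" "(x', \<sigma>') \<in> \<beta> p'"
    for x x' \<sigma> \<sigma>' p p'
  proof -
    obtain y s h b where p: "p = (y, s, h, b)" by (metis prod_cases4)
    obtain y' s' h' b' where p': "p' = (y', s', h', b')" by (metis prod_cases4)
    have P: "(y, s, h, b) \<in> P" "(y', s', h', b') \<in> P" using pp p p' by auto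
    obtain i l where i: "i < ?k" "l < as ! i" "x = (b + h * \<alpha> y s i) mod int Q" "\<sigma> = (y i + l) mod t"
      using pp(3) unfolding p \<beta>_def f_def by auto
    obtain j l1 where j: "j < ?k" "l1 < as ! j" "x' = (b + h * \<alpha> y s j) mod int Q" "\<sigma>' = (y j + l1) mod t"
      using pp(4) unfolding p \<beta>_def f_def by auto
    obtain i' l' where i': "i' < ?k" "l' < as ! i'" "x = (b' + h' * \<alpha> y' s' i') mod int Q" "\<sigma> = (y' i' + l') mod t"
      using pp(5) unfolding p' \<beta>_def f_def by auto
    obtain j' l1' where j': "j' < ?k" "l1' < as ! j'" "x' = (b' + h' * \<alpha> y' s' j') mod int Q" "\<sigma>' = (y' j' + l1') mod t"
      using pp(6) unfolding p' \<beta>_def f_def by auto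
    note F = forward[OF P(1) x i(1,3) j(1,3)]
    note F' = forward[OF P(2) x i'(1,3) j'(1,3)]
    have Y: "y \<in> ?Y" "s < c" "y' \<in> ?Y" "s' < c" using P unfolding P_def by auto
    have "(hit as y i j, s) = (hit as y' i' j', s')"
    proof (rule inj_onD[OF bij_betw_imp_inj_on[OF \<iota>]])
      show "\<iota> (hit as y i j, s) = \<iota> (hit as y' i' j', s')" using F F' by simp
      show "(hit as y i j, s) \<in> hits as t \<times> {..<c}" "(hit as y' i' j', s') \<in> hits as t \<times> {..<c}"
        using F F' Y unfolding hits_def by blast+
    qed
    then have eq: "s = s'" "i = i'" "j = j'" "y i mod as ! i = y' i mod as ! i" "y j mod as ! j = y' j mod as ! j"
      "restrict y ({..<?k} - {i, j}) = restrict y' ({..<?k} - {i, j})"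
      unfolding hit_def by auto
    have lt: "y r < t" "y' r < t" if "r < ?k" for r using Y that unfolding shifts_def by (auto simp: PiE_iff)
    have "y i = y' i"
      by (rule shift_unique[where l' = l', OF dvd[OF i(1)] lt(1)[OF i(1)] lt(2)[OF i(1)] i(2) _ eq(4)])
        (use i i' eq in auto)
    moreover have "y j = y' j"
      by (rule shift_unique[where l' = l1', OF dvd[OF j(1)] lt(1)[OF j(1)] lt(2)[OF j(1)] j(2) _ eq(5)])
        (use j j' eq in auto)
    moreover have "y r = y' r" if "r \<in> {..<?k} - {i, j}" for r
      using fun_cong[OF eq(6), of r] that by (simp only: restrict_apply' if_True)
    ultimately have "y r = y' r" if "r \<in> {..<?k}" for r using that by blast
    then have yy: "y = y'" using Y unfolding shifts_def by (blast intro: PiE_ext)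
    let ?d = "\<alpha> y s j - \<alpha> y s i"
    have d: "coprime ?d (int Q)"
      using \<alpha>(1)[of i j y s] F prime_int_Q by (simp add: coprime_commute prime_imp_coprime)
    have "[h * ?d = x' - x] (mod int Q)" "[h' * ?d = x' - x] (mod int Q)" using F F' yy eq by auto
    then have "[h * ?d = h' * ?d] (mod int Q)" by (metis cong_sym cong_trans)
    then have "[h = h'] (mod int Q)" using d by (metis cong_mult_rcancel)
    then have hh: "h = h'" using P unfolding P_def H_def by (simp add: cong_def)
    have "[b + h * \<alpha> y s i = b' + h * \<alpha> y s i] (mod int Q)"
      using i(3) i'(3) yy eq hh by (simp add: cong_def)
    then have "[b = b'] (mod int Q)" by (simp add: cong_add_rcancel)
    then have "b = b'" using P unfolding P_def by (simp add: cong_def)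
    then show ?thesis using p p' yy hh eq by simp
  qed
  have cases: "\<chi> (x' - x) < e \<or> \<chi> (x - x') < e"
    if x: "x \<in> {0..<int Q}" "x' \<in> {0..<int Q}" "x \<noteq> x'" for x x'
  proof -
    have nd: "\<not> int Q dvd x' - x"
    proof
      assume "int Q dvd x' - x"
      then have "[x' = x] (mod int Q)" by (simp add: cong_iff_dvd_diff)
      then show False using x by (simp add: cong_def)
    qed
    have "\<chi> (x - x') = (e + \<chi> (x' - x)) mod m" using chi_neg[OF nd] by simp
    moreover have "\<chi> (x' - x) < m" by (rule chi_less[OF nd])
    ultimately show ?thesis using m by (cases "\<chi> (x' - x) < e") (auto simp: mod_if)
  qed
  show ?thesis
  proof (rule decomposableI[of P \<beta>])
    fix p assume "p \<in> P"
    obtain y s h b where p: "p = (y, s, h, b)" by (metis prod_cases4)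
    have h: "\<not> int Q dvd h" using \<open>p \<in> P\<close> unfolding p P_def H_def by auto
    show "\<beta> p \<subseteq> {0..<int Q} \<times> {..<t}"
      unfolding \<beta>_def p f_def using Q_gt_1 t by auto
    have fst_f: "fst (f p (i, l)) = fst (f p (i', l')) \<longleftrightarrow> i = i'" if "i < ?k" "i' < ?k" for i l i' l'
    proof
      assume "fst (f p (i, l)) = fst (f p (i', l'))"
      then have "[b + h * \<alpha> y s i = b + h * \<alpha> y s i'] (mod int Q)" by (simp add: f_def p cong_def)
      then have "int Q dvd h * (\<alpha> y s i - \<alpha> y s i')" by (simp add: cong_iff_dvd_diff algebra_simps)
      then have "int Q dvd \<alpha> y s i - \<alpha> y s i'" using h prime_int_Q by (simp add: prime_dvd_mult_iff)
      then show "i = i'" using \<alpha>_ne[of i' i y s] that by (cases "i = i'") simp_all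
    qed (simp add: f_def p)
    have "inj_on (f p) (mp_verts as)"
    proof (rule inj_onI)
      fix u v assume uv: "u \<in> mp_verts as" "v \<in> mp_verts as" "f p u = f p v"
      obtain i l i' l' where u: "u = (i, l)" "v = (i', l')" by fastforce
      have lt: "i < ?k" "i' < ?k" "l < as ! i" "l' < as ! i'" using uv u by auto
      have ii: "i = i'" using fst_f[OF lt(1,2)] uv(3) u by metis
      have "(y i + l) mod t = (y i + l') mod t" using uv(3) u ii by (simp add: f_def p)
      then have "[y i + l = y i + l'] (mod t)" by (simp add: cong_def)
      then have "[l = l'] (mod t)" by (simp add: cong_add_lcancel_nat)
      moreover have "as ! i \<le> t" using dvd[OF lt(1)] t by (simp add: dvd_imp_le)
      ultimately have "l = l'" using lt ii by (simp add: cong_def)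
      then show "u = v" using u ii by simp
    qed
    then have "bij_betw (f p) (mp_verts as) (\<beta> p)" unfolding \<beta>_def by (rule inj_on_imp_bij_betw)
    moreover have "\<forall>u\<in>mp_verts as. \<forall>v\<in>mp_verts as. cross (f p u) (f p v) \<longleftrightarrow> cross u v"
      using fst_f by auto
    ultimately show "\<exists>as\<in>{as}. multipartite_on as cross (\<beta> p)"
      unfolding multipartite_on_def by blast
  next
    fix u v assume uv: "u \<in> {0..<int Q} \<times> {..<t}" "v \<in> {0..<int Q} \<times> {..<t}" "cross u v"
    obtain x \<sigma> x' \<sigma>' where u: "u = (x, \<sigma>)" "v = (x', \<sigma>')" by fastforce
    have x: "x \<in> {0..<int Q}" "x' \<in> {0..<int Q}" "x \<noteq> x'" "\<sigma> < t" "\<sigma>' < t" using uv u by auto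
    consider "\<chi> (x' - x) < e" | "\<chi> (x - x') < e" using cases[OF x(1-3)] by blast
    then show "\<exists>p\<in>P. u \<in> \<beta> p \<and> v \<in> \<beta> p"
    proof cases
      case 1
      show ?thesis using ex[OF x(1-3) 1 x(4,5)] u by simp
    next
      case 2
      show ?thesis using ex[OF x(2,1) x(3)[symmetric] 2 x(5,4)] u by blast
    qed
    fix p q assume pq: "p \<in> P" "q \<in> P" "u \<in> \<beta> p" "v \<in> \<beta> p" "u \<in> \<beta> q" "v \<in> \<beta> q"
    consider "\<chi> (x' - x) < e" | "\<chi> (x - x') < e" using cases[OF x(1-3)] by blast
    then show "p = q"
    proof cases
      case 1
      show ?thesis by (rule uniq[OF x(1-3) 1 pq[unfolded u]])
    next
      case 2
      show ?thesis
        by (rule uniq[OF x(2,1) x(3)[symmetric] 2 pq(1,2,4,3,6,5)[unfolded u]])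
    qed
  qed
qed

end

text \<open>The index is \<open>l * 2 ^ f\<close> with \<open>2 ^ f\<close> the exact power of 2 in
  \<open>(Q - 1) div l\<close>, so it is known only after \<open>Q\<close>, while the threshold for
  \<open>Q\<close> depends on it. Since \<open>f < A\<close>, a prime beyond the sum of the finitely
  many thresholds serves in every case.\<close>

lemma ex_prime_clique_blowup:
  fixes as :: "nat list"
  assumes k: "length as \<ge> 2" and pos: "\<forall>a\<in>set as. a > 0"
  obtains Q t :: nat where "prime Q" "t > 0" "decomposable {as} ({..<Q} \<times> {..<t}) cross"
proof -
  define t where "t = prod_list as"
  have t: "t > 0" unfolding t_def using pos by (induction as) auto
  have dvd: "as ! i dvd t" if "i < length as" for i
    unfolding t_def using that by (simp add: prod_list_dvd)
  have pos': "as ! i > 0" if "i < length as" for i using pos that by simp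
  define l where "l = 2 * card (hits as t)"
  have l: "l > 0"
  proof -
    have "restrict (\<lambda>_. 0) {..<length as} \<in> shifts as t" unfolding shifts_def using t by simp
    moreover have "0 < (1::nat)" "1 < length as" using k by auto
    ultimately have "hit as (restrict (\<lambda>_. 0) {..<length as}) 0 1 \<in> hits as t"
      unfolding hits_def by blast
    then show ?thesis unfolding l_def using finite_hits[of as t] by (simp add: card_gt_0_iff) blast
  qed
  obtain A where A: "\<And>B. \<exists>p > B. prime p \<and> l dvd p - 1 \<and> \<not> 2 ^ A dvd p - 1"
    using infinitely_many_primes_cong_1[OF l] by blast
  have "\<forall>f. \<exists>Q0. \<forall>Q \<chi> (\<rho> :: nat \<Rightarrow> nat \<Rightarrow> nat). Q \<ge> Q0 \<longrightarrow> power_residue_classes Q (l * 2 ^ f) \<chi> \<longrightarrow>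
      (\<forall>i j. \<rho> i j < l * 2 ^ f) \<longrightarrow>
      (\<exists>\<alpha>. \<forall>j<length as. \<forall>i<j. \<not> int Q dvd \<alpha> j - \<alpha> i \<and> \<chi> (\<alpha> j - \<alpha> i) = \<rho> i j)"
  proof
    fix f
    have "l * 2 ^ f > 0" using l by simp
    from ex_prescribed_differences[OF this, of "length as"] obtain Q0 where
      "\<And>Q \<chi> (\<rho> :: nat \<Rightarrow> nat \<Rightarrow> nat). Q \<ge> Q0 \<Longrightarrow> power_residue_classes Q (l * 2 ^ f) \<chi> \<Longrightarrow> (\<And>i j. \<rho> i j < l * 2 ^ f) \<Longrightarrow>
        \<exists>\<alpha>. \<forall>j<length as. \<forall>i<j. \<not> int Q dvd \<alpha> j - \<alpha> i \<and> \<chi> (\<alpha> j - \<alpha> i) = \<rho> i j" by blast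
    then show "\<exists>Q0. \<forall>Q \<chi> (\<rho> :: nat \<Rightarrow> nat \<Rightarrow> nat). Q \<ge> Q0 \<longrightarrow> power_residue_classes Q (l * 2 ^ f) \<chi> \<longrightarrow>
      (\<forall>i j. \<rho> i j < l * 2 ^ f) \<longrightarrow>
      (\<exists>\<alpha>. \<forall>j<length as. \<forall>i<j. \<not> int Q dvd \<alpha> j - \<alpha> i \<and> \<chi> (\<alpha> j - \<alpha> i) = \<rho> i j)"
      by (intro exI[of _ Q0]) simp
  qed
  from choice[OF this] obtain Q0 where
    Q0: "\<forall>f Q \<chi> (\<rho> :: nat \<Rightarrow> nat \<Rightarrow> nat). Q \<ge> Q0 f \<longrightarrow> power_residue_classes Q (l * 2 ^ f) \<chi> \<longrightarrow>
      (\<forall>i j. \<rho> i j < l * 2 ^ f) \<longrightarrow>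
      (\<exists>\<alpha>. \<forall>j<length as. \<forall>i<j. \<not> int Q dvd \<alpha> j - \<alpha> i \<and> \<chi> (\<alpha> j - \<alpha> i) = \<rho> i j)" ..
  obtain Q where Q: "Q > (\<Sum>f<A. Q0 f)" "prime Q" "l dvd Q - 1" "\<not> 2 ^ A dvd Q - 1"
    using A by blast
  obtain s where s: "Q - 1 = l * s" using Q(3) by (auto simp: dvd_def)
  have "s \<noteq> 0" using s prime_gt_1_nat[OF Q(2)] by (intro notI) simp
  define f where "f = multiplicity 2 s"
  obtain o' where o': "s = 2 ^ f * o'" "\<not> 2 dvd o'"
    using multiplicity_decompose'[of s 2] \<open>s \<noteq> 0\<close> unfolding f_def by auto
  define m where "m = l * 2 ^ f"
  have m: "Q - 1 = m * o'" unfolding m_def using s o' by simp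
  have m0: "m > 0" unfolding m_def using l by simp
  have "f < A"
  proof (rule ccontr)
    assume "\<not> f < A"
    then have "2 ^ A dvd (2 ^ f :: nat)" by (simp add: le_imp_power_dvd)
    then show False using Q(4) m unfolding m_def by (metis dvd_mult dvd_mult2)
  qed
  then have "Q0 f \<le> Q" using Q(1) member_le_sum[of f "{..<A}" Q0] by simp
  obtain \<chi> where \<chi>: "power_residue_classes Q m \<chi>"
    and neg: "\<And>e. m = 2 * e \<Longrightarrow> odd ((Q - 1) div m) \<Longrightarrow> \<chi> (- 1) = e"
    using ex_power_residue_classes[OF Q(2), of m] m by (metis dvd_triv_left)
  have "decomposable {as} ({0..<int Q} \<times> {..<t}) cross"
  proof (rule power_residue_classes.decomposable_blowup_of_prime_clique[OF \<chi>])
    show me: "m = 2 * (card (hits as t) * 2 ^ f)" unfolding m_def l_def by simp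
    show "\<chi> (- 1) = card (hits as t) * 2 ^ f" using neg[OF me] m m0 o' by simp
    fix \<rho> :: "nat \<Rightarrow> nat \<Rightarrow> nat" assume "\<And>i j. \<rho> i j < m"
    then show "\<exists>\<alpha>. \<forall>j<length as. \<forall>i<j. \<not> int Q dvd \<alpha> j - \<alpha> i \<and> \<chi> (\<alpha> j - \<alpha> i) = \<rho> i j"
      using Q0[rule_format, of f Q \<chi> \<rho>] \<open>Q0 f \<le> Q\<close> \<chi> unfolding m_def by simp
  qed (use dvd pos' t in auto)
  moreover have "bij_betw (map_prod nat id) ({0..<int Q} \<times> {..<t}) ({..<Q} \<times> {..<t})"
  proof (rule bij_betw_map_prod)
    show "bij_betw nat {0..<int Q} {..<Q}"
      by (rule bij_betw_byWitness[where f' = int]) auto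
  qed simp
  ultimately have "decomposable {as} ({..<Q} \<times> {..<t}) cross"
    by (rule decomposable_transfer) auto
  then show thesis using that Q(2) t by blast
qed

section \<open>Linearly many missing edges\<close>

text \<open>Handles orders that are not multiples of the fibre size: each of the at most
  \<open>k\<close> new vertices lies in at most \<open>2 * (n + r)\<close> ordered pairs.\<close>

lemma near_complete_add_isolated:
  assumes nc: "near_complete L c n" and r: "r \<le> k"
  shows "near_complete L (c + 2 * k) (n + r)"
proof -
  obtain E where E: "symp E" "irreflp E" "decomposable L {..<n} E"
    and miss: "card {(x, y). x < n \<and> y < n \<and> \<not> E x y} \<le> c * n"
    using nc unfolding near_complete_def by blast
  define E' where "E' x y \<longleftrightarrow> x < n \<and> y < n \<and> E x y" for x y
  have "symp E'" "irreflp E'" using E unfolding E'_def symp_def irreflp_def by blast+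
  moreover have "decomposable L {..<n + r} E'"
  proof -
    from E(3) obtain \<B> where B: "\<And>B. B \<in> \<B> \<Longrightarrow> B \<subseteq> {..<n} \<and> (\<exists>as\<in>L. multipartite_on as E B)"
      and ex: "\<And>x y. x \<in> {..<n} \<Longrightarrow> y \<in> {..<n} \<Longrightarrow> E x y \<Longrightarrow> \<exists>!B. B \<in> \<B> \<and> x \<in> B \<and> y \<in> B"
      by (rule decomposableE) (rule that)
    show ?thesis
      unfolding decomposable_def
    proof (intro exI[of _ \<B>] conjI ballI impI)
      fix B assume "B \<in> \<B>"
      note B = B[OF this]
      then show "B \<subseteq> {..<n + r}" by auto
      obtain as where "as \<in> L" "multipartite_on as E B" using B by blast
      moreover have "multipartite_on as E' (id ` B)" if "multipartite_on as E B" for as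
        by (rule multipartite_on_transfer[OF that]) (use B in \<open>auto simp: E'_def\<close>)
      ultimately show "\<exists>as\<in>L. multipartite_on as E' B" by auto
    next
      fix x y assume "E' x y"
      then show "\<exists>!B. B \<in> \<B> \<and> x \<in> B \<and> y \<in> B" using ex[of x y] unfolding E'_def by simp
    qed
  qed
  moreover have "card {(x, y). x < n + r \<and> y < n + r \<and> \<not> E' x y} \<le> (c + 2 * k) * (n + r)"
  proof -
    let ?M = "{(x, y). x < n \<and> y < n \<and> \<not> E x y}"
    let ?R = "{n..<n + r} \<times> {..<n + r}" and ?S = "{..<n + r} \<times> {n..<n + r}"
    have fin: "finite ?M" by (rule finite_subset[of _ "{..<n} \<times> {..<n}"]) auto
    have "{(x, y). x < n + r \<and> y < n + r \<and> \<not> E' x y} \<subseteq> ?M \<union> (?R \<union> ?S)"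
      unfolding E'_def by auto
    then have "card {(x, y). x < n + r \<and> y < n + r \<and> \<not> E' x y} \<le> card (?M \<union> (?R \<union> ?S))"
      using fin by (intro card_mono) auto
    also have "\<dots> \<le> card ?M + (card ?R + card ?S)"
      by (meson card_Un_le add_left_mono le_trans)
    also have "\<dots> \<le> c * n + (r * (n + r) + (n + r) * r)" using miss by (simp add: card_cartesian_product)
    also have "\<dots> \<le> c * (n + r) + (k * (n + r) + (n + r) * k)"
      using r by (intro add_mono mult_le_mono) auto
    finally show ?thesis by (simp add: algebra_simps)
  qed
  ultimately show ?thesis unfolding near_complete_def by blast
qed

text \<open>A missed pair becomes \<open>t * t\<close> missed pairs while the order grows by the
  factor \<open>t\<close>. Pairs inside a fibre come from the diagonal, which is counted.\<close>

lemma near_complete_blowup: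
  assumes nc: "near_complete (clique ` K) c n"
    and ingr: "\<And>s. s \<in> K \<Longrightarrow> decomposable L ({..<s} \<times> {..<t}) cross"
  shows "near_complete L (c * t) (n * t)"
proof -
  obtain E where E: "symp E" "irreflp E" "decomposable (clique ` K) {..<n} E"
    and miss: "card {(x, y). x < n \<and> y < n \<and> \<not> E x y} \<le> c * n"
    using nc unfolding near_complete_def by blast
  show ?thesis
  proof (rule near_completeI)
    show "decomposable L ({..<n} \<times> {..<t}) (\<lambda>p q. E (fst p) (fst q))"
      by (rule decomposable_blowup[OF E(3) ingr])
    show "symp (\<lambda>p q :: nat \<times> nat. E (fst p) (fst q))" "irreflp (\<lambda>p q :: nat \<times> nat. E (fst p) (fst q))"
      using E by (auto simp: symp_def irreflp_def)
    let ?M = "{(x, y). x < n \<and> y < n \<and> \<not> E x y}"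
    have fin: "finite ?M" by (rule finite_subset[of _ "{..<n} \<times> {..<n}"]) auto
    have "{(p, q). p \<in> {..<n} \<times> {..<t} \<and> q \<in> {..<n} \<times> {..<t} \<and> \<not> E (fst p) (fst q)}
        \<subseteq> (\<lambda>((x, y), (a, b)). ((x, a), (y, b))) ` (?M \<times> ({..<t} \<times> {..<t}))"
      by (force simp: image_iff)
    then have "card {(p, q). p \<in> {..<n} \<times> {..<t} \<and> q \<in> {..<n} \<times> {..<t} \<and> \<not> E (fst p) (fst q)}
        \<le> card (?M \<times> ({..<t} \<times> {..<t}))"
      using fin by (intro surj_card_le) auto
    also have "\<dots> = card ?M * (t * t)" by (simp add: card_cartesian_product)
    also have "\<dots> \<le> c * n * (t * t)" by (rule mult_le_mono1[OF miss])
    finally show "card {(p, q). p \<in> {..<n} \<times> {..<t} \<and> q \<in> {..<n} \<times> {..<t} \<and> \<not> E (fst p) (fst q)}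
        \<le> c * t * (n * t)" by (simp add: mult_ac)
  qed (simp_all add: card_cartesian_product)
qed

section \<open>Back from relations to graphs and the extremal number\<close>

lemma verts_complete_multipartite: "verts (complete_multipartite as) = mp_verts as"
  by (simp add: complete_multipartite_def Let_def)

lemma edge_complete_multipartite_iff:
  assumes "u \<in> mp_verts as" "v \<in> mp_verts as"
  shows "{u, v} \<in> edges (complete_multipartite as) \<longleftrightarrow> fst u \<noteq> fst v"
proof
  assume "{u, v} \<in> edges (complete_multipartite as)"
  then obtain u' v' where "{u, v} = {u', v'}" "fst u' \<noteq> fst v'"
    unfolding complete_multipartite_def Let_def by auto
  then show "fst u \<noteq> fst v" by (auto simp: doubleton_eq_iff)
next
  assume "fst u \<noteq> fst v"
  then show "{u, v} \<in> edges (complete_multipartite as)"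
    using assms unfolding complete_multipartite_def Let_def ugraph.select_convs mem_Collect_eq by blast
qed

text \<open>Blocks become induced subgraphs on their vertex sets, and uniqueness of the block
  through an edge becomes edge-disjointness. Every non-edge is the unordered form of a missed
  pair.\<close>

lemma ex_bar_le_if_near_complete:
  assumes nc: "near_complete {as} c n"
  shows "ex_bar n (complete_multipartite as) \<le> int (c * n)"
proof -
  let ?F = "complete_multipartite as"
  obtain E where E: "symp E" "irreflp E" "decomposable {as} {..<n} E"
    and miss: "card {(x, y). x < n \<and> y < n \<and> \<not> E x y} \<le> c * n"
    using nc unfolding near_complete_def by blast
  from E(3) obtain \<B> where B: "\<And>B. B \<in> \<B> \<Longrightarrow> B \<subseteq> {..<n} \<and> (\<exists>as\<in>{as}. multipartite_on as E B)"
    and ex: "\<And>x y. x \<in> {..<n} \<Longrightarrow> y \<in> {..<n} \<Longrightarrow> E x y \<Longrightarrow> \<exists>!B. B \<in> \<B> \<and> x \<in> B \<and> y \<in> B"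
    by (rule decomposableE) (rule that)
  define M where "M = {{x, y} | x y. x < n \<and> y < n \<and> E x y}"
  define G where "G = \<lparr>verts = {..<n}, edges = M\<rparr>"
  define H where "H B = \<lparr>verts = B, edges = {e \<in> M. e \<subseteq> B}\<rparr>" for B
  have M_iff: "{x, y} \<in> M \<longleftrightarrow> E x y" if "x < n" "y < n" for x y
    using that E(1) unfolding M_def by (auto simp: doubleton_eq_iff symp_def)
  have "e \<subseteq> {..<n} \<and> card e = 2" if "e \<in> M" for e
  proof -
    obtain x y where e: "e = {x, y}" "x < n" "y < n" "E x y" using \<open>e \<in> M\<close> unfolding M_def by blast
    then have "x \<noteq> y" using E(2) by (auto simp: irreflp_def)
    then show ?thesis using e by simp
  qed
  then have "simple_graph G" unfolding simple_graph_def G_def by auto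
  moreover have "induced_decomposition ?F G (H ` \<B>)"
    unfolding induced_decomposition_def
  proof (intro conjI ballI impI)
    have "\<B> \<subseteq> Pow {..<n}" using B by blast
    then show "finite (H ` \<B>)" by (meson finite_Pow_iff finite_imageI finite_lessThan finite_subset)
  next
    fix K assume "K \<in> H ` \<B>"
    then obtain B' where K: "K = H B'" "B' \<in> \<B>" by blast
    have sub: "B' \<subseteq> {..<n}" and mp: "multipartite_on as E B'" using B[OF K(2)] by auto
    show "induced_subgraph K G" unfolding induced_subgraph_def K H_def G_def using sub by simp
    obtain f where f: "bij_betw f (mp_verts as) B'"
      and Ef: "\<And>u v. u \<in> mp_verts as \<Longrightarrow> v \<in> mp_verts as \<Longrightarrow> E (f u) (f v) \<longleftrightarrow> fst u \<noteq> fst v"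
      using mp unfolding multipartite_on_def by blast
    define g where "g = inv_into (mp_verts as) f"
    have g: "bij_betw g B' (mp_verts as)" unfolding g_def by (rule bij_betw_inv_into[OF f])
    have gmem: "g x \<in> mp_verts as" and fg: "f (g x) = x" if "x \<in> B'" for x
      using bij_betw_apply[OF g that] bij_betw_inv_into_right[OF f that] unfolding g_def by simp_all
    show "graph_iso K ?F"
      unfolding graph_iso_def
    proof (intro exI[of _ g] conjI ballI)
      show "bij_betw g (verts K) (verts ?F)" unfolding verts_complete_multipartite K H_def using g by simp
      fix x y assume "x \<in> verts K" "y \<in> verts K"
      then have xy: "x \<in> B'" "y \<in> B'" unfolding K H_def by simp_all
      have "{x, y} \<in> edges K \<longleftrightarrow> E x y"
        unfolding K H_def using xy sub M_iff[of x y] by auto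
      also have "\<dots> \<longleftrightarrow> fst (g x) \<noteq> fst (g y)"
        using Ef[OF gmem[OF xy(1)] gmem[OF xy(2)]] fg xy by simp
      also have "\<dots> \<longleftrightarrow> {g x, g y} \<in> edges ?F"
        by (rule edge_complete_multipartite_iff[OF gmem[OF xy(1)] gmem[OF xy(2)], symmetric])
      finally show "{x, y} \<in> edges K \<longleftrightarrow> {g x, g y} \<in> edges ?F" .
    qed
  next
    fix K K' assume "K \<in> H ` \<B>" "K' \<in> H ` \<B>" "K \<noteq> K'"
    then obtain B1 B2 where K: "K = H B1" "K' = H B2" "B1 \<in> \<B>" "B2 \<in> \<B>" "B1 \<noteq> B2" by blast
    show "edges K \<inter> edges K' = {}"
    proof (rule ccontr)
      assume "edges K \<inter> edges K' \<noteq> {}"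
      then obtain x y where "x < n" "y < n" "E x y" "{x, y} \<subseteq> B1" "{x, y} \<subseteq> B2"
        unfolding K H_def M_def by auto
      then show False using ex[of x y] K(3-5) by auto
    qed
  next
    show "(\<Union>K\<in>H ` \<B>. edges K) = edges G"
    proof
      show "(\<Union>K\<in>H ` \<B>. edges K) \<subseteq> edges G" unfolding H_def G_def by auto
      show "edges G \<subseteq> (\<Union>K\<in>H ` \<B>. edges K)"
      proof
        fix e assume "e \<in> edges G"
        then have eM: "e \<in> M" unfolding G_def by simp
        then obtain x y where e: "e = {x, y}" "x < n" "y < n" "E x y" unfolding M_def by blast
        then obtain B' where "B' \<in> \<B>" "x \<in> B'" "y \<in> B'" using ex[of x y] by blast
        then show "e \<in> (\<Union>K\<in>H ` \<B>. edges K)" using eM e unfolding H_def by auto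
      qed
    qed
  qed
  moreover have "card (verts G) = n" unfolding G_def by simp
  ultimately have "card (edges G) \<in> ex_set n ?F" unfolding ex_set_def by blast
  then have num: "card M \<le> ex_num n ?F"
    unfolding ex_num_def G_def using Max_ge[OF ex_set_finite] by simp
  have "n choose 2 = card {e. e \<subseteq> {..<n} \<and> card e = 2}" using n_subsets[of "{..<n}" 2] by simp
  also have "\<dots> \<le> card (M \<union> (\<lambda>(x, y). {x, y}) ` {(x, y). x < n \<and> y < n \<and> \<not> E x y})"
  proof (rule card_mono)
    have "M \<subseteq> Pow {..<n}" unfolding M_def by auto
    then have "finite M" by (meson finite_Pow_iff finite_lessThan finite_subset)
    moreover have "finite {(x, y). x < n \<and> y < n \<and> \<not> E x y}"
      by (rule finite_subset[of _ "{..<n} \<times> {..<n}"]) auto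
    ultimately show "finite (M \<union> (\<lambda>(x, y). {x, y}) ` {(x, y). x < n \<and> y < n \<and> \<not> E x y})" by simp
    show "{e. e \<subseteq> {..<n} \<and> card e = 2} \<subseteq> M \<union> (\<lambda>(x, y). {x, y}) ` {(x, y). x < n \<and> y < n \<and> \<not> E x y}"
    proof
      fix e assume "e \<in> {e. e \<subseteq> {..<n} \<and> card e = 2}"
      then obtain x y where e: "e = {x, y}" "x < n" "y < n" by (auto simp: card_2_iff)
      show "e \<in> M \<union> (\<lambda>(x, y). {x, y}) ` {(x, y). x < n \<and> y < n \<and> \<not> E x y}"
      proof (cases "E x y")
        case True
        then show ?thesis using M_iff e by simp
      next
        case False
        then have "e \<in> (\<lambda>(x, y). {x, y}) ` {(x, y). x < n \<and> y < n \<and> \<not> E x y}"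
          using e by (intro image_eqI[of _ _ "(x, y)"]) auto
        then show ?thesis by blast
      qed
    qed
  qed
  also have "\<dots> \<le> card M + card ((\<lambda>(x, y). {x, y}) ` {(x, y). x < n \<and> y < n \<and> \<not> E x y})"
    by (rule card_Un_le)
  also have "card ((\<lambda>(x, y). {x, y}) ` {(x, y). x < n \<and> y < n \<and> \<not> E x y}) \<le> c * n"
  proof -
    have "finite {(x, y). x < n \<and> y < n \<and> \<not> E x y}"
      by (rule finite_subset[of _ "{..<n} \<times> {..<n}"]) auto
    then show ?thesis using miss card_image_le le_trans by blast
  qed
  finally show ?thesis unfolding ex_bar_def using num by linarith
qed

theorem theorem2:
  fixes as :: "nat list"
  assumes "length as \<ge> 2"
    and "\<forall>a\<in>set as. a > 0"
  shows "\<exists>c::real. \<forall>n\<ge>card (verts (complete_multipartite as)).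
           of_int (ex_bar n (complete_multipartite as)) \<le> c * real n"
proof -
  obtain Q t :: nat where Q: "prime Q" and t: "t > 0"
    and dt: "decomposable {as} ({..<Q} \<times> {..<t}) cross"
    using ex_prime_clique_blowup[OF assms] by blast
  obtain w :: nat where w: "w > 0" and dw: "decomposable {clique Q} ({..<Q} \<times> {..<w}) cross"
    "decomposable {clique Q} ({..<Q + 1} \<times> {..<w}) cross"
    using ex_consecutive_clique_blowups[OF Q] by blast
  have "Q \<ge> 2" using Q by (rule prime_ge_2_nat)
  then obtain c where c: "\<And>n. near_complete (clique ` {Q, Q + 1}) c n"
    using ex_near_complete by blast
  have ingr: "decomposable {as} ({..<s} \<times> {..<w * t}) cross" if s: "s \<in> {Q, Q + 1}" for s
  proof -
    \<comment> \<open>\<open>dt\<close> treats only \<open>Q\<close> classes; cutting the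
      \<open>w\<close>-fold blow-up into cliques of order \<open>Q\<close> first brings the case of
      \<open>Q + 1\<close> classes within its reach.\<close>
    have "decomposable (clique ` {Q}) ({..<s} \<times> {..<w}) cross" using s dw by auto
    then have "decomposable {as} (({..<s} \<times> {..<w}) \<times> {..<t}) (\<lambda>p q. cross (fst p) (fst q))"
      by (rule decomposable_blowup) (use dt in simp)
    from decomposable_regroup[OF this] show ?thesis by simp
  qed
  let ?c = "c * (w * t) + 2 * (w * t)"
  have "near_complete {as} ?c n" for n
  proof -
    have "near_complete {as} (c * (w * t)) (n div (w * t) * (w * t))"
      by (rule near_complete_blowup[OF c ingr])
    then have "near_complete {as} ?c (n div (w * t) * (w * t) + n mod (w * t))"
      by (rule near_complete_add_isolated) (use w t in \<open>simp add: less_imp_le\<close>)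
    then show ?thesis by (simp only: div_mult_mod_eq)
  qed
  then have "ex_bar n (complete_multipartite as) \<le> int (?c * n)" for n
    by (rule ex_bar_le_if_near_complete)
  then have "real_of_int (ex_bar n (complete_multipartite as)) \<le> real ?c * real n" for n
    by (metis of_int_le_iff of_int_of_nat_eq of_nat_mult)
  then show ?thesis by blast
qed

end
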